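(* Let $\mathcal{M}$ be a $C^1$ manifold, $g$ a locally weakly bounded Riemannian metric on $\mathcal{M}$, $\mathcal{X}\subset\mathcal{M}$ locally compact, and $f$ a locally bounded vector field on $\mathcal{X}$. Then for every $x_0\in\mathcal{X}$ there exists a Krasovskii solution $x:[0,T)\to\mathcal{X}$, for some $T>0$, of $\dot x(t)\in\Pi_{\mathcal{X}}^{g}[f](x(t))$ with $x(0)=x_0$. Furthermore, if $\mathcal{X}$ is Clarke regular, and if $f$ and $g$ are continuous, then every Krasovskii solution is a Carathéodory solution and vice versa.
   Context: A $C^1$ manifold is a finite-dimensional locally Euclidean, second countable Hausdorff space with a $C^1$ differentiable structure. A Riemannian metric $g$ assigns to every $p\in\mathcal{M}$ an inner product on $T_p\mathcal{M}$ (no regularity is implied). A vector field on $\mathcal{X}$ assigns to each $x\in\mathcal{X}$ a vector $f(x)\in T_x\mathcal{M}$. All notions below are understood in local coordinates and are independent of the chart. In $\mathbb{R}^n$: a set is locally compact if it is the intersection of a closed and an open set. For a set $\mathcal{Y}\subset\mathbb{R}^n$ and $x\in\mathcal{Y}$, the tangent cone $T_x\mathcal{Y}$ is the set of $v$ for which there exist $x_k\in\mathcal{Y}$, $x_k\to x$, $\delta_k\to0^+$ with $(x_k-x)/\delta_k\to v$; the Clarke tangent cone is $T_x^C\mathcal{Y}:=\liminf_{y\to x}T_y\mathcal{Y}$, i.e. the set of $v$ such that for every sequence $x_k\in\mathcal{Y}$, $x_k\to x$, there are (for large $k$) $v_k\in T_{x_k}\mathcal{Y}$ with $v_k\to v$;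 $\mathcal{Y}$ is Clarke regular at $x$ if it is locally compact and $T_x\mathcal{Y}=T^C_x\mathcal{Y}$. A metric $g$ in coordinates has condition number $\kappa_{g(x)}=\max_{\|v\|=1}\|v\|_{g(x)}/\min_{\|v\|=1}\|v\|_{g(x)}$ and is locally weakly bounded if each point has a neighborhood on which $\ell\le\kappa_{g(y)}\le L$ for some $\ell,L>0$. A vector field is locally bounded if each point has a neighborhood on which it is bounded. On $\mathcal{M}$: $T_x\mathcal{X}\subset T_x\mathcal{M}$ is the set with $D_x\phi(T_x\mathcal{X})=T_{\phi(x)}\phi(\mathcal{X}\cap U)$ for any chart $(U,\phi)$ at $x$ (likewise $T_x^C\mathcal{X}$); $\mathcal{X}$ is Clarke regular if it is Clarke regular at each of its points in local coordinates. $f$ (resp. $g$) is locally bounded, (locally weakly bounded), continuous if it is so in local coordinates. A curve is absolutely continuous if it is so in every chart domain. Projected vector field: $\Pi_{\mathcal{X}}^{g}[f](x):=\arg\min_{v\in T_x\mathcal{X}}\|v-f(x)\|^2_{g(x)}\subset T_x\mathcal{M}$. Krasovskii regularization: $\mathrm{K}[F](x)$ is the closed convex hull in $T_x\mathcal{M}$ of the set of all limits (taken in local coordinates) $v=\lim v_k$ with $v_k\in F(x_k)$, $x_k\in\mathcal{X}$, $x_k\to x$. A Carathéodory (resp. Krasovskii) solution is an absolutely continuous $x:[0,T)\to\mathcal{X}$, $T>0$, with $x(0)=x_0$ and $\dot x(t)\in\Pi_{\mathcal{X}}^{g}[f](x(t))$ (resp. $\dot x(t)\in\mathrm{K}[\Pi_{\mathcal{X}}^{g}[f]](x(t))$)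 for almost all $t$. *)

theory Defs
  imports "HOL-Analysis.Analysis"
begin

section \<open>Notions in Euclidean space\<close>

definition C1_on :: "'e::euclidean_space set \<Rightarrow> ('e \<Rightarrow> 'e) \<Rightarrow> bool" where
  "C1_on S h \<longleftrightarrow> (\<exists>h' :: 'e \<Rightarrow> 'e \<Rightarrow>\<^sub>L 'e.
      (\<forall>y\<in>S. (h has_derivative blinfun_apply (h' y)) (at y)) \<and> continuous_on S h')"

definition locally_compact_set :: "'a::topological_space set \<Rightarrow> bool" where
  "locally_compact_set Y \<longleftrightarrow> (\<exists>C U. closed C \<and> open U \<and> Y = C \<inter> U)"

definition tangent_cone :: "'e::euclidean_space set \<Rightarrow> 'e \<Rightarrow> 'e set" where
  "tangent_cone Y y = {v. \<exists>(ys :: nat \<Rightarrow> 'e) (\<delta> :: nat \<Rightarrow> real).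
      (\<forall>k. ys k \<in> Y) \<and> ys \<longlonglongrightarrow> y \<and> (\<forall>k. \<delta> k > 0) \<and> \<delta> \<longlonglongrightarrow> 0 \<and>
      (\<lambda>k. (ys k - y) /\<^sub>R \<delta> k) \<longlonglongrightarrow> v}"

definition clarke_tangent_cone :: "'e::euclidean_space set \<Rightarrow> 'e \<Rightarrow> 'e set" where
  "clarke_tangent_cone Y y = {v. \<forall>ys :: nat \<Rightarrow> 'e. (\<forall>k. ys k \<in> Y) \<and> ys \<longlonglongrightarrow> y \<longrightarrow>
      (\<exists>vs. (\<forall>\<^sub>F k in sequentially. vs k \<in> tangent_cone Y (ys k)) \<and> vs \<longlonglongrightarrow> v)}"

definition clarke_regular_at :: "'e::euclidean_space set \<Rightarrow> 'e \<Rightarrow> bool" where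
  "clarke_regular_at Y y \<longleftrightarrow>
     locally_compact_set Y \<and> tangent_cone Y y = clarke_tangent_cone Y y"

definition locally_bounded_on :: "'e::euclidean_space set \<Rightarrow> ('e \<Rightarrow> 'e) \<Rightarrow> bool" where
  "locally_bounded_on Y h \<longleftrightarrow> (\<forall>y\<in>Y. \<exists>N. open N \<and> y \<in> N \<and> bounded (h ` (N \<inter> Y)))"

text \<open>For an inner product \<open>G\<close> the supremum and the infimum are a maximum and a
  positive minimum, because the unit sphere is compact and nonempty.\<close>

definition condition_number :: "('e::euclidean_space \<Rightarrow> 'e \<Rightarrow> real) \<Rightarrow> real" where
  "condition_number G =
     (SUP v\<in>sphere 0 1. sqrt (G v v)) / (INF v\<in>sphere 0 1. sqrt (G v v))"

definition krasovskii_Rn :: "'e::euclidean_space set \<Rightarrow> ('e \<Rightarrow> 'e set) \<Rightarrow> 'e \<Rightarrow> 'e set" where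
  "krasovskii_Rn Y F y = closure (convex hull {v. \<exists>(ys :: nat \<Rightarrow> 'e) vs.
      (\<forall>k. ys k \<in> Y \<and> vs k \<in> F (ys k)) \<and> ys \<longlonglongrightarrow> y \<and> vs \<longlonglongrightarrow> v})"

text \<open>The finite families of non-overlapping subintervals in the usual
  \<open>\<epsilon>\<close>-\<open>\<delta>\<close> definition are divisions of subsets of \<open>{a..b}\<close>.\<close>

definition absolutely_continuous_on_interval ::
    "real \<Rightarrow> real \<Rightarrow> (real \<Rightarrow> 'e::euclidean_space) \<Rightarrow> bool" where
  "absolutely_continuous_on_interval a b h \<longleftrightarrow>
     (\<forall>\<epsilon>>0. \<exists>\<delta>>0. \<forall>D S. D division_of S \<and> S \<subseteq> {a..b} \<and> (\<Sum>I\<in>D. Sup I - Inf I) < \<delta> \<longrightarrow>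
        (\<Sum>I\<in>D. norm (h (Sup I) - h (Inf I))) < \<epsilon>)"


section \<open>Manifolds of class C1\<close>

text \<open>The manifold is the whole type \<open>'a\<close>, with the classes \<open>t2_space\<close> and
  \<open>second_countable_topology\<close>, together with a maximal C1 atlas.  The model space
  is \<open>'e\<close>.  A chart is a pair \<open>(U, \<phi>)\<close>; the values of \<open>\<phi>\<close> outside \<open>U\<close> are irrelevant.\<close>

type_synonym ('a, 'e) chart = "'a set \<times> ('a \<Rightarrow> 'e)"

abbreviation chart_dom :: "('a, 'e) chart \<Rightarrow> 'a set" where
  "chart_dom c \<equiv> fst c"

abbreviation chart_map :: "('a, 'e) chart \<Rightarrow> 'a \<Rightarrow> 'e" where
  "chart_map c \<equiv> snd c"

definition chart_inv :: "('a, 'e) chart \<Rightarrow> 'e \<Rightarrow> 'a" where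
  "chart_inv c = inv_into (chart_dom c) (chart_map c)"

definition is_chart :: "('a::topological_space, 'e::euclidean_space) chart \<Rightarrow> bool" where
  "is_chart c \<longleftrightarrow> open (chart_dom c) \<and> open (chart_map c ` chart_dom c) \<and>
     homeomorphism (chart_dom c) (chart_map c ` chart_dom c) (chart_map c) (chart_inv c)"

definition transition :: "('a, 'e) chart \<Rightarrow> ('a, 'e) chart \<Rightarrow> 'e \<Rightarrow> 'e" where
  "transition c d = chart_map d \<circ> chart_inv c"

definition C1_compatible :: "('a, 'e::euclidean_space) chart \<Rightarrow> ('a, 'e) chart \<Rightarrow> bool" where
  "C1_compatible c d \<longleftrightarrow>
     C1_on (chart_map c ` (chart_dom c \<inter> chart_dom d)) (transition c d) \<and>
     C1_on (chart_map d ` (chart_dom c \<inter> chart_dom d)) (transition d c)"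

definition C1_structure ::
    "('a::{t2_space, second_countable_topology}, 'e::euclidean_space) chart set \<Rightarrow> bool" where
  "C1_structure A \<longleftrightarrow>
     (\<forall>c\<in>A. is_chart c) \<and> (\<Union>c\<in>A. chart_dom c) = UNIV \<and>
     (\<forall>c\<in>A. \<forall>d\<in>A. C1_compatible c d) \<and>
     (\<forall>c. is_chart c \<and> (\<forall>d\<in>A. C1_compatible c d) \<longrightarrow> c \<in> A)"

definition charts_at :: "('a, 'e) chart set \<Rightarrow> 'a \<Rightarrow> ('a, 'e) chart set" where
  "charts_at A p = {c \<in> A. p \<in> chart_dom c}"

text \<open>A tangent vector at \<open>p\<close> is the family of its coordinate representations in the charts
  at \<open>p\<close>, which transform by the derivatives of the transition maps.  Thus the evaluation
  \<open>\<lambda>v. v c\<close> is the differential at \<open>p\<close> of the chart \<open>c\<close>, and the linear structure is pointwise.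
  The family is set to \<open>0\<close> at the other charts, so that equal tangent vectors are equal
  functions.\<close>

type_synonym ('a, 'e) tvec = "('a, 'e) chart \<Rightarrow> 'e"

definition tangent_space ::
    "('a, 'e::euclidean_space) chart set \<Rightarrow> 'a \<Rightarrow> ('a, 'e) tvec set" where
  "tangent_space A p = {v.
     (\<forall>c\<in>charts_at A p. \<forall>d\<in>charts_at A p.
        v d = frechet_derivative (transition c d) (at (chart_map c p)) (v c)) \<and>
     (\<forall>c. c \<notin> charts_at A p \<longrightarrow> v c = 0)}"

definition from_coord ::
    "('a, 'e::euclidean_space) chart set \<Rightarrow> ('a, 'e) chart \<Rightarrow> 'a \<Rightarrow> 'e \<Rightarrow> ('a, 'e) tvec" where
  "from_coord A c p = inv_into (tangent_space A p) (\<lambda>v. v c)"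

definition vector_field_on ::
    "('a, 'e::euclidean_space) chart set \<Rightarrow> 'a set \<Rightarrow> ('a \<Rightarrow> ('a, 'e) tvec) \<Rightarrow> bool" where
  "vector_field_on A X f \<longleftrightarrow> (\<forall>x\<in>X. f x \<in> tangent_space A x)"

definition field_coord ::
    "('a, 'e) chart \<Rightarrow> ('a \<Rightarrow> ('a, 'e) tvec) \<Rightarrow> 'e \<Rightarrow> 'e" where
  "field_coord c f y = f (chart_inv c y) c"

definition locally_bounded_field ::
    "('a, 'e::euclidean_space) chart set \<Rightarrow> 'a set \<Rightarrow> ('a \<Rightarrow> ('a, 'e) tvec) \<Rightarrow> bool" where
  "locally_bounded_field A X f \<longleftrightarrow>
     (\<forall>c\<in>A. locally_bounded_on (chart_map c ` (X \<inter> chart_dom c)) (field_coord c f))"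

definition continuous_field ::
    "('a, 'e::euclidean_space) chart set \<Rightarrow> 'a set \<Rightarrow> ('a \<Rightarrow> ('a, 'e) tvec) \<Rightarrow> bool" where
  "continuous_field A X f \<longleftrightarrow>
     (\<forall>c\<in>A. continuous_on (chart_map c ` (X \<inter> chart_dom c)) (field_coord c f))"


section \<open>Riemannian metrics\<close>

definition inner_product_on ::
    "('a, 'e::real_vector) tvec set \<Rightarrow> (('a, 'e) tvec \<Rightarrow> ('a, 'e) tvec \<Rightarrow> real) \<Rightarrow> bool" where
  "inner_product_on V B \<longleftrightarrow>
     (\<forall>u\<in>V. \<forall>v\<in>V. B u v = B v u) \<and>
     (\<forall>u\<in>V. \<forall>v\<in>V. \<forall>w\<in>V. B (\<lambda>c. u c + v c) w = B u w + B v w) \<and>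
     (\<forall>a. \<forall>u\<in>V. \<forall>v\<in>V. B (\<lambda>c. a *\<^sub>R u c) v = a * B u v) \<and>
     (\<forall>u\<in>V. u \<noteq> (\<lambda>c. 0) \<longrightarrow> B u u > 0)"

type_synonym ('a, 'e) metric = "'a \<Rightarrow> ('a, 'e) tvec \<Rightarrow> ('a, 'e) tvec \<Rightarrow> real"

definition riemannian_metric ::
    "('a, 'e::euclidean_space) chart set \<Rightarrow> ('a, 'e) metric \<Rightarrow> bool" where
  "riemannian_metric A g \<longleftrightarrow> (\<forall>p. inner_product_on (tangent_space A p) (g p))"

definition metric_coord ::
    "('a, 'e::euclidean_space) chart set \<Rightarrow> ('a, 'e) chart \<Rightarrow> ('a, 'e) metric \<Rightarrow>
     'e \<Rightarrow> 'e \<Rightarrow> 'e \<Rightarrow> real" where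
  "metric_coord A c g y u v =
     g (chart_inv c y) (from_coord A c (chart_inv c y) u) (from_coord A c (chart_inv c y) v)"

definition locally_weakly_bounded ::
    "('a, 'e::euclidean_space) chart set \<Rightarrow> ('a, 'e) metric \<Rightarrow> bool" where
  "locally_weakly_bounded A g \<longleftrightarrow>
     (\<forall>c\<in>A. \<forall>y\<in>chart_map c ` chart_dom c. \<exists>l>0. \<exists>L>0. \<forall>\<^sub>F z in nhds y.
        l \<le> condition_number (metric_coord A c g z) \<and>
        condition_number (metric_coord A c g z) \<le> L)"

text \<open>Continuity of the entries of the Gram matrix.\<close>

definition continuous_metric ::
    "('a, 'e::euclidean_space) chart set \<Rightarrow> ('a, 'e) metric \<Rightarrow> bool" where
  "continuous_metric A g \<longleftrightarrow>
     (\<forall>c\<in>A. \<forall>i\<in>Basis. \<forall>j\<in>Basis.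
        continuous_on (chart_map c ` chart_dom c) (\<lambda>y. metric_coord A c g y i j))"


section \<open>Projected vector fields and solutions\<close>

definition tangent_cone_mfd ::
    "('a, 'e::euclidean_space) chart set \<Rightarrow> 'a set \<Rightarrow> 'a \<Rightarrow> ('a, 'e) tvec set" where
  "tangent_cone_mfd A X x = {v \<in> tangent_space A x. \<forall>c\<in>charts_at A x.
     v c \<in> tangent_cone (chart_map c ` (X \<inter> chart_dom c)) (chart_map c x)}"

definition clarke_regular_mfd ::
    "('a, 'e::euclidean_space) chart set \<Rightarrow> 'a set \<Rightarrow> bool" where
  "clarke_regular_mfd A X \<longleftrightarrow> (\<forall>x\<in>X. \<forall>c\<in>charts_at A x.
     clarke_regular_at (chart_map c ` (X \<inter> chart_dom c)) (chart_map c x))"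

definition projected_field ::
    "('a, 'e::euclidean_space) chart set \<Rightarrow> 'a set \<Rightarrow> ('a, 'e) metric \<Rightarrow>
     ('a \<Rightarrow> ('a, 'e) tvec) \<Rightarrow> 'a \<Rightarrow> ('a, 'e) tvec set" where
  "projected_field A X g f x =
     {v. is_arg_min (\<lambda>w. g x (\<lambda>c. w c - f x c) (\<lambda>c. w c - f x c))
           (\<lambda>w. w \<in> tangent_cone_mfd A X x) v}"

definition krasovskii ::
    "('a, 'e::euclidean_space) chart set \<Rightarrow> 'a set \<Rightarrow> ('a \<Rightarrow> ('a, 'e) tvec set) \<Rightarrow>
     'a \<Rightarrow> ('a, 'e) tvec set" where
  "krasovskii A X F x = {v \<in> tangent_space A x. \<forall>c\<in>charts_at A x.
     v c \<in> krasovskii_Rn (chart_map c ` (X \<inter> chart_dom c))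
             (\<lambda>y. (\<lambda>w. w c) ` F (chart_inv c y)) (chart_map c x)}"

text \<open>A chart map need not be absolutely continuous up to the boundary of its domain, so the
  chart-independent condition is absolute continuity on the compact time intervals that the
  curve maps into the chart domain.  Continuity has to be required as well, since otherwise
  there may be no such intervals around a given time.\<close>

definition absolutely_continuous_curve ::
    "('a::topological_space, 'e::euclidean_space) chart set \<Rightarrow> real \<Rightarrow> (real \<Rightarrow> 'a) \<Rightarrow> bool" where
  "absolutely_continuous_curve A T x \<longleftrightarrow> continuous_on {0..<T} x \<and>
     (\<forall>c\<in>A. \<forall>a b. {a..b} \<subseteq> {0..<T} \<and> x ` {a..b} \<subseteq> chart_dom c \<longrightarrow>
        absolutely_continuous_on_interval a b (chart_map c \<circ> x))"

definition has_velocity ::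
    "('a, 'e::euclidean_space) chart set \<Rightarrow> real \<Rightarrow> (real \<Rightarrow> 'a) \<Rightarrow> real \<Rightarrow> ('a, 'e) tvec \<Rightarrow> bool" where
  "has_velocity A T x t v \<longleftrightarrow> v \<in> tangent_space A (x t) \<and>
     (\<forall>c\<in>charts_at A (x t).
        ((chart_map c \<circ> x) has_vector_derivative v c) (at t within {0..<T}))"

text \<open>A solution on \<open>{0..<T}\<close> of the differential inclusion with right-hand side \<open>F\<close>;
  the values of \<open>x\<close> outside \<open>{0..<T}\<close> are irrelevant.\<close>

definition caratheodory_solution ::
    "('a::topological_space, 'e::euclidean_space) chart set \<Rightarrow> 'a set \<Rightarrow>
     ('a \<Rightarrow> ('a, 'e) tvec set) \<Rightarrow> 'a \<Rightarrow> real \<Rightarrow> (real \<Rightarrow> 'a) \<Rightarrow> bool" where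
  "caratheodory_solution A X F x0 T x \<longleftrightarrow>
     T > 0 \<and> x ` {0..<T} \<subseteq> X \<and> absolutely_continuous_curve A T x \<and> x 0 = x0 \<and>
     (AE t in lebesgue_on {0..<T}. \<exists>v\<in>F (x t). has_velocity A T x t v)"

definition krasovskii_solution ::
    "('a::topological_space, 'e::euclidean_space) chart set \<Rightarrow> 'a set \<Rightarrow>
     ('a \<Rightarrow> ('a, 'e) tvec set) \<Rightarrow> 'a \<Rightarrow> real \<Rightarrow> (real \<Rightarrow> 'a) \<Rightarrow> bool" where
  "krasovskii_solution A X F x0 T x \<longleftrightarrow> caratheodory_solution A X (krasovskii A X F) x0 T x"

end

theory Submission
  imports Defs
begin

text \<open>
  Existence is a viability argument in one chart.  By the weak bound on the metric, the projected
  field has a bounded selection \<open>u\<close> with values in the tangent cones of the coordinate image \<open>Y\<close>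
  of \<open>X\<close>.  Compactness turns tangency into Euler steps in \<open>Y\<close> whose length is bounded below, and a
  cluster point of the Euler step functions is a Lipschitz curve \<open>x\<close> in \<open>Y\<close> such that the
  difference quotients of \<open>x\<close> between \<open>s\<close> and \<open>t\<close> lie in every closed convex set that contains
  the values of \<open>u\<close> near \<open>x s\<close>.  So, wherever \<open>x\<close> is differentiable, and this is almost
  everywhere, its velocity lies in the Krasovskii regularization.

  If \<open>X\<close> is Clarke regular, the same viability argument, applied to tangent vectors close to a given
  one, shows that the tangent cones are convex.  Hence \<open>f - \<eta>\<close> is normal to the tangent cone for
  every projection \<open>\<eta>\<close> of \<open>f\<close>, and by continuity this linear condition passes to the Krasovskii
  regularization.  A velocity \<open>v\<close> of a curve in \<open>X\<close> is tangent together with \<open>- v\<close>, so \<open>f - v\<close>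
  is normal to the tangent cone and orthogonal to \<open>v\<close>, which makes \<open>v\<close> a projection of \<open>f\<close>.
\<close>

section \<open>Differentiability of Lipschitz curves\<close>

text \<open>The tangent cones need not be convex, so projections need not be unique, and nothing is
  known about the selection \<open>u\<close> beyond its bound: neither continuity nor measurability.
  Hence no integral of \<open>u\<close> occurs. The inclusion is carried by difference quotients
  instead: an Euler increment is an average of values of \<open>u\<close> up to a small error, and
  lying in a closed convex set survives pointwise limits. With a ball as the set this gives the
  Lipschitz bound; with neighbourhoods of the Krasovskii set it gives the inclusion.

  Only the condition number of the metric matters for the bound on projections, because rescaling
  the metric at a point changes neither the minimizers nor the comparison with the tangent vector 0.

  Clarke regularity enters twice: a tangent vector at the limit point is a limit of tangent vectors
  at the approximating points, and at these points it makes projections satisfy the linear normal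
  condition.

  The notions on the manifold quantify over all charts. Each is reduced to one arbitrary chart by
  the chain rule for transition maps.\<close>

lemma vitali_covering_intervals:
  fixes E U :: "real set" and P :: "real \<Rightarrow> real \<Rightarrow> bool"
  assumes "open U" "E \<subseteq> U"
    and cov: "\<And>x d. x \<in> E \<Longrightarrow> d > 0 \<Longrightarrow> \<exists>a b. a < b \<and> x \<in> {a..b} \<and> b - a < d \<and> P a b"
  obtains C where "countable C" "\<And>i. i \<in> C \<Longrightarrow> fst i < snd i \<and> {fst i..snd i} \<subseteq> U \<and> P (fst i) (snd i)"
    "disjoint_family_on (\<lambda>i. {fst i..snd i}) C" "negligible (E - (\<Union>i\<in>C. {fst i..snd i}))"
proof -
  define K where "K = {i::real \<times> real. fst i < snd i \<and> {fst i..snd i} \<subseteq> U \<and> P (fst i) (snd i)}"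
  \<comment> \<open>Intervals are closed balls around their midpoints. The covering theorem for
    balls only wants \<open>x\<close> inside the ball, so intervals with endpoint \<open>x\<close>
    are admissible.\<close>
  define a r where "a = (\<lambda>i::real \<times> real. (fst i + snd i) / 2)" and "r = (\<lambda>i::real \<times> real. (snd i - fst i) / 2)"
  have cb: "cball (a i) (r i) = {fst i..snd i}" for i
    unfolding a_def r_def cball_eq_atLeastAtMost by (simp add: field_simps)
  have "\<exists>i. i \<in> K \<and> x \<in> cball (a i) (r i) \<and> r i < d" if x: "x \<in> E" and d: "0 < d" for x d
  proof -
    obtain e where e: "e > 0" "ball x e \<subseteq> U"
      using assms(1,2) x open_contains_ball by blast
    obtain u v where uv: "u < v" "x \<in> {u..v}" "v - u < min d e" "P u v"
      using cov[OF x, of "min d e"] d e by auto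
    have "{u..v} \<subseteq> ball x e"
      using uv by (auto simp: dist_real_def)
    then have "(u, v) \<in> K"
      using uv e by (auto simp: K_def)
    then show ?thesis
      using uv by (intro exI[of _ "(u,v)"]) (auto simp: cb, auto simp: r_def)
  qed
  then obtain C where C: "countable C" "C \<subseteq> K"
     "pairwise (\<lambda>i j. disjnt (cball (a i) (r i)) (cball (a j) (r j))) C"
     "negligible (E - (\<Union>i \<in> C. cball (a i) (r i)))"
    by (rule Vitali_covering_theorem_cballs[of K r E a, rotated]) (auto simp: K_def r_def)
  show thesis
  proof
    show "disjoint_family_on (\<lambda>i. {fst i..snd i}) C"
      using C(3) unfolding cb disjoint_family_on_def pairwise_def disjnt_def by blast
  qed (use C in \<open>auto simp: cb K_def subset_iff\<close>)
qed

text \<open>With \<open>s\<close> the outer measure of \<open>E\<close>, a Vitali cover by intervals of small slope bounds the increase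
  of \<open>F\<close> near \<open>E\<close> by \<open>p * (s + e)\<close>, and a second Vitali cover inside the first one, by intervals
  of large slope, bounds it below by \<open>q * s\<close>.\<close>

lemma negligible_two_slopes:
  fixes F :: "real \<Rightarrow> real"
  assumes F: "mono F" "continuous_on UNIV F" and pq: "0 < p" "p < q" and "bounded E"
    and lo: "\<And>x d. x \<in> E \<Longrightarrow> d > 0 \<Longrightarrow>
      \<exists>a b. a < b \<and> x \<in> {a..b} \<and> b - a < d \<and> F b - F a \<le> p * (b - a)"
    and hi: "\<And>x d. x \<in> E \<Longrightarrow> d > 0 \<Longrightarrow>
      \<exists>a b. a < b \<and> x \<in> {a..b} \<and> b - a < d \<and> q * (b - a) \<le> F b - F a"
  shows "negligible E"
proof -
  \<comment> \<open>The Stieltjes measure of \<open>F\<close> turns increments of \<open>F\<close>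
    into measures of intervals, so increments over countable disjoint families add up and can be
    compared by inclusion.\<close>
  define \<nu> where "\<nu> = interval_measure F"
  have \<nu>: "emeasure \<nu> {a..b} = ennreal (F b - F a)" if "a \<le> b" for a b
    unfolding \<nu>_def using F that
    by (intro emeasure_interval_measure_Icc) (auto simp: mono_def)
  have sets_\<nu>[simp, measurable_cong]: "sets \<nu> = sets borel"
    by (simp add: \<nu>_def)
  have sum: "emeasure \<mu> (\<Union>i\<in>C. {fst i..snd i}) = (\<integral>\<^sup>+ i. emeasure \<mu> {fst i..snd i} \<partial>count_space C)"
    if "sets \<mu> = sets borel" "countable C" "disjoint_family_on (\<lambda>i. {fst i..snd i}) C"
    for \<mu> :: "real measure" and C
    using that by (intro emeasure_UN_countable) auto
  \<comment> \<open>\<open>E\<close> is not known to be measurable; its measurable hull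
    \<open>H\<close> has the same outer measure.\<close>
  obtain H where H: "H \<in> sets lebesgue" "E \<subseteq> H" "outer_measure_of lebesgue E = emeasure lebesgue H"
    using outer_measure_of_attain[of E lebesgue] by auto
  define s where "s = emeasure lebesgue H"
  have s_le: "s \<le> emeasure lebesgue B" if "B \<in> sets lebesgue" "E \<subseteq> B" for B
    using outer_measure_of_mono[OF that(2), of lebesgue] that(1) H by (simp add: s_def)
  obtain N where "\<forall>x\<in>E. norm x \<le> N"
    using \<open>bounded E\<close> unfolding bounded_iff by blast
  then have N: "E \<subseteq> cball 0 N"
    by auto
  have "s \<le> emeasure lebesgue (cball (0::real) N)"
    using N by (intro s_le) auto
  also have "\<dots> < \<infinity>"
    using lmeasurable_cball[of "0::real" N] by (auto simp: fmeasurable_def)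
  finally have "s < \<infinity>" .
  then obtain S where S: "s = ennreal S" "S \<ge> 0"
    by (cases s) auto
  have key: "q * S \<le> p * (S + e)" if e: "e > 0" for e
  proof -
    obtain U where U: "open U" "H \<subseteq> U" "U - H \<in> lmeasurable" "emeasure lebesgue (U - H) < ennreal e"
      using sets_lebesgue_outer_open[OF H(1) e] .
    have "emeasure lebesgue U = emeasure lebesgue (H \<union> (U - H))"
      using U by (simp add: Un_absorb1)
    also have "\<dots> \<le> s + emeasure lebesgue (U - H)"
      unfolding s_def using H U by (intro emeasure_subadditive) auto
    also have "\<dots> \<le> ennreal S + ennreal e"
      using U S by (intro add_mono) auto
    finally have Us: "emeasure lborel U \<le> ennreal (S + e)"
      using S e U(1) by (simp add: ennreal_plus)
    have EU: "E \<subseteq> U" using H U by auto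
    obtain C where C: "countable C"
      "\<And>i. i \<in> C \<Longrightarrow> fst i < snd i \<and> {fst i..snd i} \<subseteq> U \<and> F (snd i) - F (fst i) \<le> p * (snd i - fst i)"
      "disjoint_family_on (\<lambda>i. {fst i..snd i}) C" "negligible (E - (\<Union>i\<in>C. {fst i..snd i}))"
      by (rule vitali_covering_intervals[OF U(1) EU, of "\<lambda>a b. F b - F a \<le> p * (b - a)"],
          (rule lo; assumption), (rule that; assumption))
    \<comment> \<open>Passing to open intervals makes room for the second cover inside the first
      one. It loses only the endpoints, which are countably many.\<close>
    define V where "V = (\<Union>i\<in>C. {fst i<..<snd i})"
    have "open V"
      unfolding V_def by auto
    obtain D where D: "countable D"
      "\<And>i. i \<in> D \<Longrightarrow> fst i < snd i \<and> {fst i..snd i} \<subseteq> V \<and> q * (snd i - fst i) \<le> F (snd i) - F (fst i)"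
      "disjoint_family_on (\<lambda>i. {fst i..snd i}) D" "negligible (E \<inter> V - (\<Union>i\<in>D. {fst i..snd i}))"
      by (rule vitali_covering_intervals[OF \<open>open V\<close> inf_le2, of E "\<lambda>a b. q * (b - a) \<le> F b - F a"],
          (rule hi[OF IntD1]; assumption), (rule that; assumption))
    define I J where "I = (\<Union>i\<in>C. {fst i..snd i})" and "J = (\<Union>i\<in>D. {fst i..snd i})"
    have "E - V \<subseteq> (E - I) \<union> (fst ` C \<union> snd ` C)"
      unfolding V_def I_def by (force simp: less_le)
    moreover have "negligible (fst ` C \<union> snd ` C)"
      using C(1) unfolding negligible_iff_null_sets
      by (intro null_sets_completionI countable_imp_null_set_lborel) auto
    ultimately have "negligible (E - V)"
      using C(4) unfolding I_def by (meson negligible_Un negligible_subset)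
    then have "negligible ((E - V) \<union> (E \<inter> V - J))"
      using D(4) by (intro negligible_Un) (auto simp: J_def)
    then have EJ: "negligible (E - J)"
      by (rule negligible_subset) auto
    have Jb: "J \<in> sets borel" "I \<in> sets borel"
      unfolding J_def I_def using C(1) D(1) by (auto intro!: sets.countable_UN')
    have "s \<le> emeasure lebesgue (J \<union> (E - J))"
      using Jb EJ by (intro s_le sets.Un) (auto simp: negligible_iff_null_sets)
    also have "\<dots> = emeasure lborel J"
      using Jb EJ by (subst emeasure_Un_null_set) (auto simp: negligible_iff_null_sets)
    finally have sJ: "s \<le> emeasure lborel J" .
    have "q * emeasure lborel J = (\<integral>\<^sup>+ i. q * emeasure lborel {fst i..snd i} \<partial>count_space D)"
      unfolding J_def by (subst sum[OF _ D(1,3)]) (simp_all add: nn_integral_cmult)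
    also have "\<dots> \<le> (\<integral>\<^sup>+ i. emeasure \<nu> {fst i..snd i} \<partial>count_space D)"
    proof (rule nn_integral_mono)
      fix i assume "i \<in> space (count_space D)"
      then have i: "fst i < snd i" "q * (snd i - fst i) \<le> F (snd i) - F (fst i)"
        using D(2) by auto
      have "ennreal q * emeasure lborel {fst i..snd i} = ennreal (q * (snd i - fst i))"
        using i(1) pq by (simp add: ennreal_mult)
      also have "\<dots> \<le> ennreal (F (snd i) - F (fst i))"
        using i(2) by (rule ennreal_leI)
      finally show "ennreal q * emeasure lborel {fst i..snd i} \<le> emeasure \<nu> {fst i..snd i}"
        using \<nu>[OF less_imp_le[OF i(1)]] by simp
    qed
    also have "\<dots> = emeasure \<nu> J"
      unfolding J_def by (subst sum[OF _ D(1,3)]) auto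
    also have "\<dots> \<le> emeasure \<nu> I"
    proof (rule emeasure_mono)
      show "J \<subseteq> I"
      proof -
        have "J \<subseteq> V" using D(2) unfolding J_def by blast
        also have "V \<subseteq> I" unfolding V_def I_def by (intro UN_mono) auto
        finally show ?thesis .
      qed
    qed (use Jb in simp)
    also have "\<dots> = (\<integral>\<^sup>+ i. emeasure \<nu> {fst i..snd i} \<partial>count_space C)"
      unfolding I_def by (subst sum[OF _ C(1,3)]) auto
    also have "\<dots> \<le> (\<integral>\<^sup>+ i. p * emeasure lborel {fst i..snd i} \<partial>count_space C)"
    proof (rule nn_integral_mono)
      fix i assume "i \<in> space (count_space C)"
      then have i: "fst i < snd i" "F (snd i) - F (fst i) \<le> p * (snd i - fst i)"
        using C(2) by auto
      have "ennreal (F (snd i) - F (fst i)) \<le> ennreal (p * (snd i - fst i))"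
        using i(2) by (rule ennreal_leI)
      also have "\<dots> = ennreal p * emeasure lborel {fst i..snd i}"
        using i(1) pq by (simp add: ennreal_mult)
      finally show "emeasure \<nu> {fst i..snd i} \<le> ennreal p * emeasure lborel {fst i..snd i}"
        using \<nu>[OF less_imp_le[OF i(1)]] by simp
    qed
    also have "\<dots> = p * emeasure lborel I"
      unfolding I_def by (subst sum[OF _ C(1,3)]) (simp_all add: nn_integral_cmult)
    also have "\<dots> \<le> p * emeasure lborel U"
      using C(2) Jb U(1) by (intro mult_left_mono emeasure_mono) (auto simp: I_def)
    also have "\<dots> \<le> ennreal p * ennreal (S + e)"
      using Us by (intro mult_left_mono) auto
    finally have "ennreal q * ennreal S \<le> ennreal p * ennreal (S + e)"
      using sJ S by (meson mult_left_mono order_trans zero_le)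
    then have "ennreal (q * S) \<le> ennreal (p * (S + e))"
      using pq S e by (simp add: ennreal_mult del: ennreal_plus)
    then show ?thesis
      using pq S e by (simp add: ennreal_le_iff)
  qed
  have "S = 0"
  proof (rule ccontr)
    assume "S \<noteq> 0"
    then have "S > 0" using S by auto
    \<comment> \<open>The choice of \<open>e\<close> adds exactly half of \<open>(q - p) * S\<close>
      to \<open>p * S\<close>, which is too little to reach \<open>q * S\<close>.\<close>
    moreover have "(q - p) * S \<le> (q - p) * S / 2"
      using key[of "(q - p) * S / (2 * p)"] pq \<open>S > 0\<close> by (simp add: field_simps)
    ultimately show False using pq by (simp add: field_simps)
  qed
  then have "H \<in> null_sets lebesgue"
    using H S by (simp add: s_def null_sets_def)
  then show ?thesis
    using H(2) negligible_iff_null_sets negligible_subset by blast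
qed

text \<open>The Lipschitz bound keeps the lower and upper limits of the difference quotients finite,
  so equality of the two would give a derivative. Rational numbers in the gap make the exceptional
  set a countable union.\<close>

lemma two_slopes_if_not_differentiable:
  fixes f :: "real \<Rightarrow> real"
  assumes lip: "L-lipschitz_on UNIV f" and nd: "\<not> f differentiable at x"
  obtains p q where "p \<in> \<rat>" "q \<in> \<rat>" "p < q"
    "\<exists>\<^sub>F y in at x. (f y - f x) / (y - x) < p" "\<exists>\<^sub>F y in at x. q < (f y - f x) / (y - x)"
proof -
  define Q where "Q = (\<lambda>y. ereal ((f y - f x) / (y - x)))"
  have bnd: "\<bar>(f y - f x) / (y - x)\<bar> \<le> L" for y
    using lipschitz_onD[OF lip, of y x] lipschitz_on_nonneg[OF lip]
    by (cases "y = x") (auto simp: dist_real_def abs_divide divide_le_eq)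
  have "Liminf (at x) Q \<noteq> Limsup (at x) Q"
  proof
    assume eq: "Liminf (at x) Q = Limsup (at x) Q"
    define l where "l = Liminf (at x) Q"
    have lim: "(Q \<longlongrightarrow> l) (at x)"
      using eq by (simp add: l_def tendsto_iff_Liminf_eq_Limsup)
    have b2: "(f y - f x) / (y - x) \<le> L" "- L \<le> (f y - f x) / (y - x)" for y
      using bnd[of y] by linarith+
    have "l \<le> ereal L" "ereal (- L) \<le> l"
      using b2 by (auto intro!: tendsto_upperbound[OF lim] tendsto_lowerbound[OF lim] simp: Q_def)
    then obtain r where "l = ereal r"
      by (cases l) auto
    then have "((\<lambda>y. (f y - f x) / (y - x)) \<longlongrightarrow> r) (at x)"
      using lim by (simp add: Q_def)
    then have "(f has_field_derivative r) (at x)"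
      by (simp add: has_field_derivative_iff)
    then show False
      using nd real_differentiable_def by blast
  qed
  then have lt: "Liminf (at x) Q < Limsup (at x) Q"
    using Liminf_le_Limsup[of "at x" Q] by (simp add: less_le)
  obtain a b where ab: "Liminf (at x) Q < ereal a" "a < b" "ereal b < Limsup (at x) Q"
    using lt by (metis ereal_dense2 less_ereal.simps(1))
  obtain p where p: "p \<in> \<rat>" "a < p" "p < b"
    using ab Rats_dense_in_real by blast
  obtain q where q: "q \<in> \<rat>" "p < q" "q < b"
    using p Rats_dense_in_real by blast
  show thesis
  proof
    show "\<exists>\<^sub>F y in at x. (f y - f x) / (y - x) < p"
    proof (rule ccontr)
      assume "\<not> ?thesis"
      then have "\<forall>\<^sub>F y in at x. ereal p \<le> Q y"
        by (simp add: not_frequently not_less Q_def)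
      then have "ereal p \<le> Liminf (at x) Q"
        by (rule Liminf_bounded)
      then show False using ab p
        by (meson less_ereal.simps(1) not_less order.strict_trans)
    qed
    show "\<exists>\<^sub>F y in at x. q < (f y - f x) / (y - x)"
    proof (rule ccontr)
      assume "\<not> ?thesis"
      then have "\<forall>\<^sub>F y in at x. Q y \<le> ereal q"
        by (simp add: not_frequently not_less Q_def)
      then have "Limsup (at x) Q \<le> ereal q"
        by (rule Limsup_bounded)
      then show False using ab q
        by (meson less_ereal.simps(1) not_less order.strict_trans)
    qed
  qed (use p q in auto)
qed

lemma lipschitz_real_differentiable_ae:
  fixes f :: "real \<Rightarrow> real"
  assumes lip: "L-lipschitz_on UNIV f"
  shows "negligible {x. \<not> f differentiable at x}"
proof -
  define Q where "Q = (\<lambda>x y. (f y - f x) / (y - x))"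
  \<comment> \<open>The cut-off \<open>N\<close> makes each set bounded; over rational slopes and
    natural \<open>N\<close> the family is countable.\<close>
  define E where "E = (\<lambda>p q (N::nat). {x. \<bar>x\<bar> \<le> N \<and> (\<exists>\<^sub>F y in at x. Q x y < p) \<and> (\<exists>\<^sub>F y in at x. q < Q x y)})"
  \<comment> \<open>Adding \<open>L * x\<close> makes the function monotone and shifts all slopes by
    \<open>L\<close>. If \<open>p + L\<close> is not positive, no slope of \<open>f\<close> lies
    below \<open>p\<close>.\<close>
  define F where "F = (\<lambda>x. f x + L * x)"
  have L0: "L \<ge> 0" using lip lipschitz_on_nonneg by blast
  have bnd: "- L \<le> Q x y" for x y
    using lipschitz_onD[OF lip, of y x] L0
    by (cases "x < y"; cases "x = y") (auto simp: dist_real_def Q_def field_simps abs_if split: if_splits)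
  have "mono F"
  proof (rule monoI)
    fix x y :: real assume "x \<le> y"
    then show "F x \<le> F y"
      using lipschitz_onD[OF lip, of y x] by (auto simp: F_def dist_real_def algebra_simps)
  qed
  have "continuous_on UNIV F"
    unfolding F_def using lipschitz_on_continuous_on[OF lip] by (intro continuous_intros) auto
  have slope: "F b - F a = (Q a b + L) * (b - a)" "F b - F a = (Q b a + L) * (b - a)" if "a < b" for a b
    using that by (auto simp: F_def Q_def field_simps)
  have neg: "negligible (E p q N)" if "p < q" for p q N
  proof (cases "p + L > 0")
    case False
    then have "\<not> Q x y < p" for x y
      using bnd[of x y] by linarith
    then have "E p q N = {}"
      by (auto simp: E_def)
    then show ?thesis by simp
  next
    case True
    show ?thesis
    proof (rule negligible_two_slopes[of F "p + L" "q + L"])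
    have cover: "\<exists>a b. a < b \<and> x \<in> {a..b} \<and> b - a < d \<and> R (Q a b) \<and> Q a b = Q b a"
      if R: "\<exists>\<^sub>F y in at x. R (Q x y)" "d > 0" for x d R
    proof -
      obtain y where y: "y \<noteq> x" "dist y x < d" "R (Q x y)"
        using R by (auto simp: frequently_def eventually_at)
      have "Q y x = Q x y" by (simp add: Q_def field_simps) (metis minus_diff_eq minus_divide_divide)
      then show ?thesis
        using y by (intro exI[of _ "min x y"] exI[of _ "max x y"]) (auto simp: dist_real_def min_def max_def)
    qed
    show "\<exists>a b. a < b \<and> x \<in> {a..b} \<and> b - a < d \<and> F b - F a \<le> (p + L) * (b - a)"
      if xd: "x \<in> E p q N" "d > 0" for x d
    proof -
      obtain a b where ab: "a < b" "x \<in> {a..b}" "b - a < d" "Q a b < p"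
        using cover[where x = x and d = d and R = "\<lambda>z. z < p"] xd by (auto simp: E_def)
      then have "F b - F a \<le> (p + L) * (b - a)"
        using slope(1)[of a b] by (simp add: mult_right_mono)
      then show ?thesis using ab by blast
    qed
    show "\<exists>a b. a < b \<and> x \<in> {a..b} \<and> b - a < d \<and> (q + L) * (b - a) \<le> F b - F a"
      if xd: "x \<in> E p q N" "d > 0" for x d
    proof -
      obtain a b where ab: "a < b" "x \<in> {a..b}" "b - a < d" "q < Q a b"
        using cover[where x = x and d = d and R = "\<lambda>z. q < z"] xd by (auto simp: E_def)
      then have "(q + L) * (b - a) \<le> F b - F a"
        using slope(1)[of a b] by (simp add: mult_right_mono)
      then show ?thesis using ab by blast
    qed
    show "bounded (E p q N)"
      by (rule bounded_subset[of "{- real N..real N}"]) (auto simp: E_def)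
    qed (use that True \<open>mono F\<close> \<open>continuous_on UNIV F\<close> in auto)
  qed
  have "{x. \<not> f differentiable at x} \<subseteq> (\<Union>(p,q,N)\<in>{(p,q,N). p \<in> \<rat> \<and> q \<in> \<rat> \<and> p < q}. E p q N)"
  proof
    fix x assume "x \<in> {x. \<not> f differentiable at x}"
    then obtain p q where "p \<in> \<rat>" "q \<in> \<rat>" "p < q" "\<exists>\<^sub>F y in at x. Q x y < p" "\<exists>\<^sub>F y in at x. q < Q x y"
      using two_slopes_if_not_differentiable[OF lip, of x] unfolding Q_def by blast
    moreover obtain N :: nat where "\<bar>x\<bar> \<le> N"
      using real_arch_simple by blast
    ultimately show "x \<in> (\<Union>(p,q,N)\<in>{(p,q,N). p \<in> \<rat> \<and> q \<in> \<rat> \<and> p < q}. E p q N)"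
      by (auto simp: E_def)
  qed
  moreover have "negligible (\<Union>(p,q,N)\<in>{(p,q,N::nat). p \<in> \<rat> \<and> q \<in> \<rat> \<and> p < q}. E p q N)"
  proof (rule negligible_countable_Union)
    have "countable (\<rat> \<times> \<rat> \<times> (UNIV :: nat set) :: (real \<times> real \<times> nat) set)"
      by (intro countable_SIGMA) (auto simp: countable_rat)
    then show "countable ((\<lambda>(p, q, N). E p q N) ` {(p, q, N::nat). p \<in> \<rat> \<and> q \<in> \<rat> \<and> p < q})"
      by (intro countable_image) (rule countable_subset[rotated], auto)
  qed (use neg in auto)
  ultimately show ?thesis
    using negligible_subset by blast
qed

lemma lipschitz_curve_differentiable_ae:
  fixes x :: "real \<Rightarrow> 'e::euclidean_space"
  assumes x: "L-lipschitz_on UNIV x"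
  shows "negligible {t. \<not> x differentiable at t}"
proof -
  have "L-lipschitz_on UNIV (\<lambda>t. x t \<bullet> i)" if i: "i \<in> Basis" for i
  proof (rule lipschitz_onI)
    fix s t
    have "dist (x s \<bullet> i) (x t \<bullet> i) \<le> norm (x s - x t)"
      using Basis_le_norm[OF i, of "x s - x t"] by (simp add: dist_real_def inner_diff_left)
    then show "dist (x s \<bullet> i) (x t \<bullet> i) \<le> L * dist s t"
      using lipschitz_onD[OF x, of s t] by (simp add: dist_norm)
  qed (rule lipschitz_on_nonneg[OF x])
  then have "negligible (\<Union>i\<in>Basis. {t. \<not> (\<lambda>t. x t \<bullet> i) differentiable at t})"
    by (intro negligible_countable_Union countable_image)
      (auto intro: lipschitz_real_differentiable_ae countable_finite)
  then show ?thesis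
    by (rule negligible_subset) (use differentiable_componentwise_within[of x _ UNIV] in auto)
qed

section \<open>Tangent cones\<close>

text \<open>Convergence of the points to \<open>y\<close> need not be demanded: \<open>z - y\<close>
  is \<open>h\<close> times a bounded quotient, so it tends to 0 with \<open>h\<close>. One
  \<open>\<epsilon>\<close> can bound both the step and the error.\<close>

lemma tangent_cone_iff:
  "v \<in> tangent_cone Y y \<longleftrightarrow>
     (\<forall>\<epsilon>>0. \<exists>h z. 0 < h \<and> h < \<epsilon> \<and> z \<in> Y \<and> norm ((z - y) /\<^sub>R h - v) < \<epsilon>)" (is "?L \<longleftrightarrow> ?R")
proof
  assume ?L
  then obtain ys \<delta> where y: "\<And>k. ys k \<in> Y" "\<And>k. \<delta> k > 0" "\<delta> \<longlonglongrightarrow> 0" "(\<lambda>k. (ys k - y) /\<^sub>R \<delta> k) \<longlonglongrightarrow> v"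
    by (auto simp: tangent_cone_def)
  show ?R
  proof (intro allI impI)
    fix \<epsilon> :: real assume \<epsilon>: "\<epsilon> > 0"
    have "\<forall>\<^sub>F k in sequentially. \<delta> k < \<epsilon>"
      using y(3) \<epsilon> by (rule order_tendstoD)
    moreover have "\<forall>\<^sub>F k in sequentially. norm ((ys k - y) /\<^sub>R \<delta> k - v) < \<epsilon>"
      using tendstoD[OF y(4) \<epsilon>] by (simp add: dist_norm)
    ultimately have "\<forall>\<^sub>F k in sequentially. \<delta> k < \<epsilon> \<and> norm ((ys k - y) /\<^sub>R \<delta> k - v) < \<epsilon>"
      by eventually_elim auto
    then obtain k where "\<delta> k < \<epsilon>" "norm ((ys k - y) /\<^sub>R \<delta> k - v) < \<epsilon>"
      using eventually_happens by fastforce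
    then show "\<exists>h z. 0 < h \<and> h < \<epsilon> \<and> z \<in> Y \<and> norm ((z - y) /\<^sub>R h - v) < \<epsilon>"
      using y(1,2)[of k] by blast
  qed
next
  assume R: ?R
  define \<epsilon> where "\<epsilon> n = 1 / real (Suc n)" for n
  have \<epsilon>: "0 < \<epsilon> n" "\<epsilon> n \<le> 1" for n by (auto simp: \<epsilon>_def)
  have \<epsilon>0: "\<epsilon> \<longlonglongrightarrow> 0" unfolding \<epsilon>_def by (rule LIMSEQ_inverse_real_of_nat[unfolded inverse_eq_divide])
  have "\<forall>n. \<exists>h z. 0 < h \<and> h < \<epsilon> n \<and> z \<in> Y \<and> norm ((z - y) /\<^sub>R h - v) < \<epsilon> n"
    using R \<epsilon>(1) by blast
  then obtain h z where hz: "\<And>n. 0 < h n" "\<And>n. h n < \<epsilon> n" "\<And>n. z n \<in> Y" "\<And>n. norm ((z n - y) /\<^sub>R h n - v) < \<epsilon> n"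
    by metis
  have h0: "h \<longlonglongrightarrow> 0"
    by (rule Lim_null_comparison[OF _ \<epsilon>0]) (use hz(1,2) in \<open>auto simp: less_imp_le abs_of_pos\<close>)
  have "(\<lambda>n. (z n - y) /\<^sub>R h n - v) \<longlonglongrightarrow> 0"
    by (rule Lim_null_comparison[OF _ \<epsilon>0]) (use hz(4) in \<open>auto simp: less_imp_le\<close>)
  then have lim: "(\<lambda>n. (z n - y) /\<^sub>R h n) \<longlonglongrightarrow> v" by (simp add: LIM_zero_iff)
  have "(\<lambda>n. y + h n *\<^sub>R ((z n - y) /\<^sub>R h n)) \<longlonglongrightarrow> y + 0 *\<^sub>R v"
    by (intro tendsto_intros h0 lim)
  moreover have "y + h n *\<^sub>R ((z n - y) /\<^sub>R h n) = z n" for n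
    using hz(1)[of n] by simp
  ultimately have "z \<longlonglongrightarrow> y" by simp
  then show ?L using hz h0 lim unfolding tangent_cone_def by blast
qed

lemma zero_in_tangent_cone: "y \<in> Y \<Longrightarrow> 0 \<in> tangent_cone Y y"
  unfolding tangent_cone_iff by (intro allI impI, rule_tac x="\<epsilon>/2" in exI, rule_tac x=y in exI) auto

lemma closed_tangent_cone: "closed (tangent_cone Y y)"
  unfolding closed_sequential_limits
proof (intro allI impI, elim conjE)
  fix w v assume w: "\<forall>n. w n \<in> tangent_cone Y y" "w \<longlonglongrightarrow> v"
  show "v \<in> tangent_cone Y y"
    unfolding tangent_cone_iff
  proof (intro allI impI)
    fix \<epsilon> :: real assume \<epsilon>: "\<epsilon> > 0"
    obtain n where n: "norm (w n - v) < \<epsilon>/2"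
      using LIMSEQ_D[OF w(2), of "\<epsilon>/2"] \<epsilon> by auto
    obtain h z where hz: "0 < h" "h < \<epsilon>/2" "z \<in> Y" "norm ((z - y) /\<^sub>R h - w n) < \<epsilon>/2"
      using w(1)[THEN spec, of n] \<epsilon> unfolding tangent_cone_iff by (meson half_gt_zero)
    have "norm ((z - y) /\<^sub>R h - v) < \<epsilon>"
      using norm_diff_triangle_less[OF hz(4) n] by simp
    then show "\<exists>h z. 0 < h \<and> h < \<epsilon> \<and> z \<in> Y \<and> norm ((z - y) /\<^sub>R h - v) < \<epsilon>"
      using hz(1-3) \<epsilon> by (intro exI[of _ h] exI[of _ z]) auto
  qed
qed

lemma tangent_cone_scaleR:
  assumes "v \<in> tangent_cone Y y" "a > 0"
  shows "a *\<^sub>R v \<in> tangent_cone Y y"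
  unfolding tangent_cone_iff
proof (intro allI impI)
  fix \<epsilon> :: real assume \<epsilon>: "\<epsilon> > 0"
  obtain h z where hz: "0 < h" "h < min (\<epsilon> * a) (\<epsilon> / a)" "z \<in> Y" "norm ((z - y) /\<^sub>R h - v) < min (\<epsilon> * a) (\<epsilon> / a)"
    using assms \<epsilon> unfolding tangent_cone_iff
    by (metis divide_pos_pos min_less_iff_conj mult_pos_pos)
  have "(z - y) /\<^sub>R (h / a) - a *\<^sub>R v = a *\<^sub>R ((z - y) /\<^sub>R h - v)"
    by (simp add: scaleR_right_diff_distrib divide_inverse mult.commute)
  then have "norm ((z - y) /\<^sub>R (h / a) - a *\<^sub>R v) < \<epsilon>"
    using hz(4) assms(2) by (simp add: pos_less_divide_eq mult.commute)
  moreover have "h / a < \<epsilon>" using hz(2) assms(2) by (simp add: pos_divide_less_eq)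
  ultimately show "\<exists>h z. 0 < h \<and> h < \<epsilon> \<and> z \<in> Y \<and> norm ((z - y) /\<^sub>R h - a *\<^sub>R v) < \<epsilon>"
    using hz(1,3) assms(2) by (intro exI[of _ "h / a"] exI[of _ z]) auto
qed

text \<open>Tangent cones depend only on the set near the point and are pushed forward by
  derivatives. Transition maps, defined well only on overlaps, are the intended use.\<close>

lemma tangent_cone_image:
  assumes h: "(h has_derivative D) (at y)" and "open N" "y \<in> N" and img: "h ` (Y \<inter> N) \<subseteq> Z"
    and v: "v \<in> tangent_cone Y y"
  shows "D v \<in> tangent_cone Z (h y)"
proof -
  obtain ys \<delta> where y: "\<And>k. ys k \<in> Y" "ys \<longlonglongrightarrow> y" "\<And>k. \<delta> k > 0" "\<delta> \<longlonglongrightarrow> 0"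
      "(\<lambda>k. (ys k - y) /\<^sub>R \<delta> k) \<longlonglongrightarrow> v"
    using v by (auto simp: tangent_cone_def)
  interpret D: bounded_linear D using h by (rule has_derivative_bounded_linear)
  \<comment> \<open>The relative remainder. Division by zero gives \<open>e y = 0\<close>, so
    \<open>e\<close> is continuous at \<open>y\<close> and sequences that hit \<open>y\<close> cause
    no trouble.\<close>
  define e where "e z = (h z - h y - D (z - y)) /\<^sub>R norm (z - y)" for z
  have "(e \<longlongrightarrow> 0) (at y)"
    using h unfolding has_derivative_def e_def by (simp add: Lim_ident_at)
  then have "isCont e y" by (simp add: isCont_def e_def)
  then have elim: "(\<lambda>k. e (ys k)) \<longlonglongrightarrow> 0"
    using isCont_tendsto_compose[OF _ y(2), of e] by (simp add: e_def)
  have split: "(h (ys k) - h y) /\<^sub>R \<delta> k = D ((ys k - y) /\<^sub>R \<delta> k) + norm ((ys k - y) /\<^sub>R \<delta> k) *\<^sub>R e (ys k)" for k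
  proof -
    have "norm (ys k - y) *\<^sub>R e (ys k) = h (ys k) - h y - D (ys k - y)"
      by (cases "ys k = y") (auto simp: e_def D.zero)
    then have "h (ys k) - h y = D (ys k - y) + norm (ys k - y) *\<^sub>R e (ys k)" by simp
    then show ?thesis
      using y(3)[of k] by (simp add: D.scaleR scaleR_right_distrib)
  qed
  have "(\<lambda>k. (h (ys k) - h y) /\<^sub>R \<delta> k) \<longlonglongrightarrow> D v + norm v *\<^sub>R 0"
    unfolding split by (intro tendsto_intros D.tendsto y(5) elim)
  then have lim: "(\<lambda>k. (h (ys k) - h y) /\<^sub>R \<delta> k) \<longlonglongrightarrow> D v" by simp
  show ?thesis
    unfolding tangent_cone_iff
  proof (intro allI impI)
    fix \<epsilon> :: real assume \<epsilon>: "\<epsilon> > 0"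
    have "\<forall>\<^sub>F k in sequentially. ys k \<in> N"
      using topological_tendstoD[OF y(2)] \<open>open N\<close> \<open>y \<in> N\<close> by blast
    moreover have "\<forall>\<^sub>F k in sequentially. \<delta> k < \<epsilon>"
      using y(4) \<epsilon> by (rule order_tendstoD)
    moreover have "\<forall>\<^sub>F k in sequentially. norm ((h (ys k) - h y) /\<^sub>R \<delta> k - D v) < \<epsilon>"
      using tendstoD[OF lim \<epsilon>] by (simp add: dist_norm)
    ultimately have "\<forall>\<^sub>F k in sequentially. ys k \<in> N \<and> \<delta> k < \<epsilon> \<and> norm ((h (ys k) - h y) /\<^sub>R \<delta> k - D v) < \<epsilon>"
      by eventually_elim auto
    then obtain k where "ys k \<in> N" "\<delta> k < \<epsilon>" "norm ((h (ys k) - h y) /\<^sub>R \<delta> k - D v) < \<epsilon>"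
      using eventually_happens by fastforce
    moreover have "h (ys k) \<in> Z" using img y(1) calculation(1) by blast
    ultimately show "\<exists>h' z. 0 < h' \<and> h' < \<epsilon> \<and> z \<in> Z \<and> norm ((z - h y) /\<^sub>R h' - D v) < \<epsilon>"
      using y(3)[of k] by blast
  qed
qed

section \<open>Viable curves\<close>

text \<open>Points \<open>z\<close> near \<open>y\<close> borrow the target \<open>w y\<close> and
  the step \<open>h y\<close> chosen for \<open>y\<close>. By compactness finitely many
  \<open>y\<close> suffice, and the least of their steps is the lower bound, without which Euler
  steps might accumulate before the final time.\<close>

lemma uniform_tangent_step:
  fixes u :: "'e::euclidean_space \<Rightarrow> 'e"
  assumes "compact K" and u: "\<And>y. y \<in> K \<Longrightarrow> u y \<in> tangent_cone Y y" and \<epsilon>: "\<epsilon> > 0"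
  obtains h0 where "h0 > 0"
    "\<And>z. z \<in> K \<Longrightarrow> \<exists>h v. h0 \<le> h \<and> h \<le> \<epsilon> \<and> z + h *\<^sub>R v \<in> Y \<and>
       (\<exists>y\<in>K. dist y z \<le> \<epsilon> \<and> norm (v - u y) \<le> \<epsilon>)"
proof -
  have "\<exists>h w. 0 < h \<and> h \<le> \<epsilon> \<and> w \<in> Y \<and> norm ((w - y) /\<^sub>R h - u y) < \<epsilon>/2" if yK: "y \<in> K" for y
    using u[OF yK, unfolded tangent_cone_iff, rule_format, of "\<epsilon>/2"] \<epsilon> by force
  then obtain h w where hw: "\<And>y. y \<in> K \<Longrightarrow> 0 < h y \<and> h y \<le> \<epsilon> \<and> w y \<in> Y \<and> norm ((w y - y) /\<^sub>R h y - u y) < \<epsilon>/2"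
    by metis
  \<comment> \<open>At this distance, replacing \<open>y\<close> by \<open>z\<close> changes the
    quotient by at most \<open>\<epsilon>/2\<close>.\<close>
  define \<eta> where "\<eta> = (\<lambda>y. min \<epsilon> (h y * \<epsilon> / 2))"
  have "K \<subseteq> (\<Union>y\<in>K. ball y (\<eta> y))"
    using hw \<epsilon> by (force simp: \<eta>_def)
  then obtain D where D: "D \<subseteq> K" "finite D" "K \<subseteq> (\<Union>y\<in>D. ball y (\<eta> y))"
    using compactE_image[OF \<open>compact K\<close>, of K "\<lambda>y. ball y (\<eta> y)"] by blast
  define h0 where "h0 = Min (insert 1 (h ` D))"
  show thesis
  proof
    show "h0 > 0"
      unfolding h0_def using D hw by (subst Min_gr_iff) auto
    fix z assume "z \<in> K"
    then obtain y where y: "y \<in> D" "dist y z < \<eta> y" using D(3) by auto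
    then have yK: "y \<in> K" using D by auto
    have hy: "h y > 0" "h y \<le> \<epsilon>" "w y \<in> Y" "norm ((w y - y) /\<^sub>R h y - u y) < \<epsilon>/2"
      using hw[OF yK] by auto
    have "h0 \<le> h y"
      unfolding h0_def using D y by (intro Min_le) auto
    moreover have "z + h y *\<^sub>R ((w y - z) /\<^sub>R h y) \<in> Y"
      using hy by simp
    moreover have "norm ((w y - z) /\<^sub>R h y - u y) \<le> \<epsilon>"
    proof -
      have eq: "(w y - z) /\<^sub>R h y - u y = ((w y - y) /\<^sub>R h y - u y) + (y - z) /\<^sub>R h y"
        by (simp add: algebra_simps)
      have "norm ((y - z) /\<^sub>R h y) \<le> \<epsilon>/2"
      proof -
        have "norm ((y - z) /\<^sub>R h y) = norm (y - z) / h y"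
          using hy(1) by (simp add: divide_inverse mult.commute)
        also have "\<dots> \<le> \<epsilon>/2"
          using y(2) hy(1) by (simp add: \<eta>_def dist_norm pos_divide_le_eq mult.commute)
        finally show ?thesis .
      qed
      then show ?thesis
        unfolding eq using hy(4) norm_triangle_ineq[of "(w y - y) /\<^sub>R h y - u y" "(y - z) /\<^sub>R h y"] by linarith
    qed
    moreover have "dist y z \<le> \<epsilon>" using y(2) by (simp add: \<eta>_def)
    ultimately show "\<exists>h v. h0 \<le> h \<and> h \<le> \<epsilon> \<and> z + h *\<^sub>R v \<in> Y \<and>
       (\<exists>y\<in>K. dist y z \<le> \<epsilon> \<and> norm (v - u y) \<le> \<epsilon>)"
      using hy yK by blast
  qed
qed

text \<open>The function jumps from node to node instead of interpolating, so that its values stay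
  in \<open>Y\<close>. Its increments are sums of whole Euler steps, hence \<open>\<tau>\<close> is
  the time between nodes and only approximates \<open>t - s\<close>.\<close>

lemma euler_step_function:
  fixes u :: "'e::euclidean_space \<Rightarrow> 'e"
  assumes K: "compact K" "K = Y \<inter> cball y0 r" and y0: "y0 \<in> Y"
    and u: "\<And>y. y \<in> K \<Longrightarrow> u y \<in> tangent_cone Y y" "\<And>y. y \<in> K \<Longrightarrow> norm (u y) \<le> M"
    and \<epsilon>: "0 < \<epsilon>" "\<epsilon> \<le> 1" and T: "T * (M + 1) \<le> r" and "r > 0"
  obtains x where "x 0 = y0" "\<And>t. 0 \<le> t \<Longrightarrow> t \<le> T \<Longrightarrow> x t \<in> K"
    "\<And>s t. 0 \<le> s \<Longrightarrow> s \<le> t \<Longrightarrow> t \<le> T \<Longrightarrow> \<exists>\<tau> c e. \<bar>\<tau> - (t - s)\<bar> \<le> \<epsilon> \<and> norm e \<le> \<epsilon> \<and>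
       x t - x s = \<tau> *\<^sub>R (c + e) \<and>
       c \<in> convex hull (u ` (K \<inter> cball (x s) ((M + \<epsilon>) * (t - s + \<epsilon>) + \<epsilon>)))"
proof -
  have "y0 \<in> K" using K y0 \<open>r > 0\<close> by auto
  then have "M \<ge> 0" using u(2) norm_ge_zero order_trans by blast
  obtain h0 where h0: "h0 > 0" "\<And>z. z \<in> K \<Longrightarrow> \<exists>h v. h0 \<le> h \<and> h \<le> \<epsilon> \<and> z + h *\<^sub>R v \<in> Y \<and>
       (\<exists>y\<in>K. dist y z \<le> \<epsilon> \<and> norm (v - u y) \<le> \<epsilon>)"
    using uniform_tangent_step[OF K(1) u(1) \<epsilon>(1)] by blast
  obtain h v p where hvp: "\<And>z. z \<in> K \<Longrightarrow> h0 \<le> h z \<and> h z \<le> \<epsilon> \<and> z + h z *\<^sub>R v z \<in> Y \<and>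
       p z \<in> K \<and> dist (p z) z \<le> \<epsilon> \<and> norm (v z - u (p z)) \<le> \<epsilon>"
    using h0(2) by metis
  \<comment> \<open>Outside \<open>K\<close> the process waits (step \<open>\<epsilon>\<close>,
    velocity 0), so that nodes exist for all indices and remain in \<open>Y\<close>. Nodes up to
    time \<open>T\<close> never use these values.\<close>
  define H where "H z = (if z \<in> K then h z else \<epsilon>)" for z
  define V where "V z = (if z \<in> K then v z else 0)" for z
  have "h0 \<le> \<epsilon>" using hvp[OF \<open>y0 \<in> K\<close>] by linarith
  then have H: "h0 \<le> H z" "H z \<le> \<epsilon>" "H z > 0" for z
    using hvp[of z] h0(1) by (auto simp: H_def)
  have V: "norm (V z) \<le> M + \<epsilon>" for z
  proof (cases "z \<in> K")
    case True
    then show ?thesis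
      using hvp[OF True] u(2)[of "p z"] norm_triangle_sub[of "v z" "u (p z)"] by (simp add: V_def)
  qed (use \<open>M \<ge> 0\<close> \<epsilon> in \<open>simp add: V_def\<close>)
  define z where "z n = ((\<lambda>z. z + H z *\<^sub>R V z) ^^ n) y0" for n
  define tt where "tt n = (\<Sum>i<n. H (z i))" for n
  have z0: "z 0 = y0" and zS: "z (Suc n) = z n + H (z n) *\<^sub>R V (z n)" for n
    by (simp_all add: z_def)
  have zY: "z n \<in> Y" for n
    by (induction n) (use y0 hvp K in \<open>auto simp: z0 zS H_def V_def\<close>)
  have tt0: "tt 0 = 0" and ttS: "tt (Suc n) = tt n + H (z n)" for n
    by (simp_all add: tt_def)
  have zdiff: "z n - z m = (\<Sum>i\<in>{m..<n}. H (z i) *\<^sub>R V (z i))" if "m \<le> n" for m n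
    using that by (induction n rule: dec_induct) (auto simp: zS)
  have tdiff: "tt n - tt m = (\<Sum>i\<in>{m..<n}. H (z i))" if "m \<le> n" for m n
    using that by (induction n rule: dec_induct) (auto simp: ttS)
  have tmono: "tt m \<le> tt n" if "m \<le> n" for m n
    using tdiff[OF that] sum_nonneg[of "{m..<n}" "\<lambda>i. H (z i)"] H(3) by (simp add: less_imp_le)
  have znorm: "norm (z n - z m) \<le> (M + \<epsilon>) * (tt n - tt m)" if "m \<le> n" for m n
  proof -
    have "norm (z n - z m) \<le> (\<Sum>i\<in>{m..<n}. H (z i) * (M + \<epsilon>))"
      unfolding zdiff[OF that] using H V by (intro sum_norm_le) (auto simp: abs_of_pos mult_left_mono less_imp_le)
    then show ?thesis
      by (simp add: tdiff[OF that] sum_distrib_left mult.commute)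
  qed
  have tn: "real n * h0 \<le> tt n" for n
  proof (induction n)
    case (Suc n) then show ?case using H(1)[of "z n"] by (simp add: ttS algebra_simps)
  qed (simp add: tt0)
  \<comment> \<open>The index of the last node reached by time \<open>s\<close>. It exists because
    the node times grow at least by \<open>h0\<close>.\<close>
  define J where "J s = (LEAST n. s < tt (Suc n))" for s
  have J: "tt (J s) \<le> s" "s < tt (Suc (J s))" if "0 \<le> s" for s
  proof -
    obtain n where "s < real n * h0" using h0(1) reals_Archimedean3 by blast
    then have "s < tt (Suc n)" using tn[of n] tmono[of n "Suc n"] by simp
    then show "s < tt (Suc (J s))" unfolding J_def by (rule LeastI)
    show "tt (J s) \<le> s"
    proof (cases "J s")
      case (Suc k)
      then have "\<not> s < tt (Suc k)"
        unfolding J_def using not_less_Least[of k "\<lambda>n. s < tt (Suc n)"] by (simp add: J_def)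
      then show ?thesis using Suc by simp
    qed (simp add: tt0 that)
  qed
  have J': "s - \<epsilon> < tt (J s)" if "0 \<le> s" for s
    using J(2)[OF that] H(2)[of "z (J s)"] by (simp add: ttS)
  have Jmono: "J s \<le> J t" if "0 \<le> s" "s \<le> t" for s t
    unfolding J_def[of s] using J(2)[of t] that by (intro Least_le) auto
  have zK: "z n \<in> K" if "tt n \<le> T" for n
  proof -
    have "0 \<le> tt n" using tmono[of 0 n] by (simp add: tt0)
    have "norm (z n - y0) \<le> (M + \<epsilon>) * tt n"
      using znorm[of 0 n] by (simp add: z0 tt0)
    \<comment> \<open>The speed is at most \<open>M + \<epsilon>\<close>, and
      \<open>\<epsilon> \<le> 1\<close>; this is the origin of \<open>M + 1\<close> in the time
      bound.\<close>
    also have "\<dots> \<le> (M + 1) * T"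
      using \<open>M \<ge> 0\<close> \<epsilon> that \<open>0 \<le> tt n\<close> by (intro mult_mono) auto
    also have "\<dots> \<le> r" using T by (simp add: mult.commute)
    finally show ?thesis using zY by (simp add: K(2) dist_norm norm_minus_commute)
  qed
  show thesis
  proof
    show "z (J 0) = y0"
    proof -
      have "J 0 = 0" unfolding J_def using H(3)[of "z 0"] by (intro Least_equality) (auto simp: ttS tt0)
      then show ?thesis by (simp add: z0)
    qed
    show "z (J t) \<in> K" if "0 \<le> t" "t \<le> T" for t
      using J(1)[OF that(1)] that(2) by (intro zK) simp
    fix s t :: real assume st: "0 \<le> s" "s \<le> t" "t \<le> T"
    define m n \<tau> where "m = J s" and "n = J t" and "\<tau> = tt n - tt m"
    have mn: "m \<le> n" using Jmono st by (simp add: m_def n_def)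
    have \<tau>: "\<bar>\<tau> - (t - s)\<bar> \<le> \<epsilon>" "\<tau> \<ge> 0"
      using J(1)[of s] J'[of s] J(1)[of t] J'[of t] st tmono[OF mn] by (auto simp: \<tau>_def m_def n_def)
    have tnT: "tt n \<le> T" using J(1)[of t] st by (simp add: n_def)
    \<comment> \<open>Nodes between the two times travel for at most
      \<open>t - s + \<epsilon>\<close> at speed \<open>M + \<epsilon>\<close>, and the point where
      \<open>u\<close> is evaluated is a further \<open>\<epsilon>\<close> away.\<close>
    let ?B = "K \<inter> cball (z m) ((M + \<epsilon>) * (t - s + \<epsilon>) + \<epsilon>)"
    have pB: "p (z i) \<in> ?B" if i: "i \<in> {m..<n}" for i
    proof -
      have iK: "z i \<in> K" using tmono[of i n] i tnT by (intro zK) auto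
      have "norm (z i - z m) \<le> (M + \<epsilon>) * (tt i - tt m)" using znorm i by auto
      also have "\<dots> \<le> (M + \<epsilon>) * (t - s + \<epsilon>)"
        using \<tau> tmono[of i n] i \<open>M \<ge> 0\<close> \<epsilon> by (intro mult_left_mono) (auto simp: \<tau>_def)
      finally show ?thesis
        using hvp[OF iK] dist_triangle[of "z m" "p (z i)" "z i"] by (simp add: dist_norm norm_minus_commute)
    qed
    show "\<exists>\<tau> c e. \<bar>\<tau> - (t - s)\<bar> \<le> \<epsilon> \<and> norm e \<le> \<epsilon> \<and>
       z (J t) - z (J s) = \<tau> *\<^sub>R (c + e) \<and>
       c \<in> convex hull (u ` (K \<inter> cball (z (J s)) ((M + \<epsilon>) * (t - s + \<epsilon>) + \<epsilon>)))"
    proof (cases "m = n")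
      \<comment> \<open>No step is completed between the two times: \<open>\<tau>\<close> is 0, and
        any value of \<open>u\<close> from \<open>?B\<close> can serve as \<open>c\<close>.\<close>
      case True
      have "z m \<in> ?B" using zK[of m] tnT True \<open>M \<ge> 0\<close> \<epsilon> st by auto
      then have "u (z m) \<in> convex hull (u ` ?B)" by (intro hull_inc) blast
      then show ?thesis
        using \<tau> True \<epsilon> by (intro exI[of _ \<tau>] exI[of _ "u (z m)"] exI[of _ 0]) (auto simp: m_def n_def \<tau>_def)
    next
      case False
      have "\<tau> > 0" unfolding \<tau>_def tdiff[OF mn] using H(3) False mn by (intro sum_pos) auto
      define c where "c = (\<Sum>i\<in>{m..<n}. (H (z i) / \<tau>) *\<^sub>R u (p (z i)))"
      define e where "e = (\<Sum>i\<in>{m..<n}. (H (z i) / \<tau>) *\<^sub>R (V (z i) - u (p (z i))))"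
      have s1: "(\<Sum>i\<in>{m..<n}. H (z i) / \<tau>) = 1"
        using \<open>\<tau> > 0\<close> tdiff[OF mn] by (simp add: sum_divide_distrib[symmetric] \<tau>_def)
      have "c \<in> convex hull (u ` ?B)"
        unfolding c_def using pB H(3) \<open>\<tau> > 0\<close>
        by (intro convex_sum s1) (auto simp: less_imp_le convex_convex_hull intro!: hull_inc)
      moreover have "norm e \<le> (\<Sum>i\<in>{m..<n}. (H (z i) / \<tau>) * \<epsilon>)"
        unfolding e_def
      proof (rule sum_norm_le)
        fix i assume i: "i \<in> {m..<n}"
        then have "z i \<in> K" using tmono[of i n] tnT by (intro zK) auto
        then have "norm (V (z i) - u (p (z i))) \<le> \<epsilon>" using hvp by (simp add: V_def)
        then show "norm ((H (z i) / \<tau>) *\<^sub>R (V (z i) - u (p (z i)))) \<le> H (z i) / \<tau> * \<epsilon>"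
          using H(3)[of "z i"] \<open>\<tau> > 0\<close> by (simp add: abs_of_pos divide_right_mono mult_left_mono)
      qed
      then have "norm e \<le> \<epsilon>"
        unfolding sum_distrib_right[symmetric] s1 by simp
      moreover have "c + e = (\<Sum>i\<in>{m..<n}. (H (z i) / \<tau>) *\<^sub>R V (z i))"
        unfolding c_def e_def by (simp add: sum.distrib[symmetric] scaleR_right_diff_distrib)
      then have "\<tau> *\<^sub>R (c + e) = z n - z m"
        using \<open>\<tau> > 0\<close> by (simp add: zdiff[OF mn] scaleR_sum_right)
      ultimately show ?thesis
        using \<tau> unfolding m_def n_def by metis
    qed
  qed
qed

text \<open>Two arguments at a time suffice, because the limits taken below only involve difference quotients.
  This avoids equicontinuity, so that discontinuous step functions can be used.\<close>

lemma cluster_point_of_functions: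
  fixes g :: "nat \<Rightarrow> 'b \<Rightarrow> 'e::metric_space"
  assumes "compact K" "\<And>n t. g n t \<in> K"
  obtains x where "\<And>t. x t \<in> K"
    "\<And>s t (N::nat) \<eta>. \<eta> > 0 \<Longrightarrow> \<exists>n\<ge>N. dist (g n s) (x s) < \<eta> \<and> dist (g n t) (x t) < \<eta>"
proof -
  \<comment> \<open>Tychonoff in the topology of pointwise convergence. The product over uncountably
    many times need not be sequentially compact, so a cluster point of the filter replaces a
    convergent subsequence.\<close>
  have "compact (PiE UNIV (\<lambda>_::'b. K))"
    using assms(1) compactin_PiE[of "\<lambda>_. euclidean" UNIV "\<lambda>_::'b. K"]
    by (simp add: euclidean_product_topology)
  moreover have "filtermap g sequentially \<noteq> bot"
    by (simp add: filtermap_bot_iff)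
  moreover have "eventually (\<lambda>f. f \<in> PiE UNIV (\<lambda>_::'b. K)) (filtermap g sequentially)"
    using assms(2) by (simp add: eventually_filtermap PiE_UNIV_domain)
  ultimately obtain x where x: "x \<in> PiE UNIV (\<lambda>_::'b. K)" "inf (nhds x) (filtermap g sequentially) \<noteq> bot"
    unfolding compact_filter by blast
  show thesis
  proof
    show "x t \<in> K" for t using x(1) by auto
    fix s t and N :: nat and \<eta> :: real assume "\<eta> > 0"
    define P where "P f \<longleftrightarrow> dist (f s) (x s) < \<eta> \<and> dist (f t) (x t) < \<eta>" for f
    have "open {f. P f}"
      unfolding P_def
      by (intro open_Collect_conj open_Collect_less continuous_intros continuous_on_product_coordinates)
    then have ev: "eventually P (nhds x)"
      using \<open>\<eta> > 0\<close> by (auto simp: eventually_nhds P_def)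
    show "\<exists>n\<ge>N. P (g n)"
    proof (rule ccontr)
      assume "\<not> ?thesis"
      then have "eventually (\<lambda>f. \<not> P f) (filtermap g sequentially)"
        by (auto simp: eventually_filtermap eventually_sequentially)
      then have "eventually (\<lambda>_. False) (inf (nhds x) (filtermap g sequentially))"
        using ev unfolding eventually_inf by blast
      then show False using x(2) by (simp add: trivial_limit_def)
    qed
  qed
qed

text \<open>Increments of the step functions are averages of \<open>u\<close> near their value at
  \<open>s\<close>, up to vanishing errors. The closed convex \<open>C\<close> keeps this
  information in the limit, although the limit of the averages is not expressed through
  \<open>u\<close>.\<close>

lemma viable_curve:
  fixes u :: "'e::euclidean_space \<Rightarrow> 'e"
  assumes K: "compact K" "K = Y \<inter> cball y0 r" and y0: "y0 \<in> Y" and "r > 0"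
    and u: "\<And>y. y \<in> K \<Longrightarrow> u y \<in> tangent_cone Y y" "\<And>y. y \<in> K \<Longrightarrow> norm (u y) \<le> M"
    and T: "0 \<le> T" "T * (M + 1) \<le> r"
  obtains x where "x 0 = y0" "x ` {0..T} \<subseteq> K"
    "\<And>s t C \<rho>. \<lbrakk>0 \<le> s; s < t; t \<le> T; closed C; convex C; M * (t - s) < \<rho>;
        \<And>y. y \<in> K \<inter> cball (x s) \<rho> \<Longrightarrow> u y \<in> C\<rbrakk> \<Longrightarrow> (x t - x s) /\<^sub>R (t - s) \<in> C"
proof -
  define \<epsilon> where "\<epsilon> n = 1 / real (Suc n)" for n
  have \<epsilon>: "0 < \<epsilon> n" "\<epsilon> n \<le> 1" for n by (auto simp: \<epsilon>_def)
  have \<epsilon>0: "\<epsilon> \<longlonglongrightarrow> 0" unfolding \<epsilon>_def by (rule LIMSEQ_inverse_real_of_nat[unfolded inverse_eq_divide])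
  have "\<forall>n. \<exists>x. x 0 = y0 \<and> (\<forall>t. 0 \<le> t \<longrightarrow> t \<le> T \<longrightarrow> x t \<in> K) \<and>
    (\<forall>s t. 0 \<le> s \<longrightarrow> s \<le> t \<longrightarrow> t \<le> T \<longrightarrow> (\<exists>\<tau> c e. \<bar>\<tau> - (t - s)\<bar> \<le> \<epsilon> n \<and> norm e \<le> \<epsilon> n \<and>
       x t - x s = \<tau> *\<^sub>R (c + e) \<and>
       c \<in> convex hull (u ` (K \<inter> cball (x s) ((M + \<epsilon> n) * (t - s + \<epsilon> n) + \<epsilon> n)))))"
  proof
    fix n
    show "\<exists>x. x 0 = y0 \<and> (\<forall>t. 0 \<le> t \<longrightarrow> t \<le> T \<longrightarrow> x t \<in> K) \<and>
      (\<forall>s t. 0 \<le> s \<longrightarrow> s \<le> t \<longrightarrow> t \<le> T \<longrightarrow> (\<exists>\<tau> c e. \<bar>\<tau> - (t - s)\<bar> \<le> \<epsilon> n \<and> norm e \<le> \<epsilon> n \<and>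
       x t - x s = \<tau> *\<^sub>R (c + e) \<and>
       c \<in> convex hull (u ` (K \<inter> cball (x s) ((M + \<epsilon> n) * (t - s + \<epsilon> n) + \<epsilon> n)))))"
      by (rule euler_step_function[OF K y0 u \<epsilon>(1,2)[of n] T(2) \<open>r > 0\<close>]; (assumption | blast))
  qed
  then obtain X where X: "\<And>n. X n 0 = y0" "\<And>n t. 0 \<le> t \<Longrightarrow> t \<le> T \<Longrightarrow> X n t \<in> K"
    "\<And>n s t. 0 \<le> s \<Longrightarrow> s \<le> t \<Longrightarrow> t \<le> T \<Longrightarrow> \<exists>\<tau> c e. \<bar>\<tau> - (t - s)\<bar> \<le> \<epsilon> n \<and> norm e \<le> \<epsilon> n \<and>
       X n t - X n s = \<tau> *\<^sub>R (c + e) \<and>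
       c \<in> convex hull (u ` (K \<inter> cball (X n s) ((M + \<epsilon> n) * (t - s + \<epsilon> n) + \<epsilon> n)))"
    by (subst (asm) choice_iff) blast
  have "y0 \<in> K" using K y0 \<open>r > 0\<close> by auto
  \<comment> \<open>Constant values outside the time interval put every coordinate into
    \<open>K\<close>, as the product argument requires.\<close>
  define g where "g n t = (if t \<in> {0..T} then X n t else y0)" for n t
  have "g n t \<in> K" for n t using X(2) \<open>y0 \<in> K\<close> by (auto simp: g_def)
  then obtain x where x: "\<And>t. x t \<in> K"
    "\<And>s t (N::nat) \<eta>. \<eta> > 0 \<Longrightarrow> \<exists>n\<ge>N. dist (g n s) (x s) < \<eta> \<and> dist (g n t) (x t) < \<eta>"
    using cluster_point_of_functions[OF K(1), of g] by blast
  show thesis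
  proof
    show "x 0 = y0"
    proof (rule ccontr)
      assume "x 0 \<noteq> y0"
      then obtain n where "dist (g n 0) (x 0) < dist y0 (x 0)" using x(2)[of "dist y0 (x 0)" 0 0 0] by auto
      then show False using X(1) T(1) by (simp add: g_def)
    qed
    show "x ` {0..T} \<subseteq> K" using x(1) by blast
    fix s t C \<rho>
    assume st: "0 \<le> s" "s < t" "t \<le> T" and C: "closed C" "convex C" and \<rho>: "M * (t - s) < \<rho>"
      and uC: "\<And>y. y \<in> K \<inter> cball (x s) \<rho> \<Longrightarrow> u y \<in> C"
    have "\<forall>n. \<exists>m\<ge>n. dist (X m s) (x s) < \<epsilon> n \<and> dist (X m t) (x t) < \<epsilon> n"
      using x(2)[OF \<epsilon>(1), where s = s and t = t] st by (auto simp: g_def)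
    \<comment> \<open>These indices depend on the fixed pair \<open>s\<close>, \<open>t\<close>; no
      subsequence common to all times is claimed.\<close>
    then obtain k where k: "\<And>n. n \<le> k n" "\<And>n. dist (X (k n) s) (x s) < \<epsilon> n" "\<And>n. dist (X (k n) t) (x t) < \<epsilon> n"
      by metis
    have kinf: "filterlim k at_top sequentially"
      by (rule filterlim_at_top_mono[OF filterlim_ident]) (use k(1) in auto)
    have \<epsilon>k: "(\<lambda>n. \<epsilon> (k n)) \<longlonglongrightarrow> 0"
      using filterlim_compose[OF \<epsilon>0 kinf] .
    have lims: "(\<lambda>n. X (k n) s) \<longlonglongrightarrow> x s" "(\<lambda>n. X (k n) t) \<longlonglongrightarrow> x t"
      using k(2,3) by (auto intro!: metric_tendsto_imp_tendsto[OF \<epsilon>0] simp: less_imp_le \<epsilon>)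
    have "\<forall>n. \<exists>\<tau> c e. \<bar>\<tau> - (t - s)\<bar> \<le> \<epsilon> (k n) \<and> norm e \<le> \<epsilon> (k n) \<and>
       X (k n) t - X (k n) s = \<tau> *\<^sub>R (c + e) \<and>
       c \<in> convex hull (u ` (K \<inter> cball (X (k n) s) ((M + \<epsilon> (k n)) * (t - s + \<epsilon> (k n)) + \<epsilon> (k n))))"
      using X(3) st by simp
    then obtain \<tau> c e where tce: "\<And>n. \<bar>\<tau> n - (t - s)\<bar> \<le> \<epsilon> (k n)" "\<And>n. norm (e n) \<le> \<epsilon> (k n)"
       "\<And>n. X (k n) t - X (k n) s = \<tau> n *\<^sub>R (c n + e n)"
       "\<And>n. c n \<in> convex hull (u ` (K \<inter> cball (X (k n) s) ((M + \<epsilon> (k n)) * (t - s + \<epsilon> (k n)) + \<epsilon> (k n))))"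
      by metis
    have "(\<lambda>n. \<tau> n - (t - s)) \<longlonglongrightarrow> 0"
      by (rule Lim_null_comparison[OF _ \<epsilon>k]) (use tce(1) in auto)
    then have \<tau>lim: "\<tau> \<longlonglongrightarrow> t - s" by (simp add: LIM_zero_iff)
    have elim: "e \<longlonglongrightarrow> 0"
      by (rule Lim_null_comparison[OF _ \<epsilon>k]) (use tce(2) in auto)
    have "(\<lambda>n. (X (k n) t - X (k n) s) /\<^sub>R \<tau> n - e n) \<longlonglongrightarrow> (x t - x s) /\<^sub>R (t - s) - 0"
      using st by (intro tendsto_intros lims \<tau>lim elim) auto
    moreover have "\<forall>\<^sub>F n in sequentially. (X (k n) t - X (k n) s) /\<^sub>R \<tau> n - e n = c n"
    proof -
      have "\<forall>\<^sub>F n in sequentially. 0 < \<tau> n"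
        using \<tau>lim st by (intro order_tendstoD) auto
      then show ?thesis by eventually_elim (simp add: tce(3))
    qed
    ultimately have clim: "c \<longlonglongrightarrow> (x t - x s) /\<^sub>R (t - s)"
      by (simp add: tendsto_cong)
    \<comment> \<open>The balls around \<open>X (k n) s\<close> that contain the evaluation points
      have radii tending to \<open>M * (t - s)\<close>, so they eventually lie in the ball of radius
      \<open>\<rho>\<close> around \<open>x s\<close>.\<close>
    have "(\<lambda>n. dist (x s) (X (k n) s) + ((M + \<epsilon> (k n)) * (t - s + \<epsilon> (k n)) + \<epsilon> (k n)))
       \<longlonglongrightarrow> dist (x s) (x s) + ((M + 0) * (t - s + 0) + 0)"
      by (intro tendsto_intros lims \<epsilon>k)
    then have "\<forall>\<^sub>F n in sequentially. dist (x s) (X (k n) s) + ((M + \<epsilon> (k n)) * (t - s + \<epsilon> (k n)) + \<epsilon> (k n)) < \<rho>"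
      by (rule order_tendstoD) (use \<rho> in simp)
    then have "\<forall>\<^sub>F n in sequentially. c n \<in> C"
    proof eventually_elim
      case (elim n)
      have "K \<inter> cball (X (k n) s) ((M + \<epsilon> (k n)) * (t - s + \<epsilon> (k n)) + \<epsilon> (k n)) \<subseteq> K \<inter> cball (x s) \<rho>"
      proof
        fix y assume y: "y \<in> K \<inter> cball (X (k n) s) ((M + \<epsilon> (k n)) * (t - s + \<epsilon> (k n)) + \<epsilon> (k n))"
        then have "dist (x s) y \<le> \<rho>"
          using elim dist_triangle[of "x s" y "X (k n) s"] by (simp del: of_nat_Suc)
        then show "y \<in> K \<inter> cball (x s) \<rho>" using y by simp
      qed
      then have "u ` (K \<inter> cball (X (k n) s) ((M + \<epsilon> (k n)) * (t - s + \<epsilon> (k n)) + \<epsilon> (k n))) \<subseteq> C"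
        using uC by blast
      then show "c n \<in> C"
        using tce(4)[of n] hull_minimal[of _ C convex] C(2) by blast
    qed
    then show "(x t - x s) /\<^sub>R (t - s) \<in> C"
      by (intro Lim_in_closed_set[OF C(1) _ _ clim]) auto
  qed
qed

section \<open>Krasovskii regularization and Clarke tangent cones\<close>

text \<open>Near \<open>y\<close> the values of \<open>u\<close> lie in any given neighbourhood of
  the Krasovskii set: otherwise boundedness would give a limit value outside of it. So
  \<open>v\<close> lies in each closed neighbourhood, and the set itself is closed.\<close>

lemma krasovskii_RnI:
  fixes u :: "'e::euclidean_space \<Rightarrow> 'e"
  assumes bdd: "bounded (u ` K)" and K: "\<And>z. z \<in> K \<Longrightarrow> z \<in> Y \<and> u z \<in> F z"
    and H: "\<And>C \<rho>. \<lbrakk>closed C; convex C; \<rho> > 0; \<And>z. z \<in> K \<inter> cball y \<rho> \<Longrightarrow> u z \<in> C\<rbrakk> \<Longrightarrow> v \<in> C"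
  shows "v \<in> krasovskii_Rn Y F y"
proof -
  define S where "S = {v. \<exists>(ys :: nat \<Rightarrow> 'e) vs. (\<forall>k. ys k \<in> Y \<and> vs k \<in> F (ys k)) \<and> ys \<longlonglongrightarrow> y \<and> vs \<longlonglongrightarrow> v}"
  define D where "D = closure (convex hull S)"
  have D: "closed D" "convex D" by (auto simp: D_def)
  have "S \<subseteq> D" unfolding D_def by (meson closure_subset hull_subset order_trans)
  have near: "\<exists>d\<in>D. dist d v \<le> \<delta>" if \<delta>: "\<delta> > 0" for \<delta>
  proof -
    \<comment> \<open>The closed \<open>\<delta>\<close>-neighbourhood of \<open>D\<close>. It is
      closed as the sum of a closed and a compact set, and convex as a sum of convex sets.\<close>
    define C where "C = (\<Union>x\<in>D. \<Union>e\<in>cball 0 \<delta>. {x + e})"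
    have C: "closed C" "convex C"
      unfolding C_def using D by (auto intro!: closed_compact_sums convex_sums)
    have "\<exists>\<rho>>0. \<forall>z\<in>K \<inter> cball y \<rho>. u z \<in> C"
    proof (rule ccontr)
      assume neg: "\<not> ?thesis"
      have "\<forall>n. \<exists>z. z \<in> K \<inter> cball y (1 / real (Suc n)) \<and> u z \<notin> C"
      proof
        fix n show "\<exists>z. z \<in> K \<inter> cball y (1 / real (Suc n)) \<and> u z \<notin> C"
          using neg[unfolded not_ex, THEN spec, of "1 / real (Suc n)"] by auto
      qed
      then obtain z where z: "\<And>n. z n \<in> K" "\<And>n. dist y (z n) \<le> 1 / real (Suc n)" "\<And>n. u (z n) \<notin> C"
        unfolding choice_iff by auto
      have zlim: "z \<longlonglongrightarrow> y"
        by (rule metric_tendsto_imp_tendsto[OF LIMSEQ_inverse_real_of_nat])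
          (use z(2) in \<open>auto simp: dist_commute inverse_eq_divide\<close>)
      have "bounded (range (\<lambda>n. u (z n)))"
        by (rule bounded_subset[OF bdd]) (use z(1) in auto)
      then obtain l k where k: "strict_mono k" "(\<lambda>n. u (z (k n))) \<longlonglongrightarrow> l"
        using bounded_imp_convergent_subsequence by (fastforce simp: o_def)
      have "(\<lambda>n. z (k n)) \<longlonglongrightarrow> y" using LIMSEQ_subseq_LIMSEQ[OF zlim k(1)] by (simp add: o_def)
      then have "l \<in> S"
        unfolding S_def using k(2) K z(1)
        by (intro CollectI exI[of _ "\<lambda>n. z (k n)"] exI[of _ "\<lambda>n. u (z (k n))"]) simp
      then have "l \<in> D" using \<open>S \<subseteq> D\<close> by blast
      obtain n where "dist (u (z (k n))) l < \<delta>"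
        using k(2) \<delta> unfolding lim_sequentially by blast
      then have "u (z (k n)) \<in> C"
        unfolding C_def using \<open>l \<in> D\<close>
        by (intro UN_I[of l D] UN_I[of "u (z (k n)) - l" "cball 0 \<delta>"]) (auto simp: dist_norm norm_minus_commute)
      then show False using z(3) by blast
    qed
    then obtain \<rho> where "\<rho> > 0" "\<And>z. z \<in> K \<inter> cball y \<rho> \<Longrightarrow> u z \<in> C" by blast
    then have "v \<in> C" by (rule H[OF C])
    then obtain d e where "d \<in> D" "norm e \<le> \<delta>" "v = d + e" by (auto simp: C_def)
    then show ?thesis by (intro bexI[of _ d]) (auto simp: dist_norm)
  qed
  have "v \<in> closure D"
    unfolding closure_approachable
  proof (intro allI impI)
    fix e :: real assume e: "e > 0"
    have "\<exists>d\<in>D. dist d v \<le> e / 2"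
    proof -
      have "0 < e / 2" using e by simp
      from near[OF this] show ?thesis .
    qed
    then show "\<exists>d\<in>D. dist d v < e" using e by force
  qed
  then show ?thesis
    using D by (simp add: krasovskii_Rn_def D_def S_def)
qed

text \<open>A curve that is viable with respect to tangent vectors close to \<open>w\<close> reaches the required point.\<close>

lemma clarke_tangent_step:
  fixes Y :: "'e::euclidean_space set"
  assumes r: "r > 0" "compact (Y \<inter> cball y r)" and w: "w \<in> clarke_tangent_cone Y y" and \<epsilon>: "\<epsilon> > 0"
  obtains \<delta> where "\<delta> > 0"
    "\<And>z h. z \<in> Y \<Longrightarrow> dist y z \<le> \<delta> \<Longrightarrow> 0 < h \<Longrightarrow> h \<le> \<delta> \<Longrightarrow> \<exists>z'\<in>Y. norm ((z' - z) /\<^sub>R h - w) \<le> \<epsilon>"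
proof -
  \<comment> \<open>The sequential definition of the Clarke cone becomes a uniform statement: a
    sequence of counterexamples approaching \<open>y\<close> would contradict it.\<close>
  have "\<exists>\<delta>>0. \<forall>z\<in>Y \<inter> cball y \<delta>. \<exists>v\<in>tangent_cone Y z. norm (v - w) \<le> \<epsilon>"
  proof (rule ccontr)
    assume neg: "\<not> ?thesis"
    have "\<forall>n. \<exists>z. z \<in> Y \<inter> cball y (1 / real (Suc n)) \<and> \<not> (\<exists>v\<in>tangent_cone Y z. norm (v - w) \<le> \<epsilon>)"
    proof
      fix n show "\<exists>z. z \<in> Y \<inter> cball y (1 / real (Suc n)) \<and> \<not> (\<exists>v\<in>tangent_cone Y z. norm (v - w) \<le> \<epsilon>)"
        using neg[unfolded not_ex, THEN spec, of "1 / real (Suc n)"] by auto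
    qed
    then obtain z where z: "\<And>n. z n \<in> Y" "\<And>n. dist y (z n) \<le> 1 / real (Suc n)"
        "\<And>n. \<not> (\<exists>v\<in>tangent_cone Y (z n). norm (v - w) \<le> \<epsilon>)"
      unfolding choice_iff by auto
    have "z \<longlonglongrightarrow> y"
      by (rule metric_tendsto_imp_tendsto[OF LIMSEQ_inverse_real_of_nat])
        (use z(2) in \<open>auto simp: dist_commute inverse_eq_divide\<close>)
    then obtain vs where vs: "\<forall>\<^sub>F k in sequentially. vs k \<in> tangent_cone Y (z k)" "vs \<longlonglongrightarrow> w"
      using w z(1) unfolding clarke_tangent_cone_def by blast
    have "\<forall>\<^sub>F k in sequentially. vs k \<in> tangent_cone Y (z k) \<and> dist (vs k) w < \<epsilon>"
      using vs(1) tendstoD[OF vs(2) \<epsilon>] by eventually_elim auto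
    then obtain k where "vs k \<in> tangent_cone Y (z k)" "dist (vs k) w < \<epsilon>"
      using eventually_happens by fastforce
    then show False using z(3)[of k] by (auto simp: dist_norm less_imp_le)
  qed
  then obtain \<delta>1 where \<delta>1: "\<delta>1 > 0" "\<forall>z\<in>Y \<inter> cball y \<delta>1. \<exists>v\<in>tangent_cone Y z. norm (v - w) \<le> \<epsilon>" by blast
  then obtain u where u: "\<And>z. z \<in> Y \<inter> cball y \<delta>1 \<Longrightarrow> u z \<in> tangent_cone Y z \<and> norm (u z - w) \<le> \<epsilon>" by metis
  \<comment> \<open>The half lets balls of radius \<open>R\<close> around points within
    \<open>R\<close> of \<open>y\<close> fit into both given balls; \<open>M\<close> bounds vectors
    within \<open>\<epsilon>\<close> of \<open>w\<close>.\<close>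
  define R M T where "R = min r \<delta>1 / 2" and "M = norm w + \<epsilon>" and "T = R / (M + 1)"
  have "R > 0" "M > 0" "T > 0" using r \<delta>1 \<epsilon> by (auto simp: R_def M_def T_def add_nonneg_pos)
  show thesis
  proof
    show "min R T > 0" using \<open>R > 0\<close> \<open>T > 0\<close> by simp
    fix z h assume z: "z \<in> Y" "dist y z \<le> min R T" and h: "0 < h" "h \<le> min R T"
    have sub: "cball z R \<subseteq> cball y r" "cball z R \<subseteq> cball y \<delta>1"
      using z(2) by (auto simp: cball_subset_cball_iff R_def dist_commute)
    have "Y \<inter> cball z R = Y \<inter> cball y r \<inter> cball z R" using sub by auto
    then have cpt: "compact (Y \<inter> cball z R)"
      using compact_Int[OF r(2) compact_cball] by simp
    have nb: "norm (u q) \<le> M" and tc: "u q \<in> tangent_cone Y q" if "q \<in> Y \<inter> cball z R" for q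
      using u[of q] that sub norm_triangle_sub[of "u q" w] by (auto simp: M_def)
    have TM: "T * (M + 1) \<le> R" using \<open>M > 0\<close> by (simp add: T_def)
    obtain x where x: "x 0 = z" "x ` {0..T} \<subseteq> Y \<inter> cball z R"
      "\<And>s t C \<rho>. \<lbrakk>0 \<le> s; s < t; t \<le> T; closed C; convex C; M * (t - s) < \<rho>;
        \<And>y. y \<in> Y \<inter> cball z R \<inter> cball (x s) \<rho> \<Longrightarrow> u y \<in> C\<rbrakk> \<Longrightarrow> (x t - x s) /\<^sub>R (t - s) \<in> C"
      by (rule viable_curve[OF cpt refl z(1) \<open>R > 0\<close> tc nb less_imp_le[OF \<open>T > 0\<close>] TM]; (assumption | blast))
    have "u q \<in> cball w \<epsilon>" if "q \<in> Y \<inter> cball z R" for q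
    proof -
      have "q \<in> Y \<inter> cball y \<delta>1" using that sub by blast
      then show ?thesis using u by (simp add: dist_norm norm_minus_commute)
    qed
    \<comment> \<open>All velocities near \<open>z\<close> lie in the ball around \<open>w\<close>,
      so the average velocity does as well. The radius only has to exceed
      \<open>M * h\<close>.\<close>
    then have "(x h - x 0) /\<^sub>R (h - 0) \<in> cball w \<epsilon>"
      using h by (intro x(3)[of 0 h "cball w \<epsilon>" "M * h + 1"]) auto
    moreover have "x h \<in> Y" using x(2) h by auto
    ultimately show "\<exists>z'\<in>Y. norm ((z' - z) /\<^sub>R h - w) \<le> \<epsilon>"
      using x(1) by (intro bexI[of _ "x h"]) (auto simp: dist_norm norm_minus_commute)
  qed
qed

text \<open>A step along \<open>v\<close> from \<open>y\<close> to \<open>z\<close> is followed by a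
  step of the same length along \<open>w\<close> from \<open>z\<close>. The second step exists
  because Clarke tangency is uniform in the base point. Where both cones agree, this makes the
  tangent cone convex.\<close>

lemma tangent_cone_add:
  fixes Y :: "'e::euclidean_space set"
  assumes r: "r > 0" "compact (Y \<inter> cball y r)"
    and v: "v \<in> tangent_cone Y y" and w: "w \<in> clarke_tangent_cone Y y"
  shows "v + w \<in> tangent_cone Y y"
  unfolding tangent_cone_iff
proof (intro allI impI)
  fix \<epsilon> :: real assume \<epsilon>: "\<epsilon> > 0"
  then have "\<epsilon>/2 > 0" by simp
  from clarke_tangent_step[OF r w this] obtain \<delta> where \<delta>: "\<delta> > 0"
    "\<And>z h. z \<in> Y \<Longrightarrow> dist y z \<le> \<delta> \<Longrightarrow> 0 < h \<Longrightarrow> h \<le> \<delta> \<Longrightarrow> \<exists>z'\<in>Y. norm ((z' - z) /\<^sub>R h - w) \<le> \<epsilon>/2"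
    by blast
  \<comment> \<open>The bound 1 limits the first quotient to \<open>norm v + 1\<close>; then
    \<open>h * (norm v + 1) \<le> \<delta>\<close> keeps \<open>z\<close> where the second step is
    available.\<close>
  define \<eta> where "\<eta> = Min {\<epsilon>/2, 1, \<delta>, \<delta> / (norm v + 1)}"
  have \<eta>: "\<eta> \<le> \<epsilon>/2" "\<eta> \<le> 1" "\<eta> \<le> \<delta>" "\<eta> \<le> \<delta> / (norm v + 1)"
    unfolding \<eta>_def by (rule Min_le; simp)+
  have "\<eta> > 0"
    unfolding \<eta>_def using \<epsilon> \<delta>(1) by (subst Min_gr_iff) (auto simp: add_nonneg_pos)
  obtain h z where hz: "0 < h" "h < \<eta>" "z \<in> Y" "norm ((z - y) /\<^sub>R h - v) < \<eta>"
    using v \<open>\<eta> > 0\<close> unfolding tangent_cone_iff by blast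
  have "norm ((z - y) /\<^sub>R h) \<le> norm v + 1"
    using hz(4) \<eta>(2) norm_triangle_sub[of "(z - y) /\<^sub>R h" v] by linarith
  then have "h * norm ((z - y) /\<^sub>R h) \<le> h * (norm v + 1)"
    using hz(1) by (intro mult_left_mono) auto
  moreover have "h * norm ((z - y) /\<^sub>R h) = norm (z - y)"
    using hz(1) by simp
  ultimately have "norm (z - y) \<le> h * (norm v + 1)"
    by linarith
  also have "\<dots> \<le> \<delta>"
  proof -
    have "h \<le> \<delta> / (norm v + 1)" using hz(2) \<eta>(4) by linarith
    then show ?thesis by (subst (asm) pos_le_divide_eq) (auto simp: add_nonneg_pos)
  qed
  finally have "dist y z \<le> \<delta>" by (simp add: dist_norm norm_minus_commute)
  then obtain z' where z': "z' \<in> Y" "norm ((z' - z) /\<^sub>R h - w) \<le> \<epsilon>/2"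
    using \<delta>(2)[of z h] hz \<eta> by auto
  have "(z' - y) /\<^sub>R h - (v + w) = ((z - y) /\<^sub>R h - v) + ((z' - z) /\<^sub>R h - w)"
    by (simp add: algebra_simps)
  then have "norm ((z' - y) /\<^sub>R h - (v + w)) \<le> norm ((z - y) /\<^sub>R h - v) + norm ((z' - z) /\<^sub>R h - w)"
    by (simp only: norm_triangle_ineq)
  then have "norm ((z' - y) /\<^sub>R h - (v + w)) < \<epsilon>"
    using hz(4) z'(2) \<eta>(1) by linarith
  then show "\<exists>h z. 0 < h \<and> h < \<epsilon> \<and> z \<in> Y \<and> norm ((z - y) /\<^sub>R h - (v + w)) < \<epsilon>"
    using hz(1,2) \<eta>(1) \<epsilon> z'(1) by (intro exI[of _ h] exI[of _ z']) auto
qed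

text \<open>Only limit values have to be transported, since linear maps commute with convex hulls
  and map closures into closures. The third assumption leaves room for transporting the
  approximating vectors by derivatives at their own base points.\<close>

lemma krasovskii_Rn_linear_image:
  fixes D :: "'e::euclidean_space \<Rightarrow> 'e"
  assumes "linear D" and v: "v \<in> krasovskii_Rn Y F y"
    and sub: "\<And>ys vs v. \<lbrakk>\<And>k. ys k \<in> Y \<and> vs k \<in> F (ys k); ys \<longlonglongrightarrow> y; vs \<longlonglongrightarrow> v\<rbrakk> \<Longrightarrow>
      \<exists>zs ws. (\<forall>k::nat. zs k \<in> Z \<and> ws k \<in> G (zs k)) \<and> zs \<longlonglongrightarrow> z \<and> ws \<longlonglongrightarrow> D v"
  shows "D v \<in> krasovskii_Rn Z G z"
proof -
  define S where "S = {v. \<exists>(ys :: nat \<Rightarrow> 'e) vs. (\<forall>k. ys k \<in> Y \<and> vs k \<in> F (ys k)) \<and> ys \<longlonglongrightarrow> y \<and> vs \<longlonglongrightarrow> v}"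
  define R where "R = {v. \<exists>(ys :: nat \<Rightarrow> 'e) vs. (\<forall>k. ys k \<in> Z \<and> vs k \<in> G (ys k)) \<and> ys \<longlonglongrightarrow> z \<and> vs \<longlonglongrightarrow> v}"
  have "D ` S \<subseteq> R"
  proof
    fix w assume "w \<in> D ` S"
    then obtain l ys vs where "w = D l" and l: "\<And>k. ys k \<in> Y \<and> vs k \<in> F (ys k)" "ys \<longlonglongrightarrow> y" "vs \<longlonglongrightarrow> l"
      by (auto simp: S_def)
    then show "w \<in> R"
      unfolding R_def mem_Collect_eq using sub[OF l] by simp
  qed
  have "D v \<in> D ` closure (convex hull S)"
    using v by (auto simp: krasovskii_Rn_def S_def)
  also have "\<dots> \<subseteq> closure (D ` (convex hull S))"
    using \<open>linear D\<close> by (rule closure_linear_image_subset)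
  also have "D ` (convex hull S) = convex hull (D ` S)"
    using \<open>linear D\<close> by (rule convex_hull_linear_image)
  also have "closure (convex hull (D ` S)) \<subseteq> closure (convex hull R)"
    using \<open>D ` S \<subseteq> R\<close> by (intro closure_mono hull_mono)
  finally show ?thesis by (simp add: krasovskii_Rn_def R_def)
qed

section \<open>Projections with respect to an inner product\<close>

text \<open>The coordinate form of \<open>inner_product_on\<close>; \<open>bounded_bilinear\<close>
  supplies the algebraic and the continuity rules.\<close>

definition inner_prod :: "('e::euclidean_space \<Rightarrow> 'e \<Rightarrow> real) \<Rightarrow> bool" where
  "inner_prod G \<longleftrightarrow> bounded_bilinear G \<and> (\<forall>u v. G u v = G v u) \<and> (\<forall>u. u \<noteq> 0 \<longrightarrow> G u u > 0)"

lemma inner_prodD: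
  assumes "inner_prod G"
  shows "bounded_bilinear G" "G u v = G v u" "u \<noteq> 0 \<Longrightarrow> G u u > 0" "G u u \<ge> 0"
proof -
  show b: "bounded_bilinear G" and "G u v = G v u" and p: "u \<noteq> 0 \<Longrightarrow> G u u > 0"
    using assms by (auto simp: inner_prod_def)
  show "G u u \<ge> 0"
    using p bounded_bilinear.zero_left[OF b] by (cases "u = 0") (auto simp: less_imp_le)
qed

lemma inner_prod_add_square:
  assumes "inner_prod G"
  shows "G (u + v) (u + v) = G u u + 2 * G u v + G v v"
  using inner_prodD(2)[OF assms, of u v]
  by (simp add: bounded_bilinear.add_left[OF inner_prodD(1)[OF assms]] bounded_bilinear.add_right[OF inner_prodD(1)[OF assms]])

lemma continuous_on_square:
  assumes "bounded_bilinear G"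
  shows "continuous_on S (\<lambda>u. G (u - a) (u - a))"
  by (rule bounded_bilinear.continuous_on[OF assms]; intro continuous_intros)

text \<open>On the unit sphere the \<open>G\<close>-norm lies between a positive minimum and a
  maximum, whose ratio is the condition number. The form without quotients covers zero
  vectors.\<close>

lemma condition_number_ge:
  fixes G :: "'e::euclidean_space \<Rightarrow> 'e \<Rightarrow> real"
  assumes G: "inner_prod G"
  shows "sqrt (G u u) * norm w \<le> condition_number G * (sqrt (G w w) * norm u)"
proof (cases "u = 0 \<or> w = 0")
  case True
  then show ?thesis
    using bounded_bilinear.zero_left[OF inner_prodD(1)[OF G]] by auto
next
  case False
  define q where "q v = sqrt (G v v)" for v
  let ?S = "sphere (0::'e) 1"
  have "continuous_on ?S q"
    unfolding q_def using continuous_on_square[OF inner_prodD(1)[OF G], of ?S 0]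
    by (intro continuous_on_real_sqrt) simp
  then have cpt: "compact (q ` ?S)" by (intro compact_continuous_image) auto
  have bdd: "bdd_above (q ` ?S)" "bdd_below (q ` ?S)"
    using compact_imp_bounded[OF cpt] bounded_imp_bdd_above bounded_imp_bdd_below by auto
  have u1: "u /\<^sub>R norm u \<in> ?S" and w1: "w /\<^sub>R norm w \<in> ?S" using False by auto
  have q_scale: "q (v /\<^sub>R norm v) = q v / norm v" if "v \<noteq> 0" for v
  proof -
    have "G (v /\<^sub>R norm v) (v /\<^sub>R norm v) = (inverse (norm v))\<^sup>2 * G v v"
      by (simp add: bounded_bilinear.scaleR_left[OF inner_prodD(1)[OF G]]
          bounded_bilinear.scaleR_right[OF inner_prodD(1)[OF G]] power2_eq_square)
    then show ?thesis by (simp add: q_def real_sqrt_mult divide_inverse mult.commute)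
  qed
  obtain m where m: "m \<in> ?S" "\<And>v. v \<in> ?S \<Longrightarrow> q m \<le> q v"
    using continuous_attains_inf[OF compact_sphere _ \<open>continuous_on ?S q\<close>] u1 by blast
  have "q m > 0" unfolding q_def using m(1) inner_prodD(3)[OF G, of m] by force
  have inf: "Inf (q ` ?S) > 0"
    using \<open>q m > 0\<close> m u1 by (intro less_le_trans[OF \<open>q m > 0\<close> cINF_greatest]) auto
  have 1: "q u / norm u \<le> Sup (q ` ?S)"
    using cSUP_upper[OF u1 bdd(1)] q_scale False by simp
  have 2: "Inf (q ` ?S) \<le> q w / norm w"
    using cINF_lower[OF bdd(2) w1] q_scale False by simp
  have "Sup (q ` ?S) \<ge> 0"
  proof -
    have "0 \<le> q u / norm u" using inner_prodD(4)[OF G, of u] by (simp add: q_def)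
    then show ?thesis using 1 by linarith
  qed
  have "(q u / norm u) * Inf (q ` ?S) \<le> Sup (q ` ?S) * (q w / norm w)"
    using 1 2 inf \<open>Sup (q ` ?S) \<ge> 0\<close> by (intro mult_mono) auto
  then have "q u / norm u \<le> Sup (q ` ?S) / Inf (q ` ?S) * (q w / norm w)"
    by (simp only: pos_le_divide_eq[OF inf] times_divide_eq_left)
  then have "(q u / norm u) * (norm u * norm w) \<le> Sup (q ` ?S) / Inf (q ` ?S) * (q w / norm w) * (norm u * norm w)"
    by (intro mult_right_mono) auto
  then have "q u * norm w \<le> Sup (q ` ?S) / Inf (q ` ?S) * (q w * norm u)"
    using False by (simp add: mult_ac)
  then show ?thesis by (simp add: q_def condition_number_def)
qed

text \<open>Since 0 competes, a minimizer \<open>v\<close> is no farther from \<open>a\<close> than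
  0 in the \<open>G\<close>-norm; the condition number converts this into a Euclidean bound. The
  same bound reduces the search to a compact set, so \<open>T\<close> may be nonconvex.\<close>

lemma inner_prod_minimizer:
  fixes G :: "'e::euclidean_space \<Rightarrow> 'e \<Rightarrow> real"
  assumes G: "inner_prod G" and T: "closed T" "0 \<in> T"
  obtains v where "v \<in> T" "\<And>w. w \<in> T \<Longrightarrow> G (v - a) (v - a) \<le> G (w - a) (w - a)"
    "norm v \<le> (condition_number G + 1) * norm a"
proof -
  have near: "norm v \<le> (condition_number G + 1) * norm a" if le: "G (v - a) (v - a) \<le> G (0 - a) (0 - a)" for v
  proof -
    have sq: "G (0 - a) (0 - a) = G a a"
      by (simp add: bounded_bilinear.minus_left[OF inner_prodD(1)[OF G]] bounded_bilinear.minus_right[OF inner_prodD(1)[OF G]])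
    have "norm (v - a) \<le> condition_number G * norm a"
    proof (cases "a = 0")
      case True
      then have "G v v \<le> 0" using le sq bounded_bilinear.zero_left[OF inner_prodD(1)[OF G]] by simp
      then have "v = 0" using inner_prodD(3)[OF G, of v] by force
      then show ?thesis using True by simp
    next
      case False
      then have "sqrt (G a a) > 0" using inner_prodD(3)[OF G] by simp
      have "norm (v - a) * sqrt (G a a) \<le> condition_number G * (sqrt (G (v - a) (v - a)) * norm a)"
        using condition_number_ge[OF G, of a "v - a"] by (simp add: mult.commute)
      also have "\<dots> \<le> condition_number G * (sqrt (G a a) * norm a)"
      proof (intro mult_left_mono mult_right_mono)
        have "1 * (sqrt (G a a) * norm a) \<le> condition_number G * (sqrt (G a a) * norm a)"
          using condition_number_ge[OF G, of a a] by simp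
        then have "1 \<le> condition_number G"
          using mult_le_cancel_right_pos[of "sqrt (G a a) * norm a" 1 "condition_number G"] \<open>sqrt (G a a) > 0\<close> False
          by (metis mult_pos_pos zero_less_norm_iff)
        then show "0 \<le> condition_number G" by simp
      qed (use le sq in auto)
      finally have "norm (v - a) * sqrt (G a a) \<le> condition_number G * norm a * sqrt (G a a)"
        by (simp only: mult_ac)
      then show ?thesis by (simp only: mult_le_cancel_right_pos[OF \<open>sqrt (G a a) > 0\<close>])
    qed
    then show ?thesis using norm_triangle_sub[of v a] by (simp add: algebra_simps)
  qed
  define R where "R = (condition_number G + 1) * norm a"
  have "compact (T \<inter> cball 0 R)" using T by (intro closed_Int_compact) auto
  moreover have "0 \<in> T \<inter> cball 0 R"
    using near[of 0] T by (simp add: R_def)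
  ultimately obtain v where v: "v \<in> T \<inter> cball 0 R" "\<And>w. w \<in> T \<inter> cball 0 R \<Longrightarrow> G (v - a) (v - a) \<le> G (w - a) (w - a)"
    using continuous_attains_inf[OF _ _ continuous_on_square[OF inner_prodD(1)[OF G]], of "T \<inter> cball 0 R" a] by blast
  have "G (v - a) (v - a) \<le> G (w - a) (w - a)" if w: "w \<in> T" for w
  proof (cases "w \<in> cball 0 R")
    case False
    then have "\<not> G (w - a) (w - a) \<le> G (0 - a) (0 - a)" using near[of w] by (auto simp: R_def)
    then show ?thesis using v(2)[OF \<open>0 \<in> T \<inter> cball 0 R\<close>] by linarith
  qed (use v w in auto)
  then show thesis using v by (intro that[of v]) (auto simp: R_def)
qed

text \<open>First variation along the ray in direction \<open>w\<close>: expand the square, divide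
  by \<open>s\<close> and let \<open>s\<close> tend to 0 from above.\<close>

lemma minimizer_normal:
  fixes G :: "'e::euclidean_space \<Rightarrow> 'e \<Rightarrow> real"
  assumes G: "inner_prod G"
    and min: "\<And>s. s > 0 \<Longrightarrow> G (v - a) (v - a) \<le> G (v + s *\<^sub>R w - a) (v + s *\<^sub>R w - a)"
  shows "G (a - v) w \<le> 0"
proof -
  have le: "0 \<le> 2 * G (v - a) w + s * G w w" if s: "s > 0" for s
  proof -
    have "G (v + s *\<^sub>R w - a) (v + s *\<^sub>R w - a) = G ((v - a) + s *\<^sub>R w) ((v - a) + s *\<^sub>R w)"
      by (simp add: algebra_simps)
    also have "\<dots> = G (v - a) (v - a) + s * (2 * G (v - a) w + s * G w w)"
      unfolding inner_prod_add_square[OF G]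
      by (simp add: bounded_bilinear.scaleR_left[OF inner_prodD(1)[OF G]] bounded_bilinear.scaleR_right[OF inner_prodD(1)[OF G]] algebra_simps)
    finally have "0 \<le> s * (2 * G (v - a) w + s * G w w)" using min[OF s] by linarith
    then show ?thesis using s by (simp add: zero_le_mult_iff)
  qed
  have "((\<lambda>s. 2 * G (v - a) w + s * G w w) \<longlongrightarrow> 2 * G (v - a) w + 0 * G w w) (at_right 0)"
    by (intro tendsto_intros)
  then have "0 \<le> 2 * G (v - a) w + 0 * G w w"
    by (rule tendsto_lowerbound) (use le in \<open>auto simp: eventually_at_right_field intro: exI[of _ 1]\<close>)
  moreover have "G (v - a) w = - G (a - v) w"
    using bounded_bilinear.minus_left[OF inner_prodD(1)[OF G], of "a - v" w] by simp
  ultimately show ?thesis by simp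
qed

text \<open>Completing the square around \<open>v\<close> leaves the nonnegative term
  \<open>G (w - v) (w - v)\<close> and a linear term whose sign is given. No convexity is
  involved.\<close>

lemma minimizer_if_normal:
  fixes G :: "'e::euclidean_space \<Rightarrow> 'e \<Rightarrow> real"
  assumes G: "inner_prod G" and n: "G (a - v) w \<le> 0" "G (a - v) v \<ge> 0"
  shows "G (v - a) (v - a) \<le> G (w - a) (w - a)"
proof -
  have "G (w - a) (w - a) = G ((v - a) + (w - v)) ((v - a) + (w - v))" by simp
  also have "\<dots> = G (v - a) (v - a) + 2 * G (v - a) (w - v) + G (w - v) (w - v)"
    by (rule inner_prod_add_square[OF G])
  also have "G (v - a) (w - v) = G (a - v) v - G (a - v) w"
    using bounded_bilinear.minus_left[OF inner_prodD(1)[OF G], of "a - v" "w - v"]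
      bounded_bilinear.diff_right[OF inner_prodD(1)[OF G], of "a - v" w v] by simp
  finally have "G (w - a) (w - a) - G (v - a) (v - a) = 2 * (G (a - v) v - G (a - v) w) + G (w - v) (w - v)"
    by simp
  moreover have "0 \<le> 2 * (G (a - v) v - G (a - v) w) + G (w - v) (w - v)"
    using n inner_prodD(4)[OF G, of "w - v"] by (intro add_nonneg_nonneg) auto
  ultimately show ?thesis by (metis diff_ge_0_iff_ge)
qed

text \<open>Continuity of the metric concerns the Gram entries; this expansion transfers it to
  arbitrary, varying vectors.\<close>

lemma bilinear_expansion:
  fixes G :: "'e::euclidean_space \<Rightarrow> 'e \<Rightarrow> real"
  assumes "bounded_bilinear G"
  shows "G u v = (\<Sum>i\<in>Basis. \<Sum>j\<in>Basis. (u \<bullet> i) * (v \<bullet> j) * G i j)"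
proof -
  have "G u v = G (\<Sum>i\<in>Basis. (u \<bullet> i) *\<^sub>R i) (\<Sum>j\<in>Basis. (v \<bullet> j) *\<^sub>R j)"
    by (simp add: euclidean_representation)
  also have "\<dots> = (\<Sum>j\<in>Basis. \<Sum>i\<in>Basis. (u \<bullet> i) * (v \<bullet> j) * G i j)"
    by (simp add: bounded_bilinear.sum_left[OF assms] bounded_bilinear.sum_right[OF assms]
        bounded_bilinear.scaleR_left[OF assms] bounded_bilinear.scaleR_right[OF assms] sum_distrib_left mult_ac)
  also have "\<dots> = (\<Sum>i\<in>Basis. \<Sum>j\<in>Basis. (u \<bullet> i) * (v \<bullet> j) * G i j)"
    by (rule sum.swap)
  finally show ?thesis .
qed

lemma lipschitz_imp_absolutely_continuous_on_interval:
  fixes h :: "real \<Rightarrow> 'e::euclidean_space"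
  assumes h: "L-lipschitz_on {a..b} h"
  shows "absolutely_continuous_on_interval a b h"
  unfolding absolutely_continuous_on_interval_def
proof (intro allI impI)
  fix \<epsilon> :: real assume \<epsilon>: "\<epsilon> > 0"
  have L: "L \<ge> 0" using h lipschitz_on_nonneg by blast
  show "\<exists>\<delta>>0. \<forall>D S. D division_of S \<and> S \<subseteq> {a..b} \<and> (\<Sum>I\<in>D. Sup I - Inf I) < \<delta> \<longrightarrow>
        (\<Sum>I\<in>D. norm (h (Sup I) - h (Inf I))) < \<epsilon>"
  \<comment> \<open>Using \<open>L + 1\<close> avoids a division by zero for constant
    curves.\<close>
  proof (intro exI[of _ "\<epsilon> / (L + 1)"] conjI allI impI, goal_cases)
    case (2 D S)
    have "norm (h (Sup I) - h (Inf I)) \<le> (L + 1) * (Sup I - Inf I)" if I: "I \<in> D" for I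
    proof -
      obtain c d where cd: "I = cbox c d" "cbox c d \<noteq> {}" "I \<subseteq> S"
        using division_ofD(2,3,4)[of D S I] 2 I by (metis)
      then have "c \<le> d" by simp
      moreover have "cbox c d \<subseteq> {a..b}" using cd 2 by blast
      ultimately have "c \<in> {a..b}" "d \<in> {a..b}" by auto
      then have "norm (h d - h c) \<le> L * (d - c)"
        using lipschitz_onD[OF h, of d c] \<open>c \<le> d\<close> by (simp add: dist_norm)
      also have "\<dots> \<le> (L + 1) * (d - c)" using \<open>c \<le> d\<close> by (intro mult_right_mono) auto
      finally show ?thesis using cd \<open>c \<le> d\<close> by simp
    qed
    then have "(\<Sum>I\<in>D. norm (h (Sup I) - h (Inf I))) \<le> (L + 1) * (\<Sum>I\<in>D. Sup I - Inf I)"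
      by (simp add: sum_distrib_left sum_mono)
    also have "\<dots> < (L + 1) * (\<epsilon> / (L + 1))" using 2 L by (intro mult_strict_left_mono) auto
    finally show ?case using L by simp
  qed (use \<epsilon> L in auto)
qed

section \<open>Curves in Euclidean space\<close>

lemma has_vector_derivative_quotient:
  assumes "(h has_vector_derivative v) (at t within S)"
  shows "((\<lambda>s. (h s - h t) /\<^sub>R (s - t)) \<longlongrightarrow> v) (at t within S)"
proof -
  have "((\<lambda>y. (h y - h t - (y - t) *\<^sub>R v) /\<^sub>R norm (y - t)) \<longlongrightarrow> 0) (at t within S)"
    using assms by (auto simp: has_vector_derivative_def has_derivative_within divide_inverse algebra_simps)
  \<comment> \<open>Under the norm, division by \<open>norm (y - t)\<close> and by
    \<open>y - t\<close> agree, so both sides of \<open>t\<close> are treated at once.\<close>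
  then have "((\<lambda>y. norm ((h y - h t - (y - t) *\<^sub>R v) /\<^sub>R norm (y - t))) \<longlongrightarrow> 0) (at t within S)"
    by (rule tendsto_norm_zero)
  then have "((\<lambda>y. norm ((h y - h t) /\<^sub>R (y - t) - v)) \<longlongrightarrow> 0) (at t within S)"
  proof (rule Lim_transform_eventually)
    show "\<forall>\<^sub>F y in at t within S. norm ((h y - h t - (y - t) *\<^sub>R v) /\<^sub>R norm (y - t)) = norm ((h y - h t) /\<^sub>R (y - t) - v)"
    proof (rule eventually_at_topological[THEN iffD2], intro exI[of _ UNIV] conjI ballI impI)
      fix y assume y: "y \<noteq> t"
      have "(h y - h t) /\<^sub>R (y - t) - v = (h y - h t - (y - t) *\<^sub>R v) /\<^sub>R (y - t)"
        using y by (simp add: scaleR_right_diff_distrib)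
      then show "norm ((h y - h t - (y - t) *\<^sub>R v) /\<^sub>R norm (y - t)) = norm ((h y - h t) /\<^sub>R (y - t) - v)"
        by simp
    qed auto
  qed
  then show ?thesis
    by (simp add: tendsto_norm_zero_iff LIM_zero_iff)
qed

text \<open>Quotients from times after \<open>t\<close> give \<open>v\<close>; those from times
  before \<open>t\<close>, divided by the positive \<open>t - s\<close>, give
  \<open>- v\<close>.\<close>

lemma velocity_in_tangent_cone:
  fixes h :: "real \<Rightarrow> 'e::euclidean_space"
  assumes h: "(h has_vector_derivative v) (at t)" and Y: "\<forall>\<^sub>F s in nhds t. h s \<in> Y"
  shows "v \<in> tangent_cone Y (h t)" "- v \<in> tangent_cone Y (h t)"
proof -
  note lim = has_vector_derivative_quotient[OF h]
  have Y': "\<forall>\<^sub>F s in at t. h s \<in> Y" using Y by (simp add: eventually_at_filter eventually_mono)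
  have ev: "\<forall>\<^sub>F s in at t. h s \<in> Y \<and> dist s t < \<epsilon> \<and> norm ((h s - h t) /\<^sub>R (s - t) - v) < \<epsilon>" if \<epsilon>: "\<epsilon> > 0" for \<epsilon>
  proof -
    have "\<forall>\<^sub>F s in at t. dist s t < \<epsilon>"
      using \<epsilon> by (auto simp: eventually_at)
    with Y' tendstoD[OF lim \<epsilon>] show ?thesis
      by eventually_elim (simp add: dist_norm)
  qed
  show "v \<in> tangent_cone Y (h t)"
    unfolding tangent_cone_iff
  proof (intro allI impI)
    fix \<epsilon> :: real assume "\<epsilon> > 0"
    from ev[OF this] have "\<forall>\<^sub>F s in at_right t. h s \<in> Y \<and> dist s t < \<epsilon> \<and> norm ((h s - h t) /\<^sub>R (s - t) - v) < \<epsilon>"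
      by (rule filter_leD[OF at_le, rotated]) simp
    moreover have "\<forall>\<^sub>F s in at_right t. t < s" by (simp add: eventually_at_right_less)
    ultimately have "\<forall>\<^sub>F s in at_right t. t < s \<and> h s \<in> Y \<and> dist s t < \<epsilon> \<and> norm ((h s - h t) /\<^sub>R (s - t) - v) < \<epsilon>"
      by eventually_elim simp
    then obtain s where "t < s" "h s \<in> Y" "dist s t < \<epsilon>" "norm ((h s - h t) /\<^sub>R (s - t) - v) < \<epsilon>"
      using eventually_happens[of _ "at_right t"] by (auto simp: trivial_limit_at_right_real)
    then show "\<exists>k z. 0 < k \<and> k < \<epsilon> \<and> z \<in> Y \<and> norm ((z - h t) /\<^sub>R k - v) < \<epsilon>"
      by (intro exI[of _ "s - t"] exI[of _ "h s"]) (auto simp: dist_real_def)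
  qed
  show "- v \<in> tangent_cone Y (h t)"
    unfolding tangent_cone_iff
  proof (intro allI impI)
    fix \<epsilon> :: real assume "\<epsilon> > 0"
    from ev[OF this] have "\<forall>\<^sub>F s in at_left t. h s \<in> Y \<and> dist s t < \<epsilon> \<and> norm ((h s - h t) /\<^sub>R (s - t) - v) < \<epsilon>"
      by (rule filter_leD[OF at_le, rotated]) simp
    moreover have "\<forall>\<^sub>F s in at_left t. s < t" by (auto simp: eventually_at_filter)
    ultimately have "\<forall>\<^sub>F s in at_left t. s < t \<and> h s \<in> Y \<and> dist s t < \<epsilon> \<and> norm ((h s - h t) /\<^sub>R (s - t) - v) < \<epsilon>"
      by eventually_elim simp
    then obtain s where s: "s < t" "h s \<in> Y" "dist s t < \<epsilon>" "norm ((h s - h t) /\<^sub>R (s - t) - v) < \<epsilon>"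
      using eventually_happens[of _ "at_left t"] by (auto simp: trivial_limit_at_left_real)
    have "(h s - h t) /\<^sub>R (t - s) - (- v) = - ((h s - h t) /\<^sub>R (s - t) - v)"
    proof -
      have "inverse (t - s) = - inverse (s - t)" by (metis inverse_minus_eq minus_diff_eq)
      then show ?thesis by simp
    qed
    then have "norm ((h s - h t) /\<^sub>R (t - s) - (- v)) < \<epsilon>" using s(4) by (simp only: norm_minus_cancel)
    then show "\<exists>k z. 0 < k \<and> k < \<epsilon> \<and> z \<in> Y \<and> norm ((z - h t) /\<^sub>R k - (- v)) < \<epsilon>"
      using s by (intro exI[of _ "t - s"] exI[of _ "h s"]) (auto simp: dist_real_def)
  qed
qed

lemma AE_lebesgue_onI:
  assumes "negligible N" "S \<in> sets lebesgue" "\<And>t. t \<in> S \<Longrightarrow> t \<notin> N \<Longrightarrow> P t"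
  shows "AE t in lebesgue_on S. P t"
proof -
  have "AE t in lebesgue. t \<in> S \<longrightarrow> P t"
    using assms by (intro AE_I'[of N]) (auto simp: negligible_iff_null_sets)
  then show ?thesis using assms(2) by (simp add: AE_restrict_space_iff)
qed

lemma locally_compact_compact_cball:
  fixes Y :: "'e::euclidean_space set"
  assumes "locally_compact_set Y" "y \<in> Y"
  obtains r where "r > 0" "compact (Y \<inter> cball y r)"
proof -
  obtain C U where CU: "closed C" "open U" "Y = C \<inter> U" using assms(1) by (auto simp: locally_compact_set_def)
  then obtain r where r: "r > 0" "cball y r \<subseteq> U" using assms(2) open_contains_cball by blast
  then have "Y \<inter> cball y r = C \<inter> cball y r" using CU by blast
  then show thesis using r CU by (intro that[of r]) (auto intro: closed_Int_compact)
qed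

text \<open>The set \<open>N\<close> need not be convex, so segments between points of the curve may
  leave it. The estimate is therefore made infinitesimally along the curve and then extended over
  the interval.\<close>

lemma C1_curve_lipschitz:
  fixes h :: "'e::euclidean_space \<Rightarrow> 'e" and x :: "real \<Rightarrow> 'e"
  assumes h: "\<And>y. y \<in> N \<Longrightarrow> (h has_derivative blinfun_apply (h' y)) (at y)" "continuous_on N h'"
    and x: "M-lipschitz_on {a..b} x" "x ` {a..b} \<subseteq> N"
  obtains L where "L-lipschitz_on {a..b} (\<lambda>t. h (x t))"
proof -
  have cx: "continuous_on {a..b} x" using x(1) lipschitz_on_continuous_on by blast
  have "compact (h' ` x ` {a..b})"
    using cx x(2) by (intro compact_continuous_image continuous_on_subset[OF h(2)]) auto
  from compact_imp_bounded[OF this] obtain B where "\<forall>z\<in>h' ` x ` {a..b}. norm z \<le> B"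
    unfolding bounded_iff by (elim exE)
  then have B: "\<And>t. t \<in> {a..b} \<Longrightarrow> norm (h' (x t)) \<le> B" by simp
  \<comment> \<open>\<open>\<bar>B\<bar>\<close> bounds the derivative on the curve; the summand 1
    is the tolerance for the remainder.\<close>
  define C where "C = \<bar>B\<bar> + 1"
  have M: "M \<ge> 0" using x(1) lipschitz_on_nonneg by blast
  have "(C * M)-lipschitz_on {a..b} (\<lambda>t. h (x t))"
  proof (rule locally_lipschitz_imp_lipschitz)
    have "continuous_on N h"
      using h(1) has_derivative_continuous continuous_at_imp_continuous_on by blast
    then show "continuous_on {a..b} (\<lambda>t. h (x t))"
      using cx x(2) continuous_on_compose2 by blast
    show "0 \<le> C * M" using M by (simp add: C_def)
    fix s y :: real assume s: "s \<in> {a..<b}" and "s < y"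
    then have sab: "s \<in> {a..b}" by auto
    have "x s \<in> N" using sab x(2) by blast
    obtain d where d: "d > 0" "\<And>z. norm (z - x s) < d \<Longrightarrow> norm (h z - h (x s) - blinfun_apply (h' (x s)) (z - x s)) \<le> 1 * norm (z - x s)"
      using h(1)[OF \<open>x s \<in> N\<close>] unfolding has_derivative_at_alt by (metis zero_less_one)
    obtain \<delta> where \<delta>: "\<delta> > 0" "\<And>z. z \<in> {a..b} \<Longrightarrow> dist z s < \<delta> \<Longrightarrow> dist (x z) (x s) < d"
      using cx sab d(1) unfolding continuous_on_iff by metis
    define z where "z = min y (min b (s + \<delta>/2))"
    have z: "s < z" "z \<le> y" "z \<in> {a..b}" "dist z s < \<delta>"
      using \<open>s < y\<close> s \<delta>(1) by (auto simp: z_def dist_real_def)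
    have "norm (h (x z) - h (x s)) \<le> norm (h (x z) - h (x s) - blinfun_apply (h' (x s)) (x z - x s)) + norm (blinfun_apply (h' (x s)) (x z - x s))"
      using norm_triangle_ineq[of "h (x z) - h (x s) - blinfun_apply (h' (x s)) (x z - x s)" "blinfun_apply (h' (x s)) (x z - x s)"]
      by (simp only: diff_add_cancel)
    also have "\<dots> \<le> norm (x z - x s) + \<bar>B\<bar> * norm (x z - x s)"
    proof (rule add_mono)
      show "norm (h (x z) - h (x s) - blinfun_apply (h' (x s)) (x z - x s)) \<le> norm (x z - x s)"
        using d(2)[of "x z"] \<delta>(2)[OF z(3,4)] by (simp add: dist_norm)
      have "norm (blinfun_apply (h' (x s)) (x z - x s)) \<le> norm (h' (x s)) * norm (x z - x s)"
        by (rule norm_blinfun)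
      also have "\<dots> \<le> \<bar>B\<bar> * norm (x z - x s)" using B[OF sab] by (intro mult_right_mono) auto
      finally show "norm (blinfun_apply (h' (x s)) (x z - x s)) \<le> \<bar>B\<bar> * norm (x z - x s)" .
    qed
    also have "\<dots> = C * norm (x z - x s)" by (simp add: C_def algebra_simps)
    also have "\<dots> \<le> C * (M * (z - s))"
      using lipschitz_onD[OF x(1) z(3) sab] z(1) by (intro mult_left_mono) (auto simp: dist_norm C_def)
    finally show "\<exists>z\<in>{s<..y}. dist (h (x z)) (h (x s)) \<le> C * M * (z - s)"
      using z by (intro bexI[of _ z]) (auto simp: dist_norm mult.assoc)
  qed
  then show thesis by (rule that)
qed

section \<open>Charts and tangent spaces\<close>

definition dtrans :: "('a, 'e::euclidean_space) chart \<Rightarrow> ('a, 'e) chart \<Rightarrow> 'a \<Rightarrow> 'e \<Rightarrow> 'e" where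
  "dtrans c d p = frechet_derivative (transition c d) (at (chart_map c p))"

locale C1_manifold =
  fixes A :: "('a::{t2_space, second_countable_topology}, 'e::euclidean_space) chart set"
  assumes C1: "C1_structure A"
begin

lemma is_chart: "c \<in> A \<Longrightarrow> is_chart c"
  using C1 by (auto simp: C1_structure_def)

lemma obtain_chart: obtains c where "c \<in> charts_at A p"
  using C1 unfolding C1_structure_def charts_at_def by (metis (mono_tags, lifting) UNIV_I UN_E mem_Collect_eq)

lemma chart_inv_map: "c \<in> A \<Longrightarrow> p \<in> chart_dom c \<Longrightarrow> chart_inv c (chart_map c p) = p"
  using is_chart by (auto simp: is_chart_def homeomorphism_def)

lemma open_chart_dom: "c \<in> A \<Longrightarrow> open (chart_dom c)"
  using is_chart by (auto simp: is_chart_def)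

lemma continuous_on_chart_inv: "c \<in> A \<Longrightarrow> continuous_on (chart_map c ` chart_dom c) (chart_inv c)"
  using is_chart by (auto simp: is_chart_def homeomorphism_def)

lemma open_chart_image:
  assumes "c \<in> A" "open U" "U \<subseteq> chart_dom c"
  shows "open (chart_map c ` U)"
proof -
  have "openin (top_of_set (chart_map c ` chart_dom c)) (chart_map c ` U)"
    using is_chart[OF assms(1)] assms(2,3)
    by (intro homeomorphism_imp_open_map[of "chart_dom c" _ _ "chart_inv c"])
      (auto simp: is_chart_def open_openin_trans)
  then show ?thesis
    using is_chart[OF assms(1)] openin_open_eq by (auto simp: is_chart_def)
qed

lemma transition_map: "c \<in> A \<Longrightarrow> p \<in> chart_dom c \<Longrightarrow> transition c d (chart_map c p) = chart_map d p"
  by (simp add: transition_def chart_inv_map)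

lemma open_overlap: "c \<in> A \<Longrightarrow> d \<in> A \<Longrightarrow> open (chart_map c ` (chart_dom c \<inter> chart_dom d))"
  by (intro open_chart_image) (auto simp: open_chart_dom)

text \<open>Besides the derivative itself, its continuity is made available: sequences with varying
  base points need it.\<close>

lemma transition_C1:
  assumes "c \<in> A" "d \<in> A"
  obtains h' where "\<And>y. y \<in> chart_map c ` (chart_dom c \<inter> chart_dom d) \<Longrightarrow>
      (transition c d has_derivative blinfun_apply (h' y)) (at y)"
    "continuous_on (chart_map c ` (chart_dom c \<inter> chart_dom d)) h'"
    "\<And>p. p \<in> chart_dom c \<inter> chart_dom d \<Longrightarrow> dtrans c d p = blinfun_apply (h' (chart_map c p))"
proof -
  obtain h' where h': "\<forall>y\<in>chart_map c ` (chart_dom c \<inter> chart_dom d).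
      (transition c d has_derivative blinfun_apply (h' y)) (at y)"
    "continuous_on (chart_map c ` (chart_dom c \<inter> chart_dom d)) h'"
    using C1 assms unfolding C1_structure_def C1_compatible_def C1_on_def by meson
  show thesis
  proof (rule that)
    show "dtrans c d p = blinfun_apply (h' (chart_map c p))" if "p \<in> chart_dom c \<inter> chart_dom d" for p
      unfolding dtrans_def using h'(1) that by (intro frechet_derivative_at[symmetric]) auto
  qed (use h' in auto)
qed

lemma has_derivative_transition:
  assumes "c \<in> charts_at A p" "d \<in> charts_at A p"
  shows "(transition c d has_derivative dtrans c d p) (at (chart_map c p))"
proof -
  have cd: "c \<in> A" "d \<in> A" "p \<in> chart_dom c \<inter> chart_dom d" using assms by (auto simp: charts_at_def)
  from transition_C1[OF cd(1,2)] obtain h' where "\<And>y. y \<in> chart_map c ` (chart_dom c \<inter> chart_dom d) \<Longrightarrow>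
      (transition c d has_derivative blinfun_apply (h' y)) (at y)"
    "\<And>p. p \<in> chart_dom c \<inter> chart_dom d \<Longrightarrow> dtrans c d p = blinfun_apply (h' (chart_map c p))"
    by metis
  then show ?thesis using cd(3) by (metis imageI)
qed

lemma linear_dtrans: "c \<in> charts_at A p \<Longrightarrow> d \<in> charts_at A p \<Longrightarrow> linear (dtrans c d p)"
  using has_derivative_transition has_derivative_linear by blast

lemma dtrans_dtrans:
  assumes "c \<in> charts_at A p" "d \<in> charts_at A p" "e \<in> charts_at A p"
  shows "dtrans d e p (dtrans c d p v) = dtrans c e p v"
proof -
  have A: "c \<in> A" "d \<in> A" "e \<in> A" "p \<in> chart_dom c \<inter> chart_dom d" using assms by (auto simp: charts_at_def)
  have td: "transition c d (chart_map c p) = chart_map d p"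
    using A by (simp add: transition_map)
  have "(transition d e \<circ> transition c d has_derivative dtrans d e p \<circ> dtrans c d p) (at (chart_map c p))"
    using has_derivative_transition[OF assms(1,2)] has_derivative_transition[OF assms(2,3)]
    by (intro diff_chain_at) (simp_all add: td)
  \<comment> \<open>Both maps send \<open>chart_map c q\<close> to \<open>chart_map e q\<close> for
    every \<open>q\<close> in the overlap of \<open>c\<close> and \<open>d\<close>, an open
    set.\<close>
  then have "(transition c e has_derivative dtrans d e p \<circ> dtrans c d p) (at (chart_map c p))"
  proof (rule has_derivative_transform_within_open)
    show "open (chart_map c ` (chart_dom c \<inter> chart_dom d))"
      using A by (intro open_overlap)
  qed (use A in \<open>auto simp: transition_map\<close>)
  from has_derivative_unique[OF this has_derivative_transition[OF assms(1,3)]]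
  show ?thesis by (metis comp_apply)
qed

lemma dtrans_refl:
  assumes "c \<in> charts_at A p"
  shows "dtrans c c p v = v"
proof -
  have A: "c \<in> A" "p \<in> chart_dom c" using assms by (auto simp: charts_at_def)
  have "(transition c c has_derivative id) (at (chart_map c p))"
    by (rule has_derivative_transform_within_open[of id _ _ _ "chart_map c ` chart_dom c"])
      (use A open_chart_image[OF A(1) open_chart_dom[OF A(1)]] in \<open>auto simp: transition_map id_def\<close>)
  from has_derivative_unique[OF this has_derivative_transition[OF assms assms]]
  show ?thesis by (metis id_apply)
qed

lemma tangent_space_chart:
  "v \<in> tangent_space A p \<Longrightarrow> c \<in> charts_at A p \<Longrightarrow> d \<in> charts_at A p \<Longrightarrow> v d = dtrans c d p (v c)"
  unfolding tangent_space_def mem_Collect_eq dtrans_def by (drule conjunct1, drule (1) bspec, erule (1) bspec)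

lemma tangent_space_outside: "v \<in> tangent_space A p \<Longrightarrow> c \<notin> charts_at A p \<Longrightarrow> v c = 0"
  unfolding tangent_space_def mem_Collect_eq by (drule conjunct2, drule spec, erule (1) mp)

lemma tangent_spaceI:
  assumes "\<And>c d. c \<in> charts_at A p \<Longrightarrow> d \<in> charts_at A p \<Longrightarrow> v d = dtrans c d p (v c)"
    and "\<And>c. c \<notin> charts_at A p \<Longrightarrow> v c = 0"
  shows "v \<in> tangent_space A p"
  unfolding tangent_space_def mem_Collect_eq
proof (intro conjI ballI allI impI)
  show "v d = frechet_derivative (transition c d) (at (chart_map c p)) (v c)"
    if "c \<in> charts_at A p" "d \<in> charts_at A p" for c d
    using assms(1)[OF that] unfolding dtrans_def .
qed (rule assms(2))

lemma tangent_space_eqI: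
  assumes "v \<in> tangent_space A p" "w \<in> tangent_space A p" "c \<in> charts_at A p" "v c = w c"
  shows "v = w"
proof
  fix d show "v d = w d"
  proof (cases "d \<in> charts_at A p")
    case True
    show ?thesis
      using tangent_space_chart[OF assms(1,3) True] tangent_space_chart[OF assms(2,3) True] assms(4) by simp
  next
    case False
    then show ?thesis using tangent_space_outside[OF assms(1) False] tangent_space_outside[OF assms(2) False] by simp
  qed
qed

text \<open>Evaluation at \<open>c\<close> is onto: the vectors \<open>dtrans c d p u\<close> form a
  consistent family by the cocycle rule. Hence \<open>inv_into\<close> yields a genuine right
  inverse.\<close>

lemma from_coord:
  assumes c: "c \<in> charts_at A p"
  shows from_coord_in: "from_coord A c p u \<in> tangent_space A p"
    and from_coord_apply: "d \<in> charts_at A p \<Longrightarrow> from_coord A c p u d = dtrans c d p u"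
    and from_coord_apply_self: "from_coord A c p u c = u"
proof -
  define w where "w d = (if d \<in> charts_at A p then dtrans c d p u else 0)" for d
  have "w \<in> tangent_space A p"
    by (rule tangent_spaceI) (simp_all only: w_def dtrans_dtrans[OF c] if_True if_False)
  moreover have "w c = u" by (simp add: w_def c dtrans_refl)
  ultimately have u: "u \<in> (\<lambda>v. v c) ` tangent_space A p" by blast
  show 1: "from_coord A c p u \<in> tangent_space A p"
    unfolding from_coord_def by (rule inv_into_into[OF u])
  show 2: "from_coord A c p u c = u"
    unfolding from_coord_def using f_inv_into_f[OF u] by simp
  show "from_coord A c p u d = dtrans c d p u" if "d \<in> charts_at A p"
    using tangent_space_chart[OF 1 c that] 2 by simp
qed

lemma from_coord_of:
  assumes c: "c \<in> charts_at A p" and v: "v \<in> tangent_space A p"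
  shows "from_coord A c p (v c) = v"
  by (rule tangent_space_eqI[OF from_coord_in[OF c] v c]) (simp only: from_coord_apply_self[OF c])

lemma tangent_space_add:
  assumes "v \<in> tangent_space A p" "w \<in> tangent_space A p"
  shows "(\<lambda>c. v c + w c) \<in> tangent_space A p"
proof (rule tangent_spaceI)
  fix c d assume cd: "c \<in> charts_at A p" "d \<in> charts_at A p"
  show "v d + w d = dtrans c d p (v c + w c)"
    by (simp only: linear_add[OF linear_dtrans[OF cd]] tangent_space_chart[OF assms(1) cd] tangent_space_chart[OF assms(2) cd])
next
  fix c assume c: "c \<notin> charts_at A p"
  show "v c + w c = 0"
    unfolding tangent_space_outside[OF assms(1) c] tangent_space_outside[OF assms(2) c] by simp
qed

lemma tangent_space_scaleR:
  assumes "v \<in> tangent_space A p"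
  shows "(\<lambda>c. a *\<^sub>R v c) \<in> tangent_space A p"
proof (rule tangent_spaceI)
  fix c d assume cd: "c \<in> charts_at A p" "d \<in> charts_at A p"
  show "a *\<^sub>R v d = dtrans c d p (a *\<^sub>R v c)"
    by (simp only: linear_scale[OF linear_dtrans[OF cd]] tangent_space_chart[OF assms(1) cd])
next
  fix c assume c: "c \<notin> charts_at A p"
  show "a *\<^sub>R v c = 0"
    unfolding tangent_space_outside[OF assms(1) c] by simp
qed

lemma tangent_space_diff:
  assumes "v \<in> tangent_space A p" "w \<in> tangent_space A p"
  shows "(\<lambda>c. v c - w c) \<in> tangent_space A p"
proof (rule tangent_spaceI)
  fix c d assume cd: "c \<in> charts_at A p" "d \<in> charts_at A p"
  show "v d - w d = dtrans c d p (v c - w c)"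
    by (simp only: linear_diff[OF linear_dtrans[OF cd]] tangent_space_chart[OF assms(1) cd] tangent_space_chart[OF assms(2) cd])
next
  fix c assume c: "c \<notin> charts_at A p"
  show "v c - w c = 0"
    unfolding tangent_space_outside[OF assms(1) c] tangent_space_outside[OF assms(2) c] by simp
qed

lemma from_coord_add:
  assumes c: "c \<in> charts_at A p"
  shows "from_coord A c p (u + v) = (\<lambda>d. from_coord A c p u d + from_coord A c p v d)"
proof (rule tangent_space_eqI)
  show "from_coord A c p (u + v) \<in> tangent_space A p" by (rule from_coord_in[OF c])
  show "(\<lambda>d. from_coord A c p u d + from_coord A c p v d) \<in> tangent_space A p"
    by (rule tangent_space_add[OF from_coord_in[OF c] from_coord_in[OF c]])
  show "from_coord A c p (u + v) c = from_coord A c p u c + from_coord A c p v c"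
    unfolding from_coord_apply_self[OF c] ..
qed (rule c)

lemma from_coord_scaleR:
  assumes c: "c \<in> charts_at A p"
  shows "from_coord A c p (a *\<^sub>R u) = (\<lambda>d. a *\<^sub>R from_coord A c p u d)"
proof (rule tangent_space_eqI)
  show "from_coord A c p (a *\<^sub>R u) \<in> tangent_space A p" by (rule from_coord_in[OF c])
  show "(\<lambda>d. a *\<^sub>R from_coord A c p u d) \<in> tangent_space A p"
    by (rule tangent_space_scaleR[OF from_coord_in[OF c]])
  show "from_coord A c p (a *\<^sub>R u) c = a *\<^sub>R from_coord A c p u c"
    unfolding from_coord_apply_self[OF c] ..
qed (rule c)

section \<open>Tangent cones and Krasovskii regularization in a single chart\<close>

lemma tangent_cone_chart_change:
  assumes c: "c \<in> charts_at A p" and d: "d \<in> charts_at A p"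
    and v: "v \<in> tangent_cone (chart_map c ` (X \<inter> chart_dom c)) (chart_map c p)"
  shows "dtrans c d p v \<in> tangent_cone (chart_map d ` (X \<inter> chart_dom d)) (chart_map d p)"
proof -
  have A: "c \<in> A" "d \<in> A" "p \<in> chart_dom c" "p \<in> chart_dom d" using c d by (auto simp: charts_at_def)
  have "dtrans c d p v \<in> tangent_cone (chart_map d ` (X \<inter> chart_dom d)) (transition c d (chart_map c p))"
  proof (rule tangent_cone_image[OF has_derivative_transition[OF c d] open_overlap[OF A(1,2)] _ _ v])
    show "transition c d ` (chart_map c ` (X \<inter> chart_dom c) \<inter> chart_map c ` (chart_dom c \<inter> chart_dom d))
      \<subseteq> chart_map d ` (X \<inter> chart_dom d)"
    proof
      fix z assume "z \<in> transition c d ` (chart_map c ` (X \<inter> chart_dom c) \<inter> chart_map c ` (chart_dom c \<inter> chart_dom d))"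
      then obtain y where y: "z = transition c d y" "y \<in> chart_map c ` (X \<inter> chart_dom c)"
        "y \<in> chart_map c ` (chart_dom c \<inter> chart_dom d)" by blast
      then obtain p q where p: "y = chart_map c p" "p \<in> X" "p \<in> chart_dom c"
        and q: "y = chart_map c q" "q \<in> chart_dom c" "q \<in> chart_dom d" by blast
      have "p = q" using chart_inv_map[OF A(1) p(3)] chart_inv_map[OF A(1) q(2)] p(1) q(1) by simp
      then show "z \<in> chart_map d ` (X \<inter> chart_dom d)"
        using y(1) p q A(1) by (simp add: transition_map)
    qed
  qed (use A in auto)
  then show ?thesis using A by (simp add: transition_map)
qed

lemma tangent_cone_mfd_iff:
  assumes c: "c \<in> charts_at A p"
  shows "v \<in> tangent_cone_mfd A X p \<longleftrightarrow> v \<in> tangent_space A p \<and>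
    v c \<in> tangent_cone (chart_map c ` (X \<inter> chart_dom c)) (chart_map c p)"
proof (intro iffI conjI)
  assume v: "v \<in> tangent_space A p \<and> v c \<in> tangent_cone (chart_map c ` (X \<inter> chart_dom c)) (chart_map c p)"
  then have "v d \<in> tangent_cone (chart_map d ` (X \<inter> chart_dom d)) (chart_map d p)" if "d \<in> charts_at A p" for d
    using tangent_cone_chart_change[OF c that] tangent_space_chart[OF conjunct1[OF v] c that] v by simp
  then show "v \<in> tangent_cone_mfd A X p"
    unfolding tangent_cone_mfd_def mem_Collect_eq using conjunct1[OF v] by (intro conjI ballI)
next
  assume "v \<in> tangent_cone_mfd A X p"
  then have v: "v \<in> tangent_space A p \<and> (\<forall>c\<in>charts_at A p.
      v c \<in> tangent_cone (chart_map c ` (X \<inter> chart_dom c)) (chart_map c p))"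
    unfolding tangent_cone_mfd_def mem_Collect_eq .
  show "v \<in> tangent_space A p" "v c \<in> tangent_cone (chart_map c ` (X \<inter> chart_dom c)) (chart_map c p)"
    using conjunct1[OF v] bspec[OF conjunct2[OF v] c] .
qed

text \<open>Approximating vectors are moved by the derivative of the transition map at their own
  base points. These derivatives converge, so limit values are moved by the derivative at
  \<open>p\<close>. Tangency of the values of \<open>F\<close> makes the moved vectors
  representatives in the other chart.\<close>

lemma krasovskii_iff:
  assumes c: "c \<in> charts_at A p" and F: "\<And>q. q \<in> X \<Longrightarrow> F q \<subseteq> tangent_space A q"
  shows "v \<in> krasovskii A X F p \<longleftrightarrow> v \<in> tangent_space A p \<and>
    v c \<in> krasovskii_Rn (chart_map c ` (X \<inter> chart_dom c)) (\<lambda>y. (\<lambda>w. w c) ` F (chart_inv c y)) (chart_map c p)"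
proof -
  have "v d \<in> krasovskii_Rn (chart_map d ` (X \<inter> chart_dom d)) (\<lambda>y. (\<lambda>w. w d) ` F (chart_inv d y)) (chart_map d p)"
    if v: "v \<in> tangent_space A p" and d: "d \<in> charts_at A p"
      and vc: "v c \<in> krasovskii_Rn (chart_map c ` (X \<inter> chart_dom c)) (\<lambda>y. (\<lambda>w. w c) ` F (chart_inv c y)) (chart_map c p)"
    for d
  proof -
    have A: "c \<in> A" "d \<in> A" "p \<in> chart_dom c" "p \<in> chart_dom d" using c d by (auto simp: charts_at_def)
    let ?N = "chart_map c ` (chart_dom c \<inter> chart_dom d)"
    obtain h' where h': "\<And>y. y \<in> ?N \<Longrightarrow> (transition c d has_derivative blinfun_apply (h' y)) (at y)"
      "continuous_on ?N h'"
      "\<And>p. p \<in> chart_dom c \<inter> chart_dom d \<Longrightarrow> dtrans c d p = blinfun_apply (h' (chart_map c p))"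
      by (rule transition_C1[OF A(1,2)]; rule that; assumption)
    have pN: "chart_map c p \<in> ?N" using A by auto
    have "dtrans c d p (v c) \<in> krasovskii_Rn (chart_map d ` (X \<inter> chart_dom d))
        (\<lambda>y. (\<lambda>w. w d) ` F (chart_inv d y)) (chart_map d p)"
    proof (rule krasovskii_Rn_linear_image[OF linear_dtrans[OF c d] vc])
      fix ys vs w assume ys: "\<And>k. ys k \<in> chart_map c ` (X \<inter> chart_dom c) \<and> vs k \<in> (\<lambda>w. w c) ` F (chart_inv c (ys k))"
        and lim: "ys \<longlonglongrightarrow> chart_map c p" "vs \<longlonglongrightarrow> w"
      have "\<forall>\<^sub>F k in sequentially. ys k \<in> ?N"
        using topological_tendstoD[OF lim(1) open_overlap[OF A(1,2)] pN] .
      then obtain k0 where k0: "\<And>k. k \<ge> k0 \<Longrightarrow> ys k \<in> ?N"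
        unfolding eventually_sequentially by blast
      \<comment> \<open>The shift by \<open>k0\<close> drops the terms outside the overlap, because
        membership is demanded at every index.\<close>
      define zs ws where "zs k = transition c d (ys (k + k0))" and "ws k = blinfun_apply (h' (ys (k + k0))) (vs (k + k0))" for k
      have lim': "(\<lambda>k. ys (k + k0)) \<longlonglongrightarrow> chart_map c p" "(\<lambda>k. vs (k + k0)) \<longlonglongrightarrow> w"
        using lim by (simp_all add: LIMSEQ_ignore_initial_segment)
      have "isCont (transition c d) (chart_map c p)"
        using h'(1)[OF pN] has_derivative_continuous by blast
      then have "zs \<longlonglongrightarrow> transition c d (chart_map c p)"
        unfolding zs_def by (rule isCont_tendsto_compose[OF _ lim'(1)])
      then have zlim: "zs \<longlonglongrightarrow> chart_map d p" using A by (simp add: transition_map)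
      have "isCont h' (chart_map c p)"
        using h'(2) pN open_overlap[OF A(1,2)] continuous_on_eq_continuous_at by blast
      then have "(\<lambda>k. h' (ys (k + k0))) \<longlonglongrightarrow> h' (chart_map c p)"
        by (rule isCont_tendsto_compose[OF _ lim'(1)])
      then have "ws \<longlonglongrightarrow> blinfun_apply (h' (chart_map c p)) w"
        unfolding ws_def by (intro blinfun.tendsto lim'(2))
      then have wlim: "ws \<longlonglongrightarrow> dtrans c d p w" using h'(3) A by simp
      have "zs k \<in> chart_map d ` (X \<inter> chart_dom d) \<and> ws k \<in> (\<lambda>w. w d) ` F (chart_inv d (zs k))" for k
      proof -
        obtain q where q: "q \<in> chart_dom c" "q \<in> chart_dom d" "ys (k + k0) = chart_map c q"
          using k0[of "k + k0"] by auto
        have qinv: "chart_inv c (ys (k + k0)) = q" using q A chart_inv_map by simp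
        then have "q \<in> X" using ys[of "k + k0"] chart_inv_map[OF A(1)] by force
        obtain w where w: "w \<in> F q" "vs (k + k0) = w c" using ys[of "k + k0"] qinv by auto
        have zq: "zs k = chart_map d q" using q A by (simp add: zs_def transition_map)
        have "ws k = w d"
          using tangent_space_chart[of w q c d] F[OF \<open>q \<in> X\<close>] w q A h'(3)[of q]
          by (auto simp: ws_def charts_at_def)
        then show ?thesis
          using w(1) q(2) \<open>q \<in> X\<close> A zq chart_inv_map by auto
      qed
      then show "\<exists>zs ws. (\<forall>k::nat. zs k \<in> chart_map d ` (X \<inter> chart_dom d) \<and> ws k \<in> (\<lambda>w. w d) ` F (chart_inv d (zs k))) \<and>
         zs \<longlonglongrightarrow> chart_map d p \<and> ws \<longlonglongrightarrow> dtrans c d p w"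
        using zlim wlim by blast
    qed
    then show ?thesis using tangent_space_chart[OF v c d] by simp
  qed
  then show ?thesis using c unfolding krasovskii_def by blast
qed

text \<open>Constant sequences realize the value as a limit. This is the direction from Caratheodory
  to Krasovskii solutions.\<close>

lemma values_in_krasovskii:
  assumes p: "p \<in> X" and v: "v \<in> F p" "v \<in> tangent_space A p"
  shows "v \<in> krasovskii A X F p"
  unfolding krasovskii_def
proof (intro CollectI conjI ballI)
  fix c assume "c \<in> charts_at A p"
  then have c: "c \<in> A" "p \<in> chart_dom c" by (auto simp: charts_at_def)
  have "v c \<in> {v. \<exists>(ys :: nat \<Rightarrow> 'e) vs. (\<forall>k. ys k \<in> chart_map c ` (X \<inter> chart_dom c) \<and>
      vs k \<in> (\<lambda>w. w c) ` F (chart_inv c (ys k))) \<and> ys \<longlonglongrightarrow> chart_map c p \<and> vs \<longlonglongrightarrow> v}"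
    using p v c by (intro CollectI exI[of _ "\<lambda>_. chart_map c p"] exI[of _ "\<lambda>_. v c"]) (auto simp: chart_inv_map)
  then show "v c \<in> krasovskii_Rn (chart_map c ` (X \<inter> chart_dom c)) (\<lambda>y. (\<lambda>w. w c) ` F (chart_inv c y)) (chart_map c p)"
    unfolding krasovskii_Rn_def by (meson closure_subset hull_inc subsetD)
qed (rule v(2))

section \<open>Velocities of curves in a single chart\<close>

lemma obtain_near_chart:
  fixes t T :: real
  assumes "c \<in> A" "continuous_on {0..<T} x" "t \<in> {0..<T}" "x t \<in> chart_dom c"
  obtains \<delta> where "\<delta> > 0" "\<And>s. s \<in> {0..<T} \<Longrightarrow> dist s t < \<delta> \<Longrightarrow> x s \<in> chart_dom c"
proof -
  have "\<exists>U. open U \<and> U \<inter> {0..<T} = x -` chart_dom c \<inter> {0..<T}"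
    using assms(2) open_chart_dom[OF assms(1)] unfolding continuous_on_open_invariant by blast
  then obtain U where U: "open U" "U \<inter> {0..<T} = x -` chart_dom c \<inter> {0..<T}" by blast
  have "t \<in> x -` chart_dom c \<inter> {0..<T}" using assms(3,4) by simp
  then have "t \<in> U" unfolding U(2)[symmetric] by (rule IntD1)
  then obtain \<delta> where \<delta>: "\<delta> > 0" "ball t \<delta> \<subseteq> U" by (rule openE[OF U(1)])
  show ?thesis
  proof (rule that[OF \<delta>(1)])
    fix s assume "s \<in> {0..<T}" "dist s t < \<delta>"
    then have "s \<in> U \<inter> {0..<T}" using \<delta>(2) by (auto simp: dist_commute)
    then show "x s \<in> chart_dom c" unfolding U(2) by blast
  qed
qed

text \<open>By continuity the curve stays in the domain of \<open>c\<close> near \<open>t\<close>,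
  so the chain rule carries the derivative to every other chart at \<open>x t\<close>.\<close>

lemma has_velocityI:
  assumes c: "c \<in> charts_at A (x t)" and S: "t \<in> {0..<T}" "continuous_on {0..<T} x"
    and u: "((chart_map c \<circ> x) has_vector_derivative u) (at t within {0..<T})"
  shows "has_velocity A T x t (from_coord A c (x t) u)"
  unfolding has_velocity_def
proof (intro conjI ballI)
  fix d assume d: "d \<in> charts_at A (x t)"
  have A: "c \<in> A" "d \<in> A" "x t \<in> chart_dom c \<inter> chart_dom d" using c d by (auto simp: charts_at_def)
  have "((transition c d \<circ> (chart_map c \<circ> x)) has_derivative
      dtrans c d (x t) \<circ> (\<lambda>s. s *\<^sub>R u)) (at t within {0..<T})"
    using has_derivative_transition[OF c d] u
    by (intro diff_chain_within) (auto simp: has_vector_derivative_def intro: has_derivative_at_withinI)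
  then have *: "((transition c d \<circ> (chart_map c \<circ> x)) has_vector_derivative dtrans c d (x t) u) (at t within {0..<T})"
    using linear_scale[OF linear_dtrans[OF c d]] by (simp add: has_vector_derivative_def o_def)
  obtain \<delta> where \<delta>: "\<delta> > 0" "\<And>s. s \<in> {0..<T} \<Longrightarrow> dist s t < \<delta> \<Longrightarrow> x s \<in> chart_dom c"
    using obtain_near_chart[OF A(1) S(2,1)] A(3) by blast
  have "((chart_map d \<circ> x) has_vector_derivative dtrans c d (x t) u) (at t within {0..<T})"
    using * \<delta>(1) S(1)
  proof (rule has_vector_derivative_transform_within)
    fix s assume "s \<in> {0..<T}" "dist s t < \<delta>"
    then show "(transition c d \<circ> (chart_map c \<circ> x)) s = (chart_map d \<circ> x) s"
      using \<delta>(2) A by (simp add: transition_map)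
  qed
  then show "((chart_map d \<circ> x) has_vector_derivative from_coord A c (x t) u d) (at t within {0..<T})"
    using from_coord_apply[OF c d] by simp
qed (rule from_coord_in[OF c])

section \<open>Projected vector fields\<close>

lemma metric_coord_eq:
  assumes c: "c \<in> charts_at A p" and v: "v \<in> tangent_space A p" and w: "w \<in> tangent_space A p"
  shows "metric_coord A c g (chart_map c p) (v c) (w c) = g p v w"
proof -
  have "chart_inv c (chart_map c p) = p" using c chart_inv_map unfolding charts_at_def by blast
  then show ?thesis
    unfolding metric_coord_def by (simp only: from_coord_of[OF c v] from_coord_of[OF c w])
qed

lemma inner_prod_metric_coord:
  assumes g: "riemannian_metric A g" and c: "c \<in> charts_at A p"
  shows "inner_prod (metric_coord A c g (chart_map c p))"
proof -
  define G where "G = metric_coord A c g (chart_map c p)"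
  have inv: "chart_inv c (chart_map c p) = p" using c chart_inv_map unfolding charts_at_def by blast
  have G: "G u v = g p (from_coord A c p u) (from_coord A c p v)" for u v
    unfolding G_def metric_coord_def inv ..
  note ip = g[unfolded riemannian_metric_def, rule_format, of p, unfolded inner_product_on_def]
  note ip1 = ip[THEN conjunct1, rule_format]
    and ip2 = ip[THEN conjunct2, THEN conjunct1, rule_format]
    and ip3 = ip[THEN conjunct2, THEN conjunct2, THEN conjunct1, rule_format]
    and ip4 = ip[THEN conjunct2, THEN conjunct2, THEN conjunct2, rule_format]
  note T = from_coord_in[OF c]
  have sym: "G u v = G v u" for u v
    unfolding G by (rule ip1[OF T T])
  have add: "G (u + v) w = G u w + G v w" for u v w
    unfolding G from_coord_add[OF c] by (rule ip2[OF T T T])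
  have scale: "G (a *\<^sub>R u) w = a * G u w" for a u w
    unfolding G from_coord_scaleR[OF c] by (rule ip3[OF T T])
  have pos: "G u u > 0" if "u \<noteq> 0" for u
  proof -
    have "from_coord A c p u \<noteq> (\<lambda>c. 0)"
    proof (rule notI)
      assume z: "from_coord A c p u = (\<lambda>c. 0)"
      have "u = 0" using fun_cong[OF z, of c] unfolding from_coord_apply_self[OF c] .
      then show False using that by simp
    qed
    then show ?thesis unfolding G by (rule ip4[OF T])
  qed
  have "linear (\<lambda>u. G u w)" for w by (rule linearI) (simp_all add: add scale)
  moreover have "linear (G w)" for w
  proof -
    have "G w = (\<lambda>u. G u w)" by (rule ext) (rule sym)
    then show ?thesis using calculation by simp
  qed
  ultimately have "bounded_bilinear G"
    unfolding bilinear_conv_bounded_bilinear[symmetric] bilinear_def by blast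
  then show ?thesis
    unfolding inner_prod_def G_def[symmetric] using sym pos by blast
qed

lemma projected_field_subset: "projected_field A X g f p \<subseteq> tangent_space A p"
  unfolding projected_field_def is_arg_min_def tangent_cone_mfd_def
  by (rule subsetI, drule CollectD, drule conjunct1, drule CollectD, erule conjunct1)

text \<open>Evaluation at \<open>c\<close> maps the tangent cone of \<open>X\<close> bijectively
  onto \<open>T\<close> and turns \<open>g p\<close> into \<open>G\<close>, so the minimization can
  be done in one chart.\<close>

lemma projected_field_iff:
  fixes X :: "'a set" and g :: "('a, 'e) metric"
  assumes c: "c \<in> charts_at A p" and f: "f p \<in> tangent_space A p"
  defines "T \<equiv> tangent_cone (chart_map c ` (X \<inter> chart_dom c)) (chart_map c p)"
    and "G \<equiv> metric_coord A c g (chart_map c p)"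
  shows "v \<in> projected_field A X g f p \<longleftrightarrow> v \<in> tangent_space A p \<and> v c \<in> T \<and>
    (\<forall>w\<in>T. G (v c - f p c) (v c - f p c) \<le> G (w - f p c) (w - f p c))"
proof -
  define Q where "Q w = g p (\<lambda>c. w c - f p c) (\<lambda>c. w c - f p c)" for w
  have Q: "Q w = G (w c - f p c) (w c - f p c)" if "w \<in> tangent_space A p" for w
    unfolding Q_def G_def using metric_coord_eq[OF c tangent_space_diff[OF that f] tangent_space_diff[OF that f], of g] ..
  have T: "w \<in> tangent_cone_mfd A X p \<longleftrightarrow> w \<in> tangent_space A p \<and> w c \<in> T" for w
    unfolding T_def by (rule tangent_cone_mfd_iff[OF c])
  have "v \<in> projected_field A X g f p \<longleftrightarrow> v \<in> tangent_cone_mfd A X p \<and> (\<forall>w\<in>tangent_cone_mfd A X p. Q v \<le> Q w)"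
    unfolding projected_field_def is_arg_min_def mem_Collect_eq Q_def[symmetric]
    by (simp only: not_ex de_Morgan_conj not_less imp_conv_disj[symmetric] Ball_def)
  also have "\<dots> \<longleftrightarrow> v \<in> tangent_space A p \<and> v c \<in> T \<and>
    (\<forall>w\<in>T. G (v c - f p c) (v c - f p c) \<le> G (w - f p c) (w - f p c))"
  proof (intro iffI conjI ballI)
    assume v: "v \<in> tangent_cone_mfd A X p \<and> (\<forall>w\<in>tangent_cone_mfd A X p. Q v \<le> Q w)"
    then show vT: "v \<in> tangent_space A p" and "v c \<in> T" using T by blast+
    fix w assume "w \<in> T"
    then have "from_coord A c p w \<in> tangent_cone_mfd A X p"
      unfolding T from_coord_apply_self[OF c] using from_coord_in[OF c] by blast
    then have "Q v \<le> Q (from_coord A c p w)" using v by blast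
    then show "G (v c - f p c) (v c - f p c) \<le> G (w - f p c) (w - f p c)"
      unfolding Q[OF vT] Q[OF from_coord_in[OF c]] from_coord_apply_self[OF c] .
  next
    assume v: "v \<in> tangent_space A p \<and> v c \<in> T \<and>
      (\<forall>w\<in>T. G (v c - f p c) (v c - f p c) \<le> G (w - f p c) (w - f p c))"
    then show "v \<in> tangent_cone_mfd A X p" using T by blast
    fix w assume "w \<in> tangent_cone_mfd A X p"
    then have w: "w \<in> tangent_space A p" "w c \<in> T" using T by blast+
    show "Q v \<le> Q w" unfolding Q[OF w(1)] Q[OF conjunct1[OF v]] using v w(2) by blast
  qed
  finally show ?thesis .
qed

section \<open>Existence of Krasovskii solutions\<close>

text \<open>In a ball inside the image of \<open>chart_dom c \<inter> U\<close>, belonging to the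
  coordinate image of \<open>X\<close> means that the chart inverse lands in \<open>C\<close>, a
  closed condition.\<close>

lemma compact_coord_cball:
  assumes X: "locally_compact_set X" and p: "p \<in> X" "c \<in> charts_at A p"
  obtains r where "r > 0" "compact (chart_map c ` (X \<inter> chart_dom c) \<inter> cball (chart_map c p) r)"
proof -
  obtain C U where CU: "closed C" "open U" "X = C \<inter> U" using X by (auto simp: locally_compact_set_def)
  have c: "c \<in> A" "p \<in> chart_dom c" using p(2) by (auto simp: charts_at_def)
  let ?W = "chart_map c ` (chart_dom c \<inter> U)"
  have "open ?W" using CU open_chart_dom[OF c(1)] by (intro open_chart_image[OF c(1)]) auto
  moreover have "chart_map c p \<in> ?W" using c p CU by auto
  ultimately obtain r where r: "r > 0" "cball (chart_map c p) r \<subseteq> ?W" using open_contains_cball by blast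
  let ?B = "cball (chart_map c p) r"
  have "chart_map c ` (X \<inter> chart_dom c) \<inter> ?B = ?B \<inter> chart_inv c -` C"
  proof (intro equalityI subsetI)
    fix y assume "y \<in> chart_map c ` (X \<inter> chart_dom c) \<inter> ?B"
    then obtain q where "y = chart_map c q" "q \<in> X" "q \<in> chart_dom c" "y \<in> ?B" by blast
    then show "y \<in> ?B \<inter> chart_inv c -` C" using chart_inv_map[OF c(1)] CU(3) by simp
  next
    fix y assume y: "y \<in> ?B \<inter> chart_inv c -` C"
    then obtain q where q: "y = chart_map c q" "q \<in> chart_dom c" "q \<in> U" using r(2) by blast
    then have "q \<in> X" using y chart_inv_map[OF c(1)] CU(3) by simp
    then show "y \<in> chart_map c ` (X \<inter> chart_dom c) \<inter> ?B" using q y by blast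
  qed
  moreover have "closed (?B \<inter> chart_inv c -` C)"
    using continuous_on_subset[OF continuous_on_chart_inv[OF c(1)]] r(2)
    by (intro continuous_closed_preimage) (auto simp: CU(1))
  ultimately show thesis
    using r(1) by (intro that[of r]) (auto simp: compact_eq_bounded_closed intro: bounded_subset[OF bounded_cball])
qed

text \<open>A C1 transition map keeps the curve Lipschitz on each compact time interval spent in the
  other chart domain.\<close>

lemma absolutely_continuous_curve_chart_inv:
  assumes c: "c \<in> A" and x: "M-lipschitz_on {0..T} x" "x ` {0..T} \<subseteq> chart_map c ` chart_dom c"
  shows "absolutely_continuous_curve A T (\<lambda>t. chart_inv c (x t))"
  unfolding absolutely_continuous_curve_def
proof (intro conjI ballI allI impI)
  have "continuous_on {0..<T} x"
    by (rule continuous_on_subset[OF lipschitz_on_continuous_on[OF x(1)]]) auto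
  then show "continuous_on {0..<T} (\<lambda>t. chart_inv c (x t))"
    by (rule continuous_on_compose2[OF continuous_on_chart_inv[OF c]]) (use x(2) in auto)
  fix d a b assume d: "d \<in> A" and ab: "{a..b} \<subseteq> {0..<T} \<and> (\<lambda>t. chart_inv c (x t)) ` {a..b} \<subseteq> chart_dom d"
  obtain h' where h': "\<And>y. y \<in> chart_map c ` (chart_dom c \<inter> chart_dom d) \<Longrightarrow> (transition c d has_derivative blinfun_apply (h' y)) (at y)"
      "continuous_on (chart_map c ` (chart_dom c \<inter> chart_dom d)) h'"
    by (rule transition_C1[OF c d]; rule that; assumption)
  have sub: "{a..b} \<subseteq> {0..T}"
  proof
    fix t assume "t \<in> {a..b}"
    then have "t \<in> {0..<T}" using ab by blast
    then show "t \<in> {0..T}" by simp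
  qed
  have "x ` {a..b} \<subseteq> chart_map c ` (chart_dom c \<inter> chart_dom d)"
  proof
    fix y assume "y \<in> x ` {a..b}"
    then obtain t where t: "t \<in> {a..b}" "y = x t" by blast
    then obtain q where q: "q \<in> chart_dom c" "y = chart_map c q" using x(2) sub by blast
    have "chart_inv c (x t) \<in> chart_dom d" using ab t(1) by blast
    then have "q \<in> chart_dom d" using chart_inv_map[OF c q(1)] t(2) q(2) by simp
    then show "y \<in> chart_map c ` (chart_dom c \<inter> chart_dom d)" using q by blast
  qed
  from C1_curve_lipschitz[OF h' lipschitz_on_subset[OF x(1) sub] this]
  obtain L where "L-lipschitz_on {a..b} (\<lambda>t. transition c d (x t))" by blast
  moreover have "(\<lambda>t. transition c d (x t)) = chart_map d \<circ> (\<lambda>t. chart_inv c (x t))"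
    by (simp add: transition_def o_def)
  ultimately show "absolutely_continuous_on_interval a b (chart_map d \<circ> (\<lambda>t. chart_inv c (x t)))"
    using lipschitz_imp_absolutely_continuous_on_interval by metis
qed

text \<open>Projections exist because tangent cones are closed and contain 0. Their norm is at most
  \<open>(L + 1) * B\<close>, with \<open>B\<close> a local bound of the field and \<open>L\<close>
  one of the condition number.\<close>

lemma bounded_projection_selection:
  fixes X :: "'a set" and g :: "('a, 'e) metric"
  assumes g: "riemannian_metric A g" "locally_weakly_bounded A g" and X: "locally_compact_set X"
    and f: "vector_field_on A X f" "locally_bounded_field A X f"
    and p: "p \<in> X" and c: "c \<in> charts_at A p"
  defines "Y \<equiv> chart_map c ` (X \<inter> chart_dom c)"
  obtains r M u where "r > 0" "compact (Y \<inter> cball (chart_map c p) r)"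
    "\<And>y. y \<in> Y \<inter> cball (chart_map c p) r \<Longrightarrow> u y \<in> (\<lambda>w. w c) ` projected_field A X g f (chart_inv c y)"
    "\<And>y. y \<in> Y \<inter> cball (chart_map c p) r \<Longrightarrow> u y \<in> tangent_cone Y y"
    "\<And>y. y \<in> Y \<inter> cball (chart_map c p) r \<Longrightarrow> norm (u y) \<le> M"
proof -
  have cA: "c \<in> A" "p \<in> chart_dom c" using c by (auto simp: charts_at_def)
  let ?y = "chart_map c p"
  have yY: "?y \<in> Y" using p cA by (auto simp: Y_def)
  obtain R where R: "R > 0" "compact (Y \<inter> cball ?y R)"
    using compact_coord_cball[OF X p c] unfolding Y_def by metis
  have "locally_bounded_on Y (field_coord c f)"
    using f(2) cA(1) unfolding locally_bounded_field_def Y_def by (rule bspec)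
  then obtain N where N: "open N" "?y \<in> N" "bounded (field_coord c f ` (N \<inter> Y))"
    using yY unfolding locally_bounded_on_def by metis
  obtain B where B: "\<And>z. z \<in> N \<inter> Y \<Longrightarrow> norm (field_coord c f z) \<le> B"
    using N(3) unfolding bounded_iff by (metis imageI)
  have "\<exists>l>0. \<exists>L>0. \<forall>\<^sub>F z in nhds ?y. l \<le> condition_number (metric_coord A c g z) \<and>
        condition_number (metric_coord A c g z) \<le> L"
    using bspec[OF bspec[OF g(2)[unfolded locally_weakly_bounded_def] cA(1)] imageI[OF cA(2)]] .
  then obtain l L where L: "L > 0" and "\<forall>\<^sub>F z in nhds ?y. l \<le> condition_number (metric_coord A c g z) \<and>
        condition_number (metric_coord A c g z) \<le> L" by blast
  then have Lev: "\<forall>\<^sub>F z in nhds ?y. condition_number (metric_coord A c g z) \<le> L"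
    by (elim eventually_mono conjunct2)
  obtain N' where N': "open N'" "?y \<in> N'" "\<And>z. z \<in> N' \<Longrightarrow> condition_number (metric_coord A c g z) \<le> L"
    using Lev unfolding eventually_nhds by metis
  obtain \<rho> where \<rho>: "\<rho> > 0" "cball ?y \<rho> \<subseteq> N \<inter> N'"
    using open_contains_cball[of "N \<inter> N'"] N N' by (meson IntI open_Int)
  define r where "r = min R \<rho>"
  have "Y \<inter> cball ?y r = Y \<inter> cball ?y R \<inter> cball ?y r" by (auto simp: r_def)
  then have cpt: "compact (Y \<inter> cball ?y r)" using compact_Int[OF R(2) compact_cball] by simp
  have "\<exists>u. u \<in> (\<lambda>w. w c) ` projected_field A X g f (chart_inv c y) \<and> u \<in> tangent_cone Y y \<and> norm u \<le> (L + 1) * B"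
    if y: "y \<in> Y \<inter> cball ?y r" for y
  proof -
    obtain q where q: "y = chart_map c q" "q \<in> X" "q \<in> chart_dom c" using y by (auto simp: Y_def)
    have cq: "c \<in> charts_at A q" using q cA by (simp add: charts_at_def)
    have inv: "chart_inv c y = q" using q chart_inv_map cA by simp
    have yN: "y \<in> N \<inter> Y" "y \<in> N'" using y \<rho>(2) by (auto simp: r_def)
    have fq: "f q \<in> tangent_space A q" using f(1) q(2) unfolding vector_field_on_def by (rule bspec)
    define G where "G = metric_coord A c g y"
    have G: "inner_prod G" unfolding G_def q(1) by (rule inner_prod_metric_coord[OF g(1) cq])
    have "0 \<in> tangent_cone Y y" using y by (intro zero_in_tangent_cone) blast
    then obtain v where v: "v \<in> tangent_cone Y y" "\<And>w. w \<in> tangent_cone Y y \<Longrightarrow> G (v - f q c) (v - f q c) \<le> G (w - f q c) (w - f q c)"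
      "norm v \<le> (condition_number G + 1) * norm (f q c)"
      using inner_prod_minimizer[OF G closed_tangent_cone] by metis
    have "norm (f q c) \<le> B" using B[OF yN(1)] by (simp add: field_coord_def inv)
    then have "(condition_number G + 1) * norm (f q c) \<le> (L + 1) * B"
      using N'(3)[OF yN(2)] L by (intro mult_mono) (auto simp: G_def)
    then have "norm v \<le> (L + 1) * B" using v(3) by (rule order_trans[rotated])
    moreover have "from_coord A c q v \<in> projected_field A X g f q"
      unfolding projected_field_iff[where f = f, OF cq fq] from_coord_apply_self[OF cq] q(1)[symmetric]
        Y_def[symmetric] G_def[symmetric]
      using from_coord_in[OF cq] v(1,2) by (intro conjI ballI)
    then have "v \<in> (\<lambda>w. w c) ` projected_field A X g f (chart_inv c y)"
      unfolding inv by (rule rev_image_eqI) (rule from_coord_apply_self[OF cq, symmetric])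
    ultimately show ?thesis using v(1) by blast
  qed
  then obtain u where "\<And>y. y \<in> Y \<inter> cball ?y r \<Longrightarrow> u y \<in> (\<lambda>w. w c) ` projected_field A X g f (chart_inv c y) \<and> u y \<in> tangent_cone Y y \<and> norm (u y) \<le> (L + 1) * B"
    by metis
  then show thesis
    using R(1) \<rho>(1) cpt by (intro that[of r u "(L + 1) * B"]) (auto simp: r_def)
qed

lemma krasovskii_solution_exists:
  fixes X :: "'a set" and g :: "('a, 'e) metric"
  assumes g: "riemannian_metric A g" "locally_weakly_bounded A g" and X: "locally_compact_set X"
    and f: "vector_field_on A X f" "locally_bounded_field A X f" and p: "p \<in> X"
  shows "\<exists>T>0. \<exists>x. krasovskii_solution A X (projected_field A X g f) p T x"
proof -
  obtain c where c: "c \<in> charts_at A p" using obtain_chart by blast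
  have cA: "c \<in> A" "p \<in> chart_dom c" using c by (auto simp: charts_at_def)
  define Y y0 where "Y = chart_map c ` (X \<inter> chart_dom c)" and "y0 = chart_map c p"
  define F where "F = projected_field A X g f"
  have yY: "y0 \<in> Y" using p cA by (auto simp: Y_def y0_def)
  obtain r M u where r: "r > 0" "compact (Y \<inter> cball y0 r)"
    and uF: "\<And>y. y \<in> Y \<inter> cball y0 r \<Longrightarrow> u y \<in> (\<lambda>w. w c) ` F (chart_inv c y)"
    and uT: "\<And>y. y \<in> Y \<inter> cball y0 r \<Longrightarrow> u y \<in> tangent_cone Y y"
    and uM: "\<And>y. y \<in> Y \<inter> cball y0 r \<Longrightarrow> norm (u y) \<le> M"
    by (rule bounded_projection_selection[OF g X f p c, folded Y_def y0_def F_def]; rule that; assumption)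
  define K where "K = Y \<inter> cball y0 r"
  have "y0 \<in> K" using yY r(1) by (simp add: K_def)
  have M: "M \<ge> 0" using order_trans[OF norm_ge_zero uM[of y0]] \<open>y0 \<in> K\<close> by (simp add: K_def)
  \<comment> \<open>The time during which speed \<open>M\<close>, with an allowance of 1 for the
    Euler error, cannot leave the ball of radius \<open>r\<close>.\<close>
  define T where "T = r / (M + 1)"
  have T: "T > 0" "T * (M + 1) \<le> r" using r(1) M by (auto simp: T_def)
  obtain x where x: "x 0 = y0" "x ` {0..T} \<subseteq> K"
    "\<And>s t C \<rho>. \<lbrakk>0 \<le> s; s < t; t \<le> T; closed C; convex C; M * (t - s) < \<rho>;
        \<And>y. y \<in> K \<inter> cball (x s) \<rho> \<Longrightarrow> u y \<in> C\<rbrakk> \<Longrightarrow> (x t - x s) /\<^sub>R (t - s) \<in> C"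
    by (rule viable_curve[OF r(2)[folded K_def] K_def yY r(1) uT[folded K_def] uM[folded K_def]
          less_imp_le[OF T(1)] T(2)]; (assumption | blast))
  have le: "norm (x t - x s) \<le> M * (t - s)" if "0 \<le> s" "s < t" "t \<le> T" for s t
  proof -
    \<comment> \<open>The ball of radius \<open>M\<close> contains all values of \<open>u\<close>,
      so membership of the quotient is the Lipschitz bound.\<close>
    have "(x t - x s) /\<^sub>R (t - s) \<in> cball 0 M"
      using that uM by (intro x(3)[of s t _ "M * (t - s) + 1"]) (auto simp: K_def)
    then show ?thesis using that(2) by (simp add: divide_inverse[symmetric] mult.commute[of "inverse _"] pos_divide_le_eq)
  qed
  have lip: "M-lipschitz_on {0..T} x"
  proof (rule lipschitz_on_leI)
    fix s t assume st: "s \<in> {0..T}" "t \<in> {0..T}" "s \<le> t"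
    show "dist (x s) (x t) \<le> M * dist s t"
    proof (cases "s = t")
      case False
      then show ?thesis using le[of s t] st by (simp add: dist_norm dist_real_def norm_minus_commute)
    qed simp
  qed (rule M)
  \<comment> \<open>Constant continuation past both ends, giving a Lipschitz curve on the whole
    line.\<close>
  define z where "z t = x (max 0 (min T t))" for t
  have "M-lipschitz_on UNIV z"
  proof (rule lipschitz_onI)
    fix s t :: real
    have "dist (z s) (z t) \<le> M * dist (max 0 (min T s)) (max 0 (min T t))"
      unfolding z_def using T(1) by (intro lipschitz_onD[OF lip]) auto
    also have "\<dots> \<le> M * dist s t"
      by (intro mult_left_mono M) (auto simp: dist_real_def max_def min_def)
    finally show "dist (z s) (z t) \<le> M * dist s t" .
  qed (rule M)
  then have neg: "negligible ({t. \<not> z differentiable at t} \<union> {0})"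
    by (intro negligible_Un lipschitz_curve_differentiable_ae negligible_sing)
  have xY: "x t \<in> Y" if "t \<in> {0..T}" for t
    using x(2) that unfolding K_def by blast
  define \<gamma> where "\<gamma> t = chart_inv c (x t)" for t
  have \<gamma>: "\<gamma> t \<in> X" "\<gamma> t \<in> chart_dom c" "chart_map c (\<gamma> t) = x t" if t: "t \<in> {0..T}" for t
  proof -
    obtain q where "x t = chart_map c q" "q \<in> X" "q \<in> chart_dom c" using xY[OF t] by (auto simp: Y_def)
    then show "\<gamma> t \<in> X" "\<gamma> t \<in> chart_dom c" "chart_map c (\<gamma> t) = x t"
      using chart_inv_map[OF cA(1)] by (simp_all add: \<gamma>_def)
  qed
  have "x ` {0..T} \<subseteq> chart_map c ` chart_dom c" using xY unfolding Y_def by blast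
  then have ac: "absolutely_continuous_curve A T \<gamma>"
    unfolding \<gamma>_def by (rule absolutely_continuous_curve_chart_inv[OF cA(1) lip])
  then have cont: "continuous_on {0..<T} \<gamma>" unfolding absolutely_continuous_curve_def by (rule conjunct1)
  have vel: "\<exists>v\<in>krasovskii A X F (\<gamma> t). has_velocity A T \<gamma> t v"
    if t: "t \<in> {0..<T}" "t \<notin> {t. \<not> z differentiable at t} \<union> {0}" for t
  proof -
    have t': "0 < t" "t < T" "t \<in> {0..T}" and "z differentiable at t" using t by auto
    then obtain v where v: "(z has_vector_derivative v) (at t)"
      using vector_derivative_works by blast
    have zx: "z s = x s" if "s \<in> {0..T}" for s using that by (simp add: z_def)
    have ct: "c \<in> charts_at A (\<gamma> t)" using \<gamma>[OF t'(3)] cA by (simp add: charts_at_def)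
    have "v \<in> krasovskii_Rn Y (\<lambda>y. (\<lambda>w. w c) ` F (chart_inv c y)) (x t)"
    proof (rule krasovskii_RnI[of u K])
      show "bounded (u ` K)" using uM unfolding bounded_iff K_def by (intro exI[of _ M]) auto
      show "z \<in> Y \<and> u z \<in> (\<lambda>w. w c) ` F (chart_inv c z)" if "z \<in> K" for z
        using that uF by (auto simp: K_def)
      fix C \<rho> assume C: "closed C" "convex C" and \<rho>: "(\<rho>::real) > 0"
        and uC: "\<And>z. z \<in> K \<inter> cball (x t) \<rho> \<Longrightarrow> u z \<in> C"
      \<comment> \<open>Quotients to the right are used, because the curve property localizes
        \<open>u\<close> around the earlier point.\<close>
      have "((\<lambda>s. (z s - z t) /\<^sub>R (s - t)) \<longlongrightarrow> v) (at_right t)"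
        using has_vector_derivative_quotient[OF has_vector_derivative_at_within[OF v]] .
      moreover have "\<forall>\<^sub>F s in at_right t. (z s - z t) /\<^sub>R (s - t) \<in> C"
      proof -
        \<comment> \<open>Times below \<open>b\<close> satisfy \<open>M * (s - t) < \<rho>\<close>,
          also when \<open>M\<close> is 0.\<close>
        define b where "b = min T (t + \<rho> / (M + 1))"
        have "t < b" using t' \<rho> M by (auto simp: b_def)
        then have "\<forall>\<^sub>F s in at_right t. s \<in> {t<..<b}" by (rule eventually_at_rightI[rotated])
        then show ?thesis
        proof eventually_elim
          case (elim s)
          then have s: "t < s" "s \<le> T" "s \<in> {0..T}" using t' by (auto simp: b_def)
          have "s - t < \<rho> / (M + 1)" using elim by (auto simp: b_def)
          then have "(s - t) * (M + 1) < \<rho>" using M by (subst (asm) pos_less_divide_eq) auto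
          then have "M * (s - t) < \<rho>" using s(1) by (simp add: algebra_simps)
          then have "(x s - x t) /\<^sub>R (s - t) \<in> C"
            using t' s C uC by (intro x(3)) auto
          then show ?case using zx[OF s(3)] zx[OF t'(3)] by simp
        qed
      qed
      ultimately show "v \<in> C"
        by (intro Lim_in_closed_set[OF C(1) _ trivial_limit_at_right_real])
    qed
    then have "from_coord A c (\<gamma> t) v \<in> krasovskii A X F (\<gamma> t)"
      unfolding krasovskii_iff[OF ct projected_field_subset[of X g f, folded F_def]] from_coord_apply_self[OF ct] \<gamma>(3)[OF t'(3)] Y_def
      using from_coord_in[OF ct] by (intro conjI)
    moreover have "((chart_map c \<circ> \<gamma>) has_vector_derivative v) (at t within {0..<T})"
    proof (rule has_vector_derivative_transform_within[OF has_vector_derivative_at_within[OF v] zero_less_one t(1)])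
      fix s assume "s \<in> {0..<T}"
      then have "s \<in> {0..T}" by simp
      then show "z s = (chart_map c \<circ> \<gamma>) s" using zx \<gamma>(3) by simp
    qed
    then have "has_velocity A T \<gamma> t (from_coord A c (\<gamma> t) v)"
      by (rule has_velocityI[OF ct t(1) cont])
    ultimately show ?thesis by blast
  qed
  have "krasovskii_solution A X F p T \<gamma>"
    unfolding krasovskii_solution_def caratheodory_solution_def
  proof (intro conjI T(1) ac)
    show "\<gamma> ` {0..<T} \<subseteq> X" using \<gamma>(1) by auto
    show "\<gamma> 0 = p" using x(1) chart_inv_map[OF cA] by (simp add: \<gamma>_def y0_def)
    show "AE t in lebesgue_on {0..<T}. \<exists>v\<in>krasovskii A X F (\<gamma> t). has_velocity A T \<gamma> t v"
      by (rule AE_lebesgue_onI[OF neg _ vel]) auto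
  qed
  then show ?thesis using T(1) unfolding F_def by blast
qed

section \<open>Clarke regular sets: Krasovskii velocities are projections\<close>

text \<open>For fixed \<open>w\<close> the claim is linear in \<open>v\<close>, so it suffices to
  check limits of projections. There \<open>w\<close> is replaced by tangent vectors
  \<open>ws k\<close> at the approximating points, where the normal condition is a first variation,
  and the limit is taken.\<close>

lemma clarke_regular_normal:
  fixes X :: "'a set" and g :: "('a, 'e) metric"
  assumes g: "riemannian_metric A g" "continuous_metric A g"
    and f: "vector_field_on A X f" "continuous_field A X f" and X: "clarke_regular_mfd A X"
    and p: "p \<in> X" and c: "c \<in> charts_at A p"
  defines "Y \<equiv> chart_map c ` (X \<inter> chart_dom c)" and "y \<equiv> chart_map c p"
  assumes v: "v \<in> krasovskii_Rn Y (\<lambda>y. (\<lambda>w. w c) ` projected_field A X g f (chart_inv c y)) y"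
    and w: "w \<in> tangent_cone Y y"
  shows "metric_coord A c g y (f p c - v) w \<le> 0"
proof -
  have cA: "c \<in> A" "p \<in> chart_dom c" using c by (auto simp: charts_at_def)
  define G where "G = metric_coord A c g"
  have G: "inner_prod (G (chart_map c q))" if "q \<in> chart_dom c" for q
    unfolding G_def using that cA(1) by (intro inner_prod_metric_coord[OF g(1)]) (simp add: charts_at_def)
  have reg: "clarke_regular_at Y (chart_map c q)" if "q \<in> X" "q \<in> chart_dom c" for q
  proof -
    have "c \<in> charts_at A q" using that cA by (simp add: charts_at_def)
    then show ?thesis
      unfolding Y_def using bspec[OF bspec[OF X[unfolded clarke_regular_mfd_def] that(1)]] by simp
  qed
  then have reg': "tangent_cone Y z = clarke_tangent_cone Y z" "locally_compact_set Y" if "z \<in> Y" for z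
    using that unfolding Y_def clarke_regular_at_def by blast+
  have yY: "y \<in> Y" unfolding y_def Y_def using p cA by blast
  define \<alpha> where "\<alpha> = field_coord c f"
  have \<alpha>c: "continuous_on Y \<alpha>" using f(2) cA(1) unfolding continuous_field_def Y_def \<alpha>_def by (rule bspec)
  have \<alpha>: "\<alpha> (chart_map c q) = f q c" if "q \<in> chart_dom c" for q
    unfolding \<alpha>_def field_coord_def chart_inv_map[OF cA(1) that] ..
  define S where "S = {v. \<exists>(ys :: nat \<Rightarrow> 'e) vs. (\<forall>k. ys k \<in> Y \<and> vs k \<in> (\<lambda>w. w c) ` projected_field A X g f (chart_inv c (ys k))) \<and> ys \<longlonglongrightarrow> y \<and> vs \<longlonglongrightarrow> v}"
  \<comment> \<open>A closed half-space, or the whole space if \<open>w\<close> is 0; it therefore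
    contains the closed convex hull as soon as it contains \<open>S\<close>.\<close>
  define H where "H = {v. G y (\<alpha> y - v) w \<le> 0}"
  have Gy: "inner_prod (G y)" unfolding y_def by (rule G[OF cA(2)])
  have "closed H"
    unfolding H_def
    by (intro closed_Collect_le continuous_intros bounded_bilinear.continuous_on[OF inner_prodD(1)[OF Gy]])
  have "convex H"
  proof (rule convexI)
    fix a b and s t :: real assume ab: "a \<in> H" "b \<in> H" and st: "0 \<le> s" "0 \<le> t" "s + t = 1"
    have "\<alpha> y - (s *\<^sub>R a + t *\<^sub>R b) = s *\<^sub>R (\<alpha> y - a) + t *\<^sub>R (\<alpha> y - b)"
      using st(3) by (simp add: scaleR_right_diff_distrib scaleR_left_distrib[symmetric] algebra_simps)
    then have "G y (\<alpha> y - (s *\<^sub>R a + t *\<^sub>R b)) w = s * G y (\<alpha> y - a) w + t * G y (\<alpha> y - b) w"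
      using inner_prodD(1)[OF Gy] by (simp add: bounded_bilinear.add_left bounded_bilinear.scaleR_left)
    also have "\<dots> \<le> 0" using ab st by (simp add: H_def add_nonpos_nonpos mult_nonneg_nonpos)
    finally show "s *\<^sub>R a + t *\<^sub>R b \<in> H" by (simp add: H_def)
  qed
  have "S \<subseteq> H"
  proof
    fix \<eta> assume "\<eta> \<in> S"
    then obtain ys vs where ys: "\<And>k. ys k \<in> Y" "ys \<longlonglongrightarrow> y" and vs: "\<And>k. vs k \<in> (\<lambda>w. w c) ` projected_field A X g f (chart_inv c (ys k))" "vs \<longlonglongrightarrow> \<eta>"
      unfolding S_def by auto
    have "w \<in> clarke_tangent_cone Y y" using w reg'(1)[OF yY] by simp
    then obtain ws where ws: "\<forall>\<^sub>F k in sequentially. ws k \<in> tangent_cone Y (ys k)" "ws \<longlonglongrightarrow> w"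
      using ys unfolding clarke_tangent_cone_def by blast
    have le: "G (ys k) (\<alpha> (ys k) - vs k) (ws k) \<le> 0" if wk: "ws k \<in> tangent_cone Y (ys k)" for k
    proof -
      obtain q where q: "ys k = chart_map c q" "q \<in> X" "q \<in> chart_dom c" using ys(1)[of k] by (auto simp: Y_def)
      have cq: "c \<in> charts_at A q" using q cA by (simp add: charts_at_def)
      have fq: "f q \<in> tangent_space A q" using f(1) q(2) unfolding vector_field_on_def by (rule bspec)
      obtain v' where v': "v' \<in> projected_field A X g f q" "vs k = v' c"
        using vs(1)[of k] unfolding q(1) chart_inv_map[OF cA(1) q(3)] by blast
      then have pr: "vs k \<in> tangent_cone Y (ys k)"
        "\<And>z. z \<in> tangent_cone Y (ys k) \<Longrightarrow> G (ys k) (vs k - f q c) (vs k - f q c) \<le> G (ys k) (z - f q c) (z - f q c)"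
        unfolding projected_field_iff[where f = f, OF cq fq] G_def Y_def q(1) by simp_all
      obtain \<rho> where \<rho>: "\<rho> > 0" "compact (Y \<inter> cball (ys k) \<rho>)"
        using locally_compact_compact_cball[OF reg'(2)[OF ys(1)] ys(1)] by blast
      have "G (ys k) (f q c - vs k) (ws k) \<le> 0"
      proof (rule minimizer_normal[where G = "G (ys k)" and a = "f q c" and v = "vs k" and w = "ws k"])
        show "inner_prod (G (ys k))" unfolding q(1) by (rule G[OF q(3)])
        fix s :: real assume "s > 0"
        \<comment> \<open>Regularity at \<open>ys k\<close> makes this multiple a Clarke tangent
          vector, so the varied point \<open>vs k + s *\<^sub>R ws k\<close> written here as
          \<open>vs k\<close> plus that multiple stays in the cone and competes with the
          projection.\<close>
        then have "s *\<^sub>R ws k \<in> clarke_tangent_cone Y (ys k)"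
          using tangent_cone_scaleR[OF wk] reg'(1)[OF ys(1)] by simp
        then show "G (ys k) (vs k - f q c) (vs k - f q c) \<le> G (ys k) (vs k + s *\<^sub>R ws k - f q c) (vs k + s *\<^sub>R ws k - f q c)"
          by (intro pr(2) tangent_cone_add[OF \<rho> pr(1)])
      qed
      then show ?thesis unfolding q(1) \<alpha>[OF q(3)] .
    qed
    have Gexp: "G (chart_map c q) a b = (\<Sum>i\<in>Basis. \<Sum>j\<in>Basis. (a \<bullet> i) * (b \<bullet> j) * G (chart_map c q) i j)"
      if "q \<in> chart_dom c" for q a b
      by (rule bilinear_expansion[OF inner_prodD(1)[OF G[OF that]]])
    have Gexp': "G z a b = (\<Sum>i\<in>Basis. \<Sum>j\<in>Basis. (a \<bullet> i) * (b \<bullet> j) * G z i j)" if z: "z \<in> Y" for z a b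
    proof -
      obtain q where "z = chart_map c q" "q \<in> chart_dom c" using z unfolding Y_def by blast
      then show ?thesis using Gexp by simp
    qed
    have Glim: "(\<lambda>k. G (ys k) i j) \<longlonglongrightarrow> G y i j" if "i \<in> Basis" "j \<in> Basis" for i j
    proof -
      have cont: "continuous_on (chart_map c ` chart_dom c) (\<lambda>y. G y i j)"
        using g(2) cA(1) that unfolding continuous_metric_def G_def by blast
      have "Y \<subseteq> chart_map c ` chart_dom c" unfolding Y_def by blast
      from continuous_on_tendsto_compose[OF continuous_on_subset[OF cont this] ys(2) yY]
      show ?thesis by (simp add: ys(1))
    qed
    have \<alpha>lim: "(\<lambda>k. \<alpha> (ys k)) \<longlonglongrightarrow> \<alpha> y"
      by (rule continuous_on_tendsto_compose[OF \<alpha>c ys(2) yY]) (simp add: ys(1))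
    have "(\<lambda>k. G (ys k) (\<alpha> (ys k) - vs k) (ws k)) \<longlonglongrightarrow> G y (\<alpha> y - \<eta>) w"
    proof -
      \<comment> \<open>The form varies with \<open>k\<close>; after expansion in the basis only
        products of convergent scalars remain.\<close>
      have "(\<lambda>k. \<Sum>i\<in>Basis. \<Sum>j\<in>Basis. ((\<alpha> (ys k) - vs k) \<bullet> i) * (ws k \<bullet> j) * G (ys k) i j)
          \<longlonglongrightarrow> (\<Sum>i\<in>Basis. \<Sum>j\<in>Basis. ((\<alpha> y - \<eta>) \<bullet> i) * (w \<bullet> j) * G y i j)"
        by (intro tendsto_sum tendsto_mult tendsto_inner tendsto_diff tendsto_const \<alpha>lim vs(2) ws(2) Glim)
      moreover have "(\<lambda>k. G (ys k) (\<alpha> (ys k) - vs k) (ws k)) =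
          (\<lambda>k. \<Sum>i\<in>Basis. \<Sum>j\<in>Basis. ((\<alpha> (ys k) - vs k) \<bullet> i) * (ws k \<bullet> j) * G (ys k) i j)"
        by (rule ext) (rule Gexp'[OF ys(1)])
      ultimately show ?thesis
        by (simp only: Gexp'[OF yY, of "\<alpha> y - \<eta>" w])
    qed
    then have "G y (\<alpha> y - \<eta>) w \<le> 0"
      by (rule tendsto_upperbound) (use ws(1) le in \<open>auto elim: eventually_mono\<close>)
    then show "\<eta> \<in> H" by (simp add: H_def)
  qed
  then have "closure (convex hull S) \<subseteq> H"
    using \<open>closed H\<close> \<open>convex H\<close> by (intro closure_minimal hull_minimal)
  then have "v \<in> H" using v unfolding krasovskii_Rn_def S_def by blast
  moreover have "\<alpha> y = f p c" unfolding y_def by (rule \<alpha>[OF cA(2)])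
  ultimately show ?thesis by (simp add: H_def G_def)
qed

text \<open>Time 0 is excluded because tangency of \<open>- v\<close> comes from earlier times; at
  interior times the derivative within the interval is two-sided.\<close>

lemma krasovskii_velocity_projected:
  fixes X :: "'a set" and g :: "('a, 'e) metric"
  assumes g: "riemannian_metric A g" "continuous_metric A g"
    and f: "vector_field_on A X f" "continuous_field A X f" and X: "clarke_regular_mfd A X"
    and x: "continuous_on {0..<T} x" "x ` {0..<T} \<subseteq> X" and t: "0 < t" "t < T"
    and v: "v \<in> krasovskii A X (projected_field A X g f) (x t)" "has_velocity A T x t v"
  shows "v \<in> projected_field A X g f (x t)"
proof -
  obtain c where c: "c \<in> charts_at A (x t)" using obtain_chart by blast
  have cA: "c \<in> A" "x t \<in> chart_dom c" using c by (auto simp: charts_at_def)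
  have t': "t \<in> {0..<T}" using t by simp
  then have xX: "x t \<in> X" using x(2) by blast
  have fx: "f (x t) \<in> tangent_space A (x t)" using f(1) xX unfolding vector_field_on_def by (rule bspec)
  let ?Y = "chart_map c ` (X \<inter> chart_dom c)" and ?y = "chart_map c (x t)"
  let ?G = "metric_coord A c g ?y"
  have G: "inner_prod ?G" by (rule inner_prod_metric_coord[OF g(1) c])
  have vT: "v \<in> tangent_space A (x t)" and vel: "((chart_map c \<circ> x) has_vector_derivative v c) (at t within {0..<T})"
    using v(2) c unfolding has_velocity_def by blast+
  have "at t within {0..<T} = at t"
    using t by (intro at_within_interior) simp
  then have vel': "((chart_map c \<circ> x) has_vector_derivative v c) (at t)" using vel by simp
  obtain \<delta> where \<delta>: "\<delta> > 0" "\<And>s. s \<in> {0..<T} \<Longrightarrow> dist s t < \<delta> \<Longrightarrow> x s \<in> chart_dom c"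
    using obtain_near_chart[OF cA(1) x(1) t' cA(2)] by blast
  have "\<forall>\<^sub>F s in nhds t. (chart_map c \<circ> x) s \<in> ?Y"
  proof -
    have "\<forall>\<^sub>F s in nhds t. s \<in> {0<..<T}" using t by (intro eventually_nhds_in_open) auto
    moreover have "\<forall>\<^sub>F s in nhds t. dist s t < \<delta>" using \<delta>(1) unfolding eventually_nhds_metric by blast
    ultimately show ?thesis
    proof eventually_elim
      case (elim s)
      then have "s \<in> {0..<T}" by simp
      then have "x s \<in> X \<inter> chart_dom c" using \<delta>(2)[OF _ elim(2)] x(2) by blast
      then show ?case by simp
    qed
  qed
  from velocity_in_tangent_cone[OF vel' this]
  have pm: "v c \<in> tangent_cone ?Y ?y" "- v c \<in> tangent_cone ?Y ?y" by simp_all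
  have vK: "v c \<in> krasovskii_Rn ?Y (\<lambda>y. (\<lambda>w. w c) ` projected_field A X g f (chart_inv c y)) ?y"
    using v(1) unfolding krasovskii_iff[OF c projected_field_subset] by (rule conjunct2)
  note normal = clarke_regular_normal[OF g f X xX c vK]
  \<comment> \<open>Normality tested on \<open>- v c\<close> gives the second sign needed by
    \<open>minimizer_if_normal\<close>; tested on \<open>w\<close> it gives the first.\<close>
  have "?G (f (x t) c - v c) (- v c) = - ?G (f (x t) c - v c) (v c)"
    by (rule bounded_bilinear.minus_right[OF inner_prodD(1)[OF G]])
  then have "0 \<le> ?G (f (x t) c - v c) (v c)" using normal[OF pm(2)] by simp
  then have "?G (v c - f (x t) c) (v c - f (x t) c) \<le> ?G (w - f (x t) c) (w - f (x t) c)" if "w \<in> tangent_cone ?Y ?y" for w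
    by (rule minimizer_if_normal[OF G normal[OF that]])
  then show ?thesis
    unfolding projected_field_iff[where f = f, OF c fx] using vT pm(1) by (intro conjI ballI)
qed

lemma krasovskii_iff_caratheodory:
  fixes X :: "'a set" and g :: "('a, 'e) metric"
  assumes g: "riemannian_metric A g" "continuous_metric A g"
    and f: "vector_field_on A X f" "continuous_field A X f" and X: "clarke_regular_mfd A X"
  shows "krasovskii_solution A X (projected_field A X g f) p T x \<longleftrightarrow>
    caratheodory_solution A X (projected_field A X g f) p T x"
proof -
  let ?F = "projected_field A X g f"
  have "(AE t in lebesgue_on {0..<T}. \<exists>v\<in>krasovskii A X ?F (x t). has_velocity A T x t v) \<longleftrightarrow>
      (AE t in lebesgue_on {0..<T}. \<exists>v\<in>?F (x t). has_velocity A T x t v)"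
    if x: "x ` {0..<T} \<subseteq> X" "absolutely_continuous_curve A T x"
  proof
    assume "AE t in lebesgue_on {0..<T}. \<exists>v\<in>krasovskii A X ?F (x t). has_velocity A T x t v"
    \<comment> \<open>The initial time, where no earlier times exist, forms a null set.\<close>
    moreover have "AE t in lebesgue_on {0..<T}. 0 < t \<and> t < T"
      by (rule AE_lebesgue_onI[of "{0}"]) auto
    ultimately show "AE t in lebesgue_on {0..<T}. \<exists>v\<in>?F (x t). has_velocity A T x t v"
    proof eventually_elim
      case (elim t)
      have "continuous_on {0..<T} x" using x(2) unfolding absolutely_continuous_curve_def by (rule conjunct1)
      then show ?case using elim krasovskii_velocity_projected[OF g f X _ x(1)] by blast
    qed
  next
    assume "AE t in lebesgue_on {0..<T}. \<exists>v\<in>?F (x t). has_velocity A T x t v"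
    moreover have "AE t in lebesgue_on {0..<T}. t \<in> {0..<T}"
      by (rule AE_lebesgue_onI[of "{}"]) auto
    ultimately show "AE t in lebesgue_on {0..<T}. \<exists>v\<in>krasovskii A X ?F (x t). has_velocity A T x t v"
    proof eventually_elim
      case (elim t)
      then obtain v where v: "v \<in> ?F (x t)" "has_velocity A T x t v" by blast
      have "x t \<in> X" using elim(2) x(1) by blast
      then have "v \<in> krasovskii A X ?F (x t)"
        by (rule values_in_krasovskii[where F = ?F, OF _ v(1) subsetD[OF projected_field_subset v(1)]])
      then show ?case using v(2) by blast
    qed
  qed
  then show ?thesis
    unfolding krasovskii_solution_def caratheodory_solution_def by blast
qed

end

theorem theorem7p4:
  fixes A :: "('a::{t2_space, second_countable_topology}, 'e::euclidean_space) chart set"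
    and g :: "('a, 'e) metric"
    and X :: "'a set"
    and f :: "'a \<Rightarrow> ('a, 'e) tvec"
  assumes "C1_structure A"
    and "riemannian_metric A g" and "locally_weakly_bounded A g"
    and "locally_compact_set X"
    and "vector_field_on A X f" and "locally_bounded_field A X f"
  shows "(\<forall>x0\<in>X. \<exists>T>0. \<exists>x. krasovskii_solution A X (projected_field A X g f) x0 T x) \<and>
    (clarke_regular_mfd A X \<and> continuous_field A X f \<and> continuous_metric A g \<longrightarrow>
      (\<forall>x0\<in>X. \<forall>T>0. \<forall>x. krasovskii_solution A X (projected_field A X g f) x0 T x \<longleftrightarrow>
         caratheodory_solution A X (projected_field A X g f) x0 T x))"
proof -
  interpret C1_manifold A by unfold_locales (rule assms(1))
  show ?thesis
    using krasovskii_solution_exists[OF assms(2-6)] krasovskii_iff_caratheodory[OF assms(2) _ assms(5)]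
    by simp
qed

end
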